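(* Let $(\mu_n)_{n\in\mathbb N}$ be a sequence of Fourier transformable measures on $\mathbb R^d$, and let $\mu$ be a measure on $\mathbb R^d$ such that (i) $(\mu_n)_{n\in\mathbb N}$ converges vaguely to $\mu$, (ii) $\mu$ is tempered, (iii) $\{\widehat{\mu_n} : n\in\mathbb N\}$ is a set of equi translation bounded measures. Then $\mu$ is Fourier transformable and $\lim_{n\to\infty}\widehat{\mu_n}=\widehat{\mu}$ in the vague topology.
   Context: A measure on $\mathbb R^d$ is a (complex) Radon measure, equivalently a linear functional $\mu$ on $C_c(\mathbb R^d)$ such that for every compact $K$ there is $a_K$ with $|\mu(g)|\le a_K\|g\|_\infty$ whenever $\mathrm{supp}(g)\subseteq K$; $|\mu|$ denotes its total variation measure. Conventions: $\widehat f(y)=\int f(x)e^{-2\pi i xy}\,dx$, $\check f(y)=\int f(x)e^{2\pi i xy}\,dx$, $\widetilde f(x)=\overline{f(-x)}$. A measure $\mu$ is Fourier transformable if there is a measure $\widehat\mu$ with $\check f\in L^2(\widehat\mu)$ and $\mu(f*\widetilde f)=\widehat\mu(|\check f|^2)$ for all $f\in C_c(\mathbb R^d)$; $\widehat\mu$ is its Fourier transform. A measure is tempered if it defines a tempered distribution. $\mu$ is translation bounded if $\|\mu\|_K:=\sup_{t\in\mathbb R^d}|\mu|(t+K)<\infty$ for all compact $K$; a family $(\mu_\alpha)$ is equi translation bounded if $\sup_\alpha\|\mu_\alpha\|_K<\infty$ for all compact $K$. $\mu_n\to\mu$ vaguely means $\mu_n(f)\to\mu(f)$ for all $f\in C_c(\mathbb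 R^d)$. *)

theory Defs
  imports "HOL-Analysis.Analysis"
begin

text \<open>The space R^d is modelled by an arbitrary Euclidean space type 'a.
  A (complex Radon) measure is a linear functional on C_c('a), as in the paper.\<close>

definition supp :: "('a::euclidean_space \<Rightarrow> complex) \<Rightarrow> 'a set" where
  "supp g = closure {x. g x \<noteq> 0}"

definition Cc :: "('a::euclidean_space \<Rightarrow> complex) set" where
  "Cc = {g. continuous_on UNIV g \<and> compact (supp g)}"

definition supn :: "('a::euclidean_space \<Rightarrow> complex) \<Rightarrow> real" where
  "supn g = (SUP x. cmod (g x))"

definition is_measure :: "(('a::euclidean_space \<Rightarrow> complex) \<Rightarrow> complex) \<Rightarrow> bool" where
  "is_measure \<mu> \<longleftrightarrow>
     (\<forall>f\<in>Cc. \<forall>g\<in>Cc. \<mu> (\<lambda>x. f x + g x) = \<mu> f + \<mu> g) \<and>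
     (\<forall>c. \<forall>g\<in>Cc. \<mu> (\<lambda>x. c * g x) = c * \<mu> g) \<and>
     (\<forall>K. compact K \<longrightarrow> (\<exists>a. \<forall>g\<in>Cc. supp g \<subseteq> K \<longrightarrow> cmod (\<mu> g) \<le> a * supn g))"

text \<open>Total variation |mu|: on open sets via the Riesz formula, on arbitrary sets
  (in particular compact sets) by outer regularity.\<close>

definition tv_open :: "(('a::euclidean_space \<Rightarrow> complex) \<Rightarrow> complex) \<Rightarrow> 'a set \<Rightarrow> ennreal" where
  "tv_open \<mu> U = (SUP g\<in>{g\<in>Cc. supp g \<subseteq> U \<and> supn g \<le> 1}. ennreal (cmod (\<mu> g)))"

definition tv :: "(('a::euclidean_space \<Rightarrow> complex) \<Rightarrow> complex) \<Rightarrow> 'a set \<Rightarrow> ennreal" where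
  "tv \<mu> A = (INF U\<in>{U. open U \<and> A \<subseteq> U}. tv_open \<mu> U)"

definition equi_translation_bounded :: "(nat \<Rightarrow> (('a::euclidean_space \<Rightarrow> complex) \<Rightarrow> complex)) \<Rightarrow> bool" where
  "equi_translation_bounded \<nu> \<longleftrightarrow>
     (\<forall>K. compact K \<longrightarrow> (SUP n. SUP t. tv (\<nu> n) ((\<lambda>x. t + x) ` K)) < \<infinity>)"

text \<open>Representation of a Radon measure by its variation measure M and polar density h
  (Riesz), used to integrate non-compactly-supported functions against it.\<close>

definition radon_rep :: "(('a::euclidean_space \<Rightarrow> complex) \<Rightarrow> complex) \<Rightarrow> 'a measure \<Rightarrow> ('a \<Rightarrow> complex) \<Rightarrow> bool" where
  "radon_rep \<mu> M h \<longleftrightarrow>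
     sets M = sets borel \<and> (\<forall>K. compact K \<longrightarrow> emeasure M K < \<infinity>) \<and>
     h \<in> borel_measurable M \<and> (AE x in M. cmod (h x) = 1) \<and>
     (\<forall>g\<in>Cc. integrable M (\<lambda>x. g x * h x) \<and> \<mu> g = (\<integral>x. g x * h x \<partial>M))"

definition inv_ft :: "('a::euclidean_space \<Rightarrow> complex) \<Rightarrow> 'a \<Rightarrow> complex" where
  "inv_ft f y = (\<integral>x. f x * exp (complex_of_real (2 * pi * (x \<bullet> y)) * \<i>) \<partial>lborel)"

definition tilde :: "('a::euclidean_space \<Rightarrow> complex) \<Rightarrow> 'a \<Rightarrow> complex" where
  "tilde f x = cnj (f (- x))"

definition conv :: "('a::euclidean_space \<Rightarrow> complex) \<Rightarrow> ('a \<Rightarrow> complex) \<Rightarrow> 'a \<Rightarrow> complex" where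
  "conv f g x = (\<integral>y. f y * g (x - y) \<partial>lborel)"

definition is_fourier_transform ::
  "(('a::euclidean_space \<Rightarrow> complex) \<Rightarrow> complex) \<Rightarrow> (('a \<Rightarrow> complex) \<Rightarrow> complex) \<Rightarrow> bool" where
  "is_fourier_transform \<mu> \<nu> \<longleftrightarrow> is_measure \<nu> \<and>
     (\<exists>M h. radon_rep \<nu> M h \<and>
        (\<forall>f\<in>Cc. integrable M (\<lambda>y. (cmod (inv_ft f y))\<^sup>2) \<and>
                 \<mu> (conv f (tilde f)) = (\<integral>y. complex_of_real ((cmod (inv_ft f y))\<^sup>2) * h y \<partial>M)))"

definition fourier_transformable :: "(('a::euclidean_space \<Rightarrow> complex) \<Rightarrow> complex) \<Rightarrow> bool" where
  "fourier_transformable \<mu> \<longleftrightarrow> (\<exists>\<nu>. is_fourier_transform \<mu> \<nu>)"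

definition vague_conv :: "(nat \<Rightarrow> (('a::euclidean_space \<Rightarrow> complex) \<Rightarrow> complex)) \<Rightarrow> (('a \<Rightarrow> complex) \<Rightarrow> complex) \<Rightarrow> bool" where
  "vague_conv \<mu>s \<mu> \<longleftrightarrow> (\<forall>g\<in>Cc. (\<lambda>n. \<mu>s n g) \<longlonglongrightarrow> \<mu> g)"

fun pdl :: "'a list \<Rightarrow> ('a::euclidean_space \<Rightarrow> complex) \<Rightarrow> 'a \<Rightarrow> complex" where
  "pdl [] \<phi> = \<phi>"
| "pdl (b # bs) \<phi> = (\<lambda>x. frechet_derivative (pdl bs \<phi>) (at x) b)"

definition smooth :: "('a::euclidean_space \<Rightarrow> complex) \<Rightarrow> bool" where
  "smooth \<phi> \<longleftrightarrow> (\<forall>bs. set bs \<subseteq> Basis \<longrightarrow> (\<forall>x. pdl bs \<phi> differentiable at x))"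

definition schwartz_seminorm :: "nat \<Rightarrow> ('a::euclidean_space \<Rightarrow> complex) \<Rightarrow> real" where
  "schwartz_seminorm N \<phi> =
     (\<Sum>bs\<in>{bs. set bs \<subseteq> Basis \<and> length bs \<le> N}. SUP x. (1 + norm x) ^ N * cmod (pdl bs \<phi> x))"

definition tempered :: "(('a::euclidean_space \<Rightarrow> complex) \<Rightarrow> complex) \<Rightarrow> bool" where
  "tempered \<mu> \<longleftrightarrow> (\<exists>C N. \<forall>\<phi>\<in>Cc. smooth \<phi> \<longrightarrow> cmod (\<mu> \<phi>) \<le> C * schwartz_seminorm N \<phi>)"

end

theory Submission
  imports Defs "HOL-Probability.Characteristic_Functions"
begin

text \<open>Every functional on \<open>Cc\<close> that is a measure is represented by a positive Borel measure \<open>M\<close> and a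
  unimodular density, with \<open>M\<close> controlled by the total variation; so the representing measures of
  the \<open>\<nu>s n\<close> give uniformly bounded mass to unit balls. For \<open>f\<close> in \<open>Cc\<close> the energy \<open>|inv_ft f|\<^sup>2\<close> is dominated
  by local averages of an integrable function, hence its integral against the \<open>\<nu>s n\<close> is uniformly
  tight; and by vague convergence of the \<open>\<mu>s n\<close> at \<open>f * tilde f\<close> these integrals converge to \<open>\<mu> (f * tilde f)\<close>.
  Polarization and a Gaussian approximation show that energies span a set rich enough to force
  convergence of \<open>\<nu>s n g\<close> for all \<open>g\<close> in \<open>Cc\<close>, so no compactness argument is needed. Tightness lets
  the energy identity pass to the limit.\<close>

section \<open>Riesz representation of positive functionals\<close>

text \<open>Vague convergence tests only functions of compact support, which energies do not have in
  general. Uniform mass on unit balls alone does not repair this: an integrable function may be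
  large exactly where some \<open>\<nu>s n\<close> puts its mass. Replacing the value of an energy
  at a point by a Lebesgue integral over a unit ball does: after Fubini the tail is the ball bound
  times a Lebesgue tail that no longer sees the measure.

  Division by the transform of a narrow bump serves twice: to write \<open>f\<close> as a test
  function times a transform, whence the local average, and to write \<open>g\<close> as an energy
  times a test function \<open>u\<close>. Gaussians serve twice as well, since their transform is
  explicit: damping by them proves energies integrable, and convolution with their transforms
  approximates \<open>u\<close> uniformly.

  The pair in \<open>is_fourier_transform\<close> is just some representing pair, and mass bounds
  are stated through \<open>tv\<close>. So a pair with
  \<open>emeasure M K \<le> 6 * tv \<nu> K\<close> is constructed and exchanged for the given one.
  The factor 6 is 2 from the dominating functional times 3 from the crude bound on the density; only
  its independence of \<open>n\<close> matters.\<close>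

definition Ccp :: "('a::euclidean_space \<Rightarrow> real) set" where
  "Ccp = {f. continuous_on UNIV f \<and> (\<forall>x. 0 \<le> f x) \<and> bounded {x. f x \<noteq> 0}}"

lemma CcpD:
  assumes "f \<in> Ccp"
  shows "continuous_on UNIV f" "0 \<le> f x" "bounded {x. f x \<noteq> 0}"
  using assms by (auto simp: Ccp_def)

lemma Ccp_mult:
  assumes "f \<in> Ccp" "continuous_on UNIV g" "\<And>x. 0 \<le> g x"
  shows "(\<lambda>x. f x * g x) \<in> Ccp"
  using assms unfolding Ccp_def
  by (auto intro!: continuous_on_mult intro: bounded_subset)

lemma Ccp_add:
  assumes "f \<in> Ccp" "g \<in> Ccp"
  shows "(\<lambda>x. f x + g x) \<in> Ccp"
proof -
  have "bounded ({x. f x \<noteq> 0} \<union> {x. g x \<noteq> 0})" using assms by (auto simp: Ccp_def)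
  then have "bounded {x. f x + g x \<noteq> 0}" by (rule bounded_subset) auto
  then show ?thesis using assms by (auto simp: Ccp_def intro!: continuous_on_add)
qed

lemma Ccp_dominated:
  assumes "f \<in> Ccp" "continuous_on UNIV g" "\<And>x. 0 \<le> g x" "\<And>x. g x \<le> f x"
  shows "g \<in> Ccp"
proof -
  have "{x. g x \<noteq> 0} \<subseteq> {x. f x \<noteq> 0}" using assms(3,4) 
    by (metis (mono_tags, lifting) Collect_mono antisym)
  then show ?thesis using assms(1-3) unfolding Ccp_def by (auto intro: bounded_subset)
qed

lemma Ccp_zero: "(\<lambda>x. 0) \<in> Ccp" by (simp add: Ccp_def)

lemma Ccp_bounded:
  assumes "f \<in> Ccp" 
  obtains B where "B > 0" "\<And>x. f x \<le> B"
proof -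
  let ?S = "closure {x. f x \<noteq> 0}"
  have "compact ?S" using CcpD(3)[OF assms] by (simp add: compact_closure)
  then have "compact (f ` ?S)" using CcpD(1)[OF assms]
    by (meson compact_continuous_image continuous_on_subset subset_UNIV)
  then obtain B where B: "\<And>y. y \<in> f ` ?S \<Longrightarrow> norm y \<le> B" using compact_imp_bounded bounded_iff by metis
  have "f x \<le> max B 1" for x
  proof (cases "f x = 0")
    case False
    then have "x \<in> ?S" using closure_subset[of "{x. f x \<noteq> 0}"] by auto
    then have "norm (f x) \<le> B" using B by blast
    then show ?thesis by simp
  qed auto
  then show ?thesis using that[of "max B 1"] by auto
qed

text \<open>A tent function of \<open>infdist x K\<close> works: the closed
  \<open>d\<close>-neighbourhood of a compact set is compact, and for small \<open>d\<close> it
  stays inside \<open>U\<close>.\<close>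

lemma Ccp_bump:
  assumes K: "compact K" and U: "open U" "K \<subseteq> U"
  obtains f where "f \<in> Ccp" "\<And>x. x \<in> K \<Longrightarrow> f x = 1" "\<And>x. f x \<le> 1" "closure {x. f x \<noteq> 0} \<subseteq> U"
proof (cases "K = {}")
  case True
  then show ?thesis using that[of "\<lambda>x. 0"] by (simp add: Ccp_zero)
next
  case False
  obtain d where d: "d > 0" "{x. infdist x K \<le> d} \<subseteq> U"
    by (rule compact_in_open_separated[OF False K U])
  define f where "f = (\<lambda>x. max 0 (1 - infdist x K / d))"
  have "{x. f x \<noteq> 0} \<subseteq> {x. infdist x K \<le> d}" using d(1) by (auto simp: f_def max_def field_simps split: if_splits)
  moreover have c: "compact {x. infdist x K \<le> d}" by (rule compact_infdist_le[OF False K d(1)])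
  ultimately have cl: "closure {x. f x \<noteq> 0} \<subseteq> {x. infdist x K \<le> d}"
    by (intro closure_minimal compact_imp_closed)
  then have "bounded {x. f x \<noteq> 0}" using c by (meson bounded_subset closure_subset compact_imp_bounded order_trans)
  then have "f \<in> Ccp" unfolding Ccp_def f_def by (auto intro!: continuous_intros)
  then show ?thesis
  proof (rule that)
    show "f x = 1" if "x \<in> K" for x using that by (simp add: f_def)
    show "f x \<le> 1" for x using d(1) infdist_nonneg[of x K] by (simp add: f_def)
    show "closure {x. f x \<noteq> 0} \<subseteq> U" using cl d by auto
  qed
qed

text \<open>Additivity is asked on the nonnegative cone only, because the total variation
  \<open>tvf\<close> used later is additive only there.\<close>

locale positive_functional =
  fixes L :: "('a::euclidean_space \<Rightarrow> real) \<Rightarrow> real"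
  assumes L_add: "f \<in> Ccp \<Longrightarrow> g \<in> Ccp \<Longrightarrow> L (\<lambda>x. f x + g x) = L f + L g"
    and L_scale: "f \<in> Ccp \<Longrightarrow> 0 \<le> c \<Longrightarrow> L (\<lambda>x. c * f x) = c * L f"
    and L_nonneg: "f \<in> Ccp \<Longrightarrow> 0 \<le> L f"
begin

lemma L_zero: "L (\<lambda>x. 0) = 0"
  using L_scale[OF Ccp_zero, of 0] by simp

lemma L_mono:
  assumes "f \<in> Ccp" "g \<in> Ccp" "\<And>x. f x \<le> g x"
  shows "L f \<le> L g"
proof -
  have h: "(\<lambda>x. g x - f x) \<in> Ccp"
    by (rule Ccp_dominated[OF assms(2)]) 
       (use assms CcpD(1)[OF assms(1)] CcpD(1)[OF assms(2)] CcpD(2)[OF assms(1)] in \<open>auto intro!: continuous_on_diff\<close>)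
  have "L g = L (\<lambda>x. f x + (g x - f x))" by simp
  also have "\<dots> = L f + L (\<lambda>x. g x - f x)" by (rule L_add[OF assms(1) h])
  finally show ?thesis using L_nonneg[OF h] by simp
qed

lemma L_sum:
  assumes "finite I" "\<And>i. i \<in> I \<Longrightarrow> f i \<in> Ccp"
  shows "(\<lambda>x. \<Sum>i\<in>I. f i x) \<in> Ccp \<and> L (\<lambda>x. \<Sum>i\<in>I. f i x) = (\<Sum>i\<in>I. L (f i))"
  using assms
proof (induction rule: finite_induct)
  case empty then show ?case by (simp add: L_zero Ccp_zero)
next
  case (insert i I)
  then show ?case using L_add[of "f i" "\<lambda>x. \<Sum>i\<in>I. f i x"] Ccp_add[of "f i" "\<lambda>x. \<Sum>i\<in>I. f i x"] by simp
qed

text \<open>A Daniell-style outer measure: sets are covered directly by countable sums of functions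
  in \<open>Ccp\<close>, without passing through open sets. A cover can then be cut in two by
  multiplying it with a continuous function.\<close>

definition outer :: "'a set \<Rightarrow> ennreal" where
  "outer A = (INF F\<in>{F. (\<forall>n::nat. F n \<in> Ccp) \<and> (\<forall>x\<in>A. 1 \<le> (\<Sum>n. ennreal (F n x)))}. \<Sum>n. ennreal (L (F n)))"

lemma outer_le:
  assumes "\<And>n::nat. F n \<in> Ccp" "\<And>x. x \<in> A \<Longrightarrow> 1 \<le> (\<Sum>n. ennreal (F n x))"
  shows "outer A \<le> (\<Sum>n. ennreal (L (F n)))"
  unfolding outer_def by (rule INF_lower) (use assms in auto)

text \<open>Covers indexed by pairs are admissible: \<open>prod_decode\<close> enumerates the pairs,
  and nonnegative double series may be reordered.\<close>

lemma outer_le_double: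
  assumes "\<And>i j::nat. F i j \<in> Ccp" "\<And>x. x \<in> A \<Longrightarrow> 1 \<le> (\<Sum>i. \<Sum>j. ennreal (F i j x))"
  shows "outer A \<le> (\<Sum>i. \<Sum>j. ennreal (L (F i j)))"
proof -
  define G where "G = (\<lambda>n. case_prod F (prod_decode n))"
  have "outer A \<le> (\<Sum>n. ennreal (L (G n)))"
  proof (rule outer_le)
    show "G n \<in> Ccp" for n by (simp add: G_def assms split: prod.split)
    fix x assume x: "x \<in> A"
    have "(\<Sum>n. ennreal (G n x)) = (\<Sum>n. (\<lambda>(i,j). ennreal (F i j x)) (prod_decode n))"
      by (simp add: G_def split_beta)
    also have "\<dots> = (\<Sum>i. \<Sum>j. ennreal (F i j x))"
      by (rule suminf_ennreal_2dimen) simp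
    finally show "1 \<le> (\<Sum>n. ennreal (G n x))" using assms(2)[OF x] by simp
  qed
  also have "(\<Sum>n. ennreal (L (G n))) = (\<Sum>n. (\<lambda>(i,j). ennreal (L (F i j))) (prod_decode n))"
    by (simp add: G_def split_beta)
  also have "\<dots> = (\<Sum>i. \<Sum>j. ennreal (L (F i j)))"
    by (rule suminf_ennreal_2dimen) simp
  finally show ?thesis .
qed

lemma outer_le_single:
  assumes "f \<in> Ccp" "\<And>x. x \<in> A \<Longrightarrow> 1 \<le> f x"
  shows "outer A \<le> ennreal (L f)"
proof -
  define F where "F = (\<lambda>n::nat. if n = 0 then f else (\<lambda>x. 0))"
  have *: "(\<Sum>n. ennreal (h (F n))) = ennreal (h f)" if "h (\<lambda>x. 0) = 0" for h
  proof -
    have "(\<Sum>n. ennreal (h (F n))) = (\<Sum>n\<in>{0}. ennreal (h (F n)))"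
      by (rule suminf_finite) (auto simp: F_def that)
    then show ?thesis by (simp add: F_def)
  qed
  have "outer A \<le> (\<Sum>n. ennreal (L (F n)))"
  proof (rule outer_le)
    show "F n \<in> Ccp" for n by (simp add: F_def assms Ccp_zero)
    show "1 \<le> (\<Sum>n. ennreal (F n x))" if "x \<in> A" for x
      using *[of "\<lambda>f. f x"] assms(2)[OF that] by (simp add: ennreal_1[symmetric] del: ennreal_1)
  qed
  then show ?thesis using *[of L] L_zero by simp
qed

lemma outer_mono: "A \<subseteq> B \<Longrightarrow> outer A \<le> outer B"
  unfolding outer_def by (rule INF_superset_mono) auto

lemma outer_empty: "outer {} = 0"
  using outer_le_single[OF Ccp_zero, of "{}"] L_zero by simp

lemma outer_approx:
  assumes "outer A < \<infinity>" "0 < (e::real)"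
  obtains F where "\<And>n::nat. F n \<in> Ccp" "\<And>x. x \<in> A \<Longrightarrow> 1 \<le> (\<Sum>n. ennreal (F n x))"
    "(\<Sum>n. ennreal (L (F n))) \<le> outer A + ennreal e"
proof -
  have "outer A < outer A + ennreal e" using assms 
    by (metis ennreal_add_left_cancel_less add.right_neutral ennreal_less_zero_iff infinity_ennreal_def)
  then show ?thesis using that unfolding outer_def INF_less_iff by (force intro: less_imp_le)
qed

lemma outer_countably_subadditive: "outer (\<Union>i. A (i::nat)) \<le> (\<Sum>i. outer (A i))"
proof (rule ennreal_le_epsilon)
  fix e :: real assume fin: "(\<Sum>i. outer (A i)) < top" and e: "0 < e"
  have fin': "outer (A i) < \<infinity>" for i using fin
    by (metis ennreal_suminf_lessD infinity_ennreal_def)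
  have "\<exists>F. (\<forall>n::nat. F n \<in> Ccp) \<and> (\<forall>x\<in>A i. 1 \<le> (\<Sum>n. ennreal (F n x))) \<and>
    (\<Sum>n. ennreal (L (F n))) \<le> outer (A i) + ennreal (e * (1/2)^Suc i)" for i
    by (rule outer_approx[OF fin', of "e * (1/2)^Suc i" i]) (use e in auto)
  then obtain F where F: "\<And>i n. F i n \<in> Ccp" "\<And>i x. x \<in> A i \<Longrightarrow> 1 \<le> (\<Sum>n. ennreal (F i n x))"
    "\<And>i. (\<Sum>n. ennreal (L (F i (n::nat)))) \<le> outer (A i) + ennreal (e * (1/2)^Suc i)" by metis
  have "outer (\<Union>i. A i) \<le> (\<Sum>i. \<Sum>j. ennreal (L (F i j)))"
  proof (rule outer_le_double[OF F(1)])
    fix x assume "x \<in> (\<Union>i. A i)"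
    then obtain i where "x \<in> A i" by auto
    then have "1 \<le> (\<Sum>n. ennreal (F i n x))" by (rule F(2))
    also have "\<dots> \<le> (\<Sum>i. \<Sum>n. ennreal (F i n x))" 
      using sum_le_suminf[of "\<lambda>i. \<Sum>n. ennreal (F i n x)" "{i}"] by simp
    finally show "1 \<le> (\<Sum>i. \<Sum>n. ennreal (F i n x))" .
  qed
  also have "\<dots> \<le> (\<Sum>i. outer (A i) + ennreal (e * (1/2)^Suc i))"
    by (intro suminf_le F(3)) auto
  also have "\<dots> = (\<Sum>i. outer (A i)) + (\<Sum>i. ennreal (e * (1/2)^Suc i))"
    by (intro suminf_add[symmetric]) auto
  also have "(\<Sum>i. ennreal (e * (1/2)^Suc i)) = ennreal e"
    by (rule suminf_ennreal_eq) (use e sums_mult[OF power_half_series, of e] in auto)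
  finally show "outer (\<Union>i. A i) \<le> (\<Sum>i. outer (A i)) + ennreal e" .
qed

lemma outer_measure_space_outer: "outer_measure_space UNIV outer"
  unfolding outer_measure_space_def positive_def increasing_def countably_subadditive_def
  by (auto simp: outer_empty outer_mono outer_countably_subadditive)

lemma outer_Un_le: "outer (A \<union> B) \<le> outer A + outer B"
proof -
  have "outer (A \<union> B) = outer (\<Union>i. binaryset A B i)" by (simp add: UN_binaryset_eq)
  also have "\<dots> \<le> (\<Sum>i. outer (binaryset A B i))" by (rule outer_countably_subadditive)
  also have "\<dots> = outer A + outer B" by (rule suminf_binaryset_eq) (rule outer_empty)
  finally show ?thesis .
qed

text \<open>Cut a covering sequence by continuous \<open>p k\<close> increasing to the indicator of \<open>{v > 0}\<close>;
  the increments of \<open>p\<close> turn the limit into a countable cover again.\<close>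

lemma outer_split:
  assumes v: "continuous_on UNIV (v :: 'a \<Rightarrow> real)"
  shows "outer (A \<inter> {x. 0 < v x}) + outer (A - {x. 0 < v x}) \<le> outer A"
proof -
  define U where "U = {x. 0 < v x}"
  define p where "p = (\<lambda>k x. min 1 (max 0 (real k * v x)))"
  have p01: "0 \<le> p k x" "p k x \<le> 1" for k x by (auto simp: p_def)
  have pcont: "continuous_on UNIV (p k)" for k unfolding p_def
    by (intro continuous_intros v)
  have pmono: "p k x \<le> p (Suc k) x" for k x
  proof -
    have "v x \<ge> 0 \<Longrightarrow> real k * v x \<le> real (Suc k) * v x" by (simp add: mult_right_mono)
    moreover have "v x \<le> 0 \<Longrightarrow> real k * v x \<le> 0 \<and> real (Suc k) * v x \<le> 0" by (simp add: mult_nonneg_nonpos)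
    ultimately show ?thesis unfolding p_def by (cases "v x \<ge> 0") auto
  qed
  have p0: "p 0 x = 0" for x by (simp add: p_def)
  have pout: "p k x = 0" if "x \<notin> U" for x k
  proof -
    have "real k * v x \<le> 0" using that by (intro mult_nonneg_nonpos) (auto simp: U_def)
    then show ?thesis by (simp add: p_def)
  qed
  have pin: "\<exists>k. p k x = 1" if "x \<in> U" for x
  proof -
    obtain k where "1 < real k * v x" using ex_less_of_nat_mult[of "v x" 1] \<open>x \<in> U\<close> by (auto simp: U_def)
    then show ?thesis by (intro exI[of _ k]) (auto simp: p_def)
  qed
  have main: "outer (A \<inter> U) + outer (A - U) \<le> (\<Sum>n. ennreal (L (F n)))"
    if F: "\<And>n::nat. F n \<in> Ccp" and cov: "\<And>x. x \<in> A \<Longrightarrow> 1 \<le> (\<Sum>n. ennreal (F n x))" for F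
  proof -
    have Fp: "(\<lambda>x. F n x * p k x) \<in> Ccp" for n k by (rule Ccp_mult[OF F pcont p01(1)])
    have Fq: "(\<lambda>x. F n x * (1 - p k x)) \<in> Ccp" for n k 
      by (rule Ccp_mult[OF F]) (auto intro!: continuous_intros pcont p01)
    have Fd: "(\<lambda>x. F n x * (p (Suc k) x - p k x)) \<in> Ccp" for n k 
      by (rule Ccp_mult[OF F]) (auto intro!: continuous_intros pcont pmono)
    have F0: "0 \<le> F n x" for n x by (rule CcpD(2)[OF F])
    have Linc: "L (\<lambda>x. F n x * p (Suc k) x) = L (\<lambda>x. F n x * p k x) + L (\<lambda>x. F n x * (p (Suc k) x - p k x))" for n k
      by (subst L_add[OF Fp Fd, symmetric]) (simp add: algebra_simps)
    have Lsum: "(\<Sum>j<k. L (\<lambda>x. F n x * (p (Suc j) x - p j x))) = L (\<lambda>x. F n x * p k x)" for n k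
      by (induction k) (simp_all add: p0 L_zero Linc)
    have inc: "incseq (\<lambda>k. ennreal (L (\<lambda>x. F n x * p k x)))" for n
      by (rule incseq_SucI) (use Linc[of n] L_nonneg[OF Fd] in \<open>auto intro!: ennreal_leI\<close>)
    have series: "(\<Sum>j. ennreal (L (\<lambda>x. F n x * (p (Suc j) x - p j x)))) = (SUP k. ennreal (L (\<lambda>x. F n x * p k x)))" for n
      unfolding suminf_eq_SUP by (simp add: sum_ennreal L_nonneg[OF Fd] Lsum)
    have "outer (A \<inter> U) \<le> (\<Sum>n. \<Sum>j. ennreal (L (\<lambda>x. F n x * (p (Suc j) x - p j x))))"
    proof (rule outer_le_double[OF Fd])
      fix x assume x: "x \<in> A \<inter> U"
      obtain k where k: "p k x = 1" using pin x by auto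
      have tel: "(\<Sum>j<k. (p (Suc j) x - p j x)) = 1"
        by (subst sum_lessThan_telescope) (simp add: k p0)
      then have "ennreal (F n x) = (\<Sum>j<k. ennreal (F n x * (p (Suc j) x - p j x)))" for n
        by (subst sum_ennreal) (auto intro!: mult_nonneg_nonneg F0 pmono simp: sum_distrib_left[symmetric] tel)
      then have "ennreal (F n x) \<le> (\<Sum>j. ennreal (F n x * (p (Suc j) x - p j x)))" for n
        by (simp add: sum_le_suminf)
      then have "(\<Sum>n. ennreal (F n x)) \<le> (\<Sum>n. \<Sum>j. ennreal (F n x * (p (Suc j) x - p j x)))"
        by (intro suminf_le) auto
      then show "1 \<le> (\<Sum>n. \<Sum>j. ennreal (F n x * (p (Suc j) x - p j x)))"
        using cov[of x] x by (auto intro: order_trans)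
    qed
    also have "\<dots> = (SUP k. \<Sum>n. ennreal (L (\<lambda>x. F n x * p k x)))"
      unfolding series by (rule ennreal_suminf_SUP_eq[OF inc])
    finally have 1: "outer (A \<inter> U) \<le> (SUP k. \<Sum>n. ennreal (L (\<lambda>x. F n x * p k x)))" .
    \<comment> \<open>For fixed \<open>k\<close> the cost of each \<open>F n\<close> splits exactly
      between the factors \<open>p k\<close> and \<open>1 - p k\<close>. The second factor equals 1
      outside \<open>U\<close>, so these pieces alone cover \<open>A - U\<close>.\<close>
    have 2: "(\<Sum>n. ennreal (L (\<lambda>x. F n x * p k x))) + outer (A - U) \<le> (\<Sum>n. ennreal (L (F n)))" for k
    proof -
      have "outer (A - U) \<le> (\<Sum>n. ennreal (L (\<lambda>x. F n x * (1 - p k x))))"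
        by (rule outer_le[OF Fq]) (use cov pout in auto)
      then have "(\<Sum>n. ennreal (L (\<lambda>x. F n x * p k x))) + outer (A - U) 
         \<le> (\<Sum>n. ennreal (L (\<lambda>x. F n x * p k x))) + (\<Sum>n. ennreal (L (\<lambda>x. F n x * (1 - p k x))))"
        by (rule add_left_mono)
      also have "\<dots> = (\<Sum>n. ennreal (L (\<lambda>x. F n x * p k x)) + ennreal (L (\<lambda>x. F n x * (1 - p k x))))"
        by (rule suminf_add) auto
      also have "\<dots> = (\<Sum>n. ennreal (L (F n)))"
      proof -
        have "L (F n) = L (\<lambda>x. F n x * p k x) + L (\<lambda>x. F n x * (1 - p k x))" for n
          by (subst L_add[OF Fp Fq, symmetric]) (simp add: algebra_simps)
        then show ?thesis by (simp add: L_nonneg[OF Fp] L_nonneg[OF Fq])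
      qed
      finally show ?thesis .
    qed
    have "outer (A \<inter> U) + outer (A - U) \<le> (SUP k. \<Sum>n. ennreal (L (\<lambda>x. F n x * p k x))) + outer (A - U)"
      using 1 by (rule add_right_mono)
    also have "\<dots> = (SUP k. (\<Sum>n. ennreal (L (\<lambda>x. F n x * p k x))) + outer (A - U))"
      by (rule ennreal_SUP_add_left[symmetric]) simp
    also have "\<dots> \<le> (\<Sum>n. ennreal (L (F n)))" by (rule SUP_least) (rule 2)
    finally show ?thesis .
  qed
  show ?thesis unfolding U_def[symmetric] outer_def[of A]
    by (rule INF_greatest) (use main in auto)
qed

definition rmeasure :: "'a measure" where
  "rmeasure = measure_of UNIV (sets borel) outer"

lemma sets_rmeasure [simp, measurable_cong]: "sets rmeasure = sets borel"
  unfolding rmeasure_def by (metis sets.sets_measure_of_eq space_borel)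

lemma space_rmeasure [simp]: "space rmeasure = UNIV"
  using sets_eq_imp_space_eq[OF sets_rmeasure] by simp

text \<open>Caratheodory: the sets that split every set additively form a sigma-algebra.
  \<open>outer_split\<close> with affine \<open>v\<close> puts all half-spaces into it, and these
  generate the Borel sets.\<close>

lemma emeasure_rmeasure:
  assumes "A \<in> sets borel" shows "emeasure rmeasure A = outer A"
proof -
  let ?L = "lambda_system UNIV UNIV outer"
  interpret P: sigma_algebra "UNIV :: 'a set" UNIV using sigma_algebra_Pow[of UNIV] by simp
  have ms: "measure_space UNIV ?L outer"
    by (rule P.caratheodory_lemma[OF outer_measure_space_outer])
  have half: "{x::'a. x \<bullet> i < a} \<in> ?L" for i a
  proof -
    have eq: "{x::'a. x \<bullet> i < a} = {x. 0 < a - x \<bullet> i}" by auto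
    have "outer (B \<inter> {x. x \<bullet> i < a}) + outer (B - {x. x \<bullet> i < a}) = outer B" for B
    proof (rule antisym)
      show "outer (B \<inter> {x. x \<bullet> i < a}) + outer (B - {x. x \<bullet> i < a}) \<le> outer B"
        unfolding eq by (rule outer_split) (intro continuous_intros)
      show "outer B \<le> outer (B \<inter> {x. x \<bullet> i < a}) + outer (B - {x. x \<bullet> i < a})"
        using outer_Un_le[of "B \<inter> {x. x \<bullet> i < a}" "B - {x. x \<bullet> i < a}"] by (simp add: Int_Diff_Un)
    qed
    then show ?thesis unfolding P.lambda_system_eq by simp
  qed
  have sub: "sets borel \<subseteq> ?L"
  proof -
    have "sigma_sets UNIV ((\<lambda>(a, i). {x::'a. x \<bullet> i < a}) ` (UNIV \<times> Basis)) \<subseteq> ?L"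
      by (rule sigma_algebra.sigma_sets_subset) (use ms half in \<open>auto simp: measure_space_def\<close>)
    then show ?thesis by (subst borel_eq_halfspace_less) simp
  qed
  have ca: "countably_additive (sets borel) outer"
    using ms sub unfolding measure_space_def countably_additive_def by blast
  show ?thesis unfolding rmeasure_def
    by (rule emeasure_measure_of_sigma[OF _ _ ca assms])
       (use outer_empty sets.sigma_algebra_axioms[of borel] in \<open>auto simp: positive_def\<close>)
qed

text \<open>Compactness of \<open>K\<close> is what bounds the cost of a cover from below: for
  \<open>t < 1\<close> the open sets where partial sums exceed \<open>t\<close> exhaust
  \<open>K\<close>, so a single finite partial sum dominates \<open>t / c * g\<close>. Monotonicity
  of \<open>L\<close> applies to it, and \<open>t\<close> tends to 1.\<close>

lemma L_le_emeasure:
  assumes g: "g \<in> Ccp" and K: "compact K" and sub: "\<And>x. x \<notin> K \<Longrightarrow> g x = 0" and c: "0 < c" "\<And>x. g x \<le> c"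
  shows "ennreal (L g) \<le> ennreal c * emeasure rmeasure K"
proof -
  have main: "ennreal (L g / c) \<le> (\<Sum>n. ennreal (L (F n)))"
    if F: "\<And>n::nat. F n \<in> Ccp" and cov: "\<And>x. x \<in> K \<Longrightarrow> 1 \<le> (\<Sum>n. ennreal (F n x))" for F
  proof -
    have F0: "0 \<le> F n x" for n x by (rule CcpD(2)[OF F])
    have t: "ennreal (t * (L g / c)) \<le> (\<Sum>n. ennreal (L (F n)))" if t: "0 < t" "t < 1" for t
    proof -
      define W where "W = (\<lambda>N::nat. {x. t < (\<Sum>n<N. F n x)})"
      have oW: "open (W N)" for N unfolding W_def
        by (intro open_Collect_less continuous_intros CcpD(1)[OF F])
      have incW: "W N \<subseteq> W M" if "N \<le> M" for N M
      proof
        fix x assume "x \<in> W N"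
        moreover have "(\<Sum>n<N. F n x) \<le> (\<Sum>n<M. F n x)" using that by (intro sum_mono2) (auto simp: F0)
        ultimately show "x \<in> W M" by (simp add: W_def)
      qed
      have "K \<subseteq> (\<Union>N. W N)"
      proof
        fix x assume "x \<in> K"
        have "ennreal t < 1" using t by (simp add: ennreal_less_one_iff)
        also have "1 \<le> (\<Sum>n. ennreal (F n x))" by (rule cov) fact
        finally obtain N where "ennreal t < (\<Sum>n<N. ennreal (F n x))" unfolding suminf_eq_SUP less_SUP_iff by auto
        then have "t < (\<Sum>n<N. F n x)" using t by (simp add: sum_ennreal F0 ennreal_less_iff)
        then show "x \<in> (\<Union>N. W N)" by (auto simp: W_def)
      qed
      then obtain C where C: "finite C" "K \<subseteq> (\<Union>N\<in>C. W N)"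
        using compactE_image[OF K, of UNIV W] oW by metis
      then have KW: "K \<subseteq> W (Max C)" using incW[OF Max_ge[OF C(1)]] by blast
      let ?N = "Max C"
      have SF: "(\<lambda>x. \<Sum>n<?N. F n x) \<in> Ccp" "L (\<lambda>x. \<Sum>n<?N. F n x) = (\<Sum>n<?N. L (F n))"
        using L_sum[of "{..<?N}" F] F by auto
      have "t / c * L g = L (\<lambda>x. t / c * g x)" by (rule L_scale[OF g, symmetric]) (use t c in auto)
      also have "\<dots> \<le> L (\<lambda>x. \<Sum>n<?N. F n x)"
      proof (rule L_mono[OF _ SF(1)])
        show "(\<lambda>x. t / c * g x) \<in> Ccp" 
          using Ccp_mult[OF g continuous_on_const, of "t/c"] t c by (simp add: mult.commute)
        fix x
        show "t / c * g x \<le> (\<Sum>n<?N. F n x)"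
        proof (cases "x \<in> K")
          case True
          then have "t < (\<Sum>n<?N. F n x)" using KW by (auto simp: W_def)
          moreover have "t / c * g x \<le> t" using c(2)[of x] c(1) t by (simp add: field_simps)
          ultimately show ?thesis by simp
        qed (simp add: sub sum_nonneg F0)
      qed
      finally have "ennreal (t * (L g / c)) \<le> ennreal (\<Sum>n<?N. L (F n))" using SF by (simp add: ennreal_leI)
      also have "\<dots> = (\<Sum>n<?N. ennreal (L (F n)))" by (simp add: sum_ennreal L_nonneg F)
      also have "\<dots> \<le> (\<Sum>n. ennreal (L (F n)))" by (rule sum_le_suminf) auto
      finally show ?thesis .
    qed
    show ?thesis
    proof (cases "\<Sum>n. ennreal (L (F n))")
      case (real r)
      then have "t * (L g / c) \<le> r" if "0 < t" "t < 1" for t using t[OF that] by simp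
      then have "L g / c \<le> r" by (rule field_le_mult_one_interval)
      then show ?thesis using real by simp
    qed simp
  qed
  have "ennreal (L g / c) \<le> outer K"
    unfolding outer_def by (rule INF_greatest) (use main in auto)
  then have "ennreal c * ennreal (L g / c) \<le> ennreal c * outer K" by (rule mult_left_mono) simp
  then show ?thesis using c L_nonneg[OF g] K 
    by (simp add: ennreal_mult[symmetric] emeasure_rmeasure borel_compact)
qed

lemma emeasure_le_L:
  assumes g: "g \<in> Ccp" and A: "A \<in> sets borel" and c: "0 < c" "\<And>x. x \<in> A \<Longrightarrow> c \<le> g x"
  shows "ennreal c * emeasure rmeasure A \<le> ennreal (L g)"
proof -
  have gc: "(\<lambda>x. (1 / c) * g x) \<in> Ccp" using Ccp_mult[OF g continuous_on_const, of "1/c"] c by (simp add: mult.commute)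
  have "outer A \<le> ennreal (L (\<lambda>x. (1 / c) * g x))"
    by (rule outer_le_single[OF gc]) (use c in auto)
  also have "L (\<lambda>x. (1 / c) * g x) = (1 / c) * L g" by (rule L_scale[OF g]) (use c in auto)
  finally have "ennreal c * outer A \<le> ennreal c * ennreal ((1 / c) * L g)" by (rule mult_left_mono) simp
  then show ?thesis using c L_nonneg[OF g] by (simp add: ennreal_mult[symmetric] emeasure_rmeasure A)
qed

lemma rmeasure_compact_finite:
  assumes "compact K" shows "emeasure rmeasure K < \<infinity>"
proof -
  obtain f where f: "f \<in> Ccp" "\<And>x. x \<in> K \<Longrightarrow> f x = 1"
    using Ccp_bump[OF assms open_UNIV] by (metis subset_UNIV)
  have "ennreal 1 * emeasure rmeasure K \<le> ennreal (L f)"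
    by (rule emeasure_le_L) (use f assms in \<open>auto simp: borel_compact\<close>)
  then show ?thesis by (simp add: order.strict_trans1)
qed

text \<open>Cut \<open>f\<close> into horizontal slices \<open>g j\<close> of height
  \<open>e\<close>. Each slice lies between \<open>e\<close> times the indicators of two consecutive
  superlevel sets, so its integral and its value under \<open>L\<close> obey the same two measure
  bounds. The total discrepancy is at most \<open>e\<close> times the mass of the support.\<close>

lemma nn_integral_rmeasure:
  assumes f: "f \<in> Ccp"
  shows "(\<integral>\<^sup>+x. ennreal (f x) \<partial>rmeasure) = ennreal (L f)"
proof -
  define S where "S = closure {x. f x \<noteq> 0}"
  have S: "compact S" using CcpD(3)[OF f] by (simp add: S_def compact_closure)
  have inS: "f x \<noteq> 0 \<Longrightarrow> x \<in> S" for x using closure_subset[of "{x. f x \<noteq> 0}"] by (auto simp: S_def)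
  have f0: "0 \<le> f x" for x by (rule CcpD(2)[OF f])
  obtain B where B: "B > 0" "\<And>x. f x \<le> B" using Ccp_bounded[OF f] by metis
  have both: "(\<integral>\<^sup>+x. ennreal (f x) \<partial>rmeasure) \<le> ennreal e * emeasure rmeasure S + ennreal (L f) \<and>
     ennreal (L f) \<le> ennreal e * emeasure rmeasure S + (\<integral>\<^sup>+x. ennreal (f x) \<partial>rmeasure)" if e: "0 < e" for e
  proof -
    obtain N :: nat where N: "B < real N * e" using ex_less_of_nat_mult[OF e] by auto
    define g where "g = (\<lambda>j x. min (f x) (real (Suc j) * e) - min (f x) (real j * e))"
    define A where "A = (\<lambda>j. S \<inter> {x. real j * e \<le> f x})"
    have je: "real j * e \<le> real (Suc j) * e" "0 \<le> real j * e" for j using e by auto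
    have g_nn: "0 \<le> g j x" for j x using je[of j] unfolding g_def by linarith
    have g_le: "g j x \<le> f x" for j x using je[of j] f0[of x] unfolding g_def by linarith
    have g_le_e: "g j x \<le> e" for j x using je[of j] e unfolding g_def by (simp add: min_def algebra_simps)
    have g_cont: "continuous_on UNIV (g j)" for j unfolding g_def
      by (intro continuous_intros CcpD(1)[OF f])
    have gC: "g j \<in> Ccp" for j by (rule Ccp_dominated[OF f g_cont g_nn g_le])
    have gA: "g j x = 0" if "x \<notin> A j" for j x
    proof (cases "x \<in> S")
      case True
      then have "f x < real j * e" using that by (auto simp: A_def)
      then show ?thesis using je(1)[of j] by (auto simp: g_def min_def)
    next
      case False
      then have "f x = 0" using inS by auto
      then show ?thesis using je[of j] e by (auto simp: g_def min_def)
    qed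
    have gA': "e \<le> g j x" if "x \<in> A (Suc j)" for j x
      using that je[of j] by (simp add: A_def g_def min_def algebra_simps)
    have cA: "compact (A j)" for j unfolding A_def
      by (intro compact_Int_closed S closed_Collect_le continuous_intros CcpD(1)[OF f])
    have bA[measurable]: "A j \<in> sets borel" for j by (rule borel_compact[OF cA])
    have gmeas[measurable]: "g j \<in> borel_measurable borel" for j
      by (rule borel_measurable_continuous_onI[OF g_cont])
    have fsum: "f x = (\<Sum>j<N. g j x)" for x
      using N B(2)[of x] f0[of x] unfolding g_def by (subst sum_lessThan_telescope) auto
    have Lf: "ennreal (L f) = (\<Sum>j<N. ennreal (L (g j)))"
    proof -
      have "f = (\<lambda>x. \<Sum>j<N. g j x)" using fsum by auto
      then have "L f = (\<Sum>j<N. L (g j))" using L_sum[of "{..<N}" g] gC by simp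
      then show ?thesis by (simp add: sum_ennreal L_nonneg gC)
    qed
    have If: "(\<integral>\<^sup>+x. ennreal (f x) \<partial>rmeasure) = (\<Sum>j<N. \<integral>\<^sup>+x. ennreal (g j x) \<partial>rmeasure)"
      unfolding fsum by (subst nn_integral_sum[symmetric]) (auto simp: sum_ennreal g_nn)
    define c where "c = (\<lambda>j. ennreal e * emeasure rmeasure (A j))"
    have 1: "(\<integral>\<^sup>+x. ennreal (g j x) \<partial>rmeasure) \<le> c j" for j
    proof -
      have "(\<integral>\<^sup>+x. ennreal (g j x) \<partial>rmeasure) \<le> (\<integral>\<^sup>+x. ennreal e * indicator (A j) x \<partial>rmeasure)"
        by (rule nn_integral_mono) (auto simp: indicator_def gA intro!: ennreal_leI g_le_e)
      then show ?thesis by (simp add: c_def nn_integral_cmult_indicator)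
    qed
    have 2: "c (Suc j) \<le> (\<integral>\<^sup>+x. ennreal (g j x) \<partial>rmeasure)" for j
    proof -
      have "(\<integral>\<^sup>+x. ennreal e * indicator (A (Suc j)) x \<partial>rmeasure) \<le> (\<integral>\<^sup>+x. ennreal (g j x) \<partial>rmeasure)"
        by (rule nn_integral_mono) (auto simp: indicator_def intro!: ennreal_leI gA')
      then show ?thesis by (simp add: c_def nn_integral_cmult_indicator)
    qed
    have 3: "ennreal (L (g j)) \<le> c j" for j
      unfolding c_def by (rule L_le_emeasure[OF gC cA gA e g_le_e])
    have 4: "c (Suc j) \<le> ennreal (L (g j))" for j
      unfolding c_def by (rule emeasure_le_L[OF gC bA e gA'])
    \<comment> \<open>Upper bounds carry the index \<open>j\<close> and lower bounds
      \<open>Suc j\<close>, so two sums of slices can differ by no more than the bottom term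
      \<open>c 0\<close>. It is used in both directions, with the integral and \<open>L\<close>
      exchanging roles.\<close>
    have shift: "(\<Sum>j<N. a j) \<le> c 0 + (\<Sum>j<N. b j)" if ab: "\<And>j. a j \<le> c j" "\<And>j. c (Suc j) \<le> b j" 
      for a b :: "nat \<Rightarrow> ennreal"
    proof -
      have "(\<Sum>j<N. a j) \<le> (\<Sum>j<N. c j)" by (intro sum_mono ab)
      also have "\<dots> \<le> (\<Sum>j<Suc N. c j)" by simp
      also have "\<dots> = c 0 + (\<Sum>j<N. c (Suc j))" by (rule sum.lessThan_Suc_shift)
      also have "\<dots> \<le> c 0 + (\<Sum>j<N. b j)" by (intro add_left_mono sum_mono ab)
      finally show ?thesis .
    qed
    have "c 0 \<le> ennreal e * emeasure rmeasure S" unfolding c_def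
      by (intro mult_left_mono emeasure_mono) (auto simp: A_def borel_compact S)
    then show ?thesis using shift[OF 1 4] shift[OF 3 2] unfolding Lf If
      by (meson add_right_mono order_trans)
  qed
  have lim: "X \<le> Y" if "\<And>e. 0 < e \<Longrightarrow> X \<le> ennreal e * emeasure rmeasure S + Y" for X Y :: ennreal
  proof (rule ennreal_le_epsilon)
    fix e :: real assume e: "0 < e"
    obtain r where r: "emeasure rmeasure S = ennreal r" "0 \<le> r" 
      using rmeasure_compact_finite[OF S] by (cases "emeasure rmeasure S") auto
    have "X \<le> ennreal (e / (r + 1)) * ennreal r + Y" using that[of "e / (r+1)"] e r by auto
    also have "ennreal (e / (r + 1)) * ennreal r \<le> ennreal e"
      using e r by (simp add: ennreal_mult[symmetric] field_simps)
    finally show "X \<le> Y + ennreal e" by (simp add: add.commute add_left_mono)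
  qed
  show ?thesis
    by (rule antisym; rule lim) (use both in auto)
qed

end

section \<open>Riesz representation of complex functionals\<close>

lemma Cc_iff: "f \<in> Cc \<longleftrightarrow> continuous_on UNIV f \<and> bounded {x. f x \<noteq> 0}"
  unfolding Cc_def supp_def by simp

lemma Cc_continuous: "f \<in> Cc \<Longrightarrow> continuous_on UNIV f"
  by (simp add: Cc_iff)

lemma Cc_measurable: "f \<in> Cc \<Longrightarrow> f \<in> borel_measurable borel"
  by (simp add: Cc_continuous borel_measurable_continuous_onI)

lemma Cc_dominated:
  assumes "f \<in> Cc" "continuous_on UNIV g" "\<And>x. f x = 0 \<Longrightarrow> g x = 0"
  shows "g \<in> Cc"
  using assms unfolding Cc_iff by (auto intro: bounded_subset)

lemma Cc_zero: "(\<lambda>x. 0) \<in> Cc" by (simp add: Cc_iff)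

lemma Cc_add:
  assumes "f \<in> Cc" "g \<in> Cc"
  shows "(\<lambda>x. f x + g x) \<in> Cc"
proof -
  have "bounded ({x. f x \<noteq> 0} \<union> {x. g x \<noteq> 0})" using assms by (auto simp: Cc_iff)
  then have "bounded {x. f x + g x \<noteq> 0}" by (rule bounded_subset) auto
  then show ?thesis using assms by (auto simp: Cc_iff intro!: continuous_on_add)
qed

lemma Cc_mult:
  assumes "f \<in> Cc" "continuous_on UNIV g"
  shows "(\<lambda>x. f x * g x) \<in> Cc"
  using assms by (intro Cc_dominated[OF assms(1)] continuous_on_mult) (auto simp: Cc_iff)

lemma Cc_scale: "f \<in> Cc \<Longrightarrow> (\<lambda>x. c * f x) \<in> Cc"
  using Cc_mult[of f "\<lambda>x. c"] by (simp add: mult.commute)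

lemma Ccp_of_real: "f \<in> Ccp \<Longrightarrow> (\<lambda>x. complex_of_real (f x)) \<in> Cc"
  unfolding Cc_iff Ccp_def by (auto intro!: continuous_intros)

lemma Cc_norm: "f \<in> Cc \<Longrightarrow> (\<lambda>x. cmod (f x)) \<in> Ccp"
  unfolding Cc_iff Ccp_def by (auto intro!: continuous_intros)

lemma Cc_bounded:
  assumes "f \<in> Cc" 
  obtains B where "B > 0" "\<And>x. cmod (f x) \<le> B"
  using Ccp_bounded[OF Cc_norm[OF assms]] by metis

lemma supn_upper:
  assumes "f \<in> Cc" shows "cmod (f x) \<le> supn f"
proof -
  obtain B where "\<And>x. cmod (f x) \<le> B" using Cc_bounded[OF assms] by metis
  then show ?thesis unfolding supn_def by (intro cSUP_upper) (auto intro!: bdd_aboveI)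
qed

lemma supn_le: "(\<And>x. cmod (f x) \<le> B) \<Longrightarrow> supn f \<le> B"
  unfolding supn_def by (rule cSUP_least) auto

lemma Cc_decompose:
  assumes "g \<in> Cc"
  obtains a b c d where "a \<in> Ccp" "b \<in> Ccp" "c \<in> Ccp" "d \<in> Ccp"
    "g = (\<lambda>x. (complex_of_real (a x) + (-1) * complex_of_real (b x)) + (\<i> * complex_of_real (c x) + (-\<i>) * complex_of_real (d x)))"
proof
  have *: "(\<lambda>x. max 0 (r (g x))) \<in> Ccp" if "continuous_on UNIV r" "r 0 = 0" for r :: "complex \<Rightarrow> real"
  proof -
    have "continuous_on UNIV (\<lambda>x. r (g x))" using assms that(1) unfolding Cc_iff
      by (metis continuous_on_compose2 subset_UNIV)
    moreover have "bounded {x. max 0 (r (g x)) \<noteq> 0}"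
      using assms that(2) unfolding Cc_iff by (auto elim!: bounded_subset)
    ultimately show ?thesis unfolding Ccp_def by (auto intro!: continuous_intros)
  qed
  show "(\<lambda>x. max 0 (Re (g x))) \<in> Ccp" "(\<lambda>x. max 0 (- Re (g x))) \<in> Ccp"
    "(\<lambda>x. max 0 (Im (g x))) \<in> Ccp" "(\<lambda>x. max 0 (- Im (g x))) \<in> Ccp"
    by (rule *; auto intro!: continuous_intros)+
  show "g = (\<lambda>x. (complex_of_real (max 0 (Re (g x))) + (-1) * complex_of_real (max 0 (- Re (g x))))
    + (\<i> * complex_of_real (max 0 (Im (g x))) + (-\<i>) * complex_of_real (max 0 (- Im (g x)))))"
    by (rule ext) (simp add: complex_eq_iff max_def)
qed

text \<open>Positive and negative parts of the real and imaginary parts write \<open>g\<close> as a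
  combination of four members of \<open>Ccp\<close>, so complex linearity leaves no freedom beyond
  the cone.\<close>

lemma Cc_linear_ext:
  assumes S: "\<And>f g. f \<in> Cc \<Longrightarrow> g \<in> Cc \<Longrightarrow> S (\<lambda>x. f x + g x) = S f + S g" 
      "\<And>c g. g \<in> Cc \<Longrightarrow> S (\<lambda>x. c * g x) = c * S g"
    and T: "\<And>f g. f \<in> Cc \<Longrightarrow> g \<in> Cc \<Longrightarrow> T (\<lambda>x. f x + g x) = T f + T g" 
      "\<And>c g. g \<in> Cc \<Longrightarrow> T (\<lambda>x. c * g x) = c * T g"
    and eq: "\<And>f. f \<in> Ccp \<Longrightarrow> S (\<lambda>x. complex_of_real (f x)) = T (\<lambda>x. complex_of_real (f x))"
    and g: "g \<in> Cc"
  shows "S g = (T g :: complex)"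
proof -
  obtain a b c d where *: "a \<in> Ccp" "b \<in> Ccp" "c \<in> Ccp" "d \<in> Ccp"
    and geq: "g = (\<lambda>x. (complex_of_real (a x) + (-1) * complex_of_real (b x)) + (\<i> * complex_of_real (c x) + (-\<i>) * complex_of_real (d x)))"
    by (rule Cc_decompose[OF g])
  note C = *[THEN Ccp_of_real]
  show ?thesis unfolding geq
    by (simp only: S T Cc_add Cc_scale C eq[OF *(1)] eq[OF *(2)] eq[OF *(3)] eq[OF *(4)])
qed

text \<open>Off \<open>U\<close> the factor \<open>q\<close> may jump, but it is bounded and
  \<open>h\<close> tends to 0 there. This handles quotients whose denominator vanishes only together
  with \<open>h\<close>.\<close>

lemma continuous_mult_bounded:
  fixes h q :: "'a::euclidean_space \<Rightarrow> complex"
  assumes h: "continuous_on UNIV h" and U: "open U" "continuous_on U q"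
    and b: "\<And>x. cmod (q x) \<le> 1" and z: "\<And>x. x \<notin> U \<Longrightarrow> h x = 0"
  shows "continuous_on UNIV (\<lambda>x. h x * q x)"
proof -
  have "isCont (\<lambda>x. h x * q x) x" for x
  proof (cases "x \<in> U")
    case True
    then show ?thesis using h U by (auto intro!: continuous_intros simp: continuous_on_eq_continuous_at)
  next
    case False
    have "(h \<longlongrightarrow> h x) (at x)" using h by (auto simp: continuous_on_eq_continuous_at isCont_def)
    then have "(h \<longlongrightarrow> 0) (at x)" using z[OF False] by simp
    then have "((\<lambda>x. h x * q x) \<longlongrightarrow> 0) (at x)"
      by (rule Lim_null_comparison[OF _ tendsto_norm_zero, rotated])
         (use b in \<open>auto simp: norm_mult intro!: always_eventually mult_left_le\<close>)
    then show ?thesis using z[OF False] by (simp add: isCont_def)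
  qed
  then show ?thesis by (simp add: continuous_at_imp_continuous_on)
qed

text \<open>The total variation of \<open>\<nu>\<close> integrated against a nonnegative
  \<open>g\<close>, expressed without a measure.\<close>

definition tvf :: "(('a::euclidean_space \<Rightarrow> complex) \<Rightarrow> complex) \<Rightarrow> ('a \<Rightarrow> real) \<Rightarrow> real" where
  "tvf \<nu> g = Sup ((\<lambda>h. cmod (\<nu> h)) ` {h\<in>Cc. \<forall>x. cmod (h x) \<le> g x})"

lemma unimodular_rotation: "\<exists>c. cmod c = 1 \<and> c * z = complex_of_real (cmod z)"
proof (cases "z = 0")
  case False
  then show ?thesis
    by (intro exI[of _ "cnj z / complex_of_real (cmod z)"])
       (simp add: norm_divide complex_norm_square[symmetric] mult.commute power2_eq_square)
qed (auto intro!: exI[of _ 1])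

context
  fixes \<nu> :: "('a::euclidean_space \<Rightarrow> complex) \<Rightarrow> complex"
  assumes meas: "is_measure \<nu>"
begin

lemma meas_add: "f \<in> Cc \<Longrightarrow> g \<in> Cc \<Longrightarrow> \<nu> (\<lambda>x. f x + g x) = \<nu> f + \<nu> g"
  and meas_scale: "g \<in> Cc \<Longrightarrow> \<nu> (\<lambda>x. c * g x) = c * \<nu> g"
  using meas by (auto simp: is_measure_def)

lemma meas_zero: "\<nu> (\<lambda>x. 0) = 0"
  using meas_scale[OF Cc_zero, of 0] by simp

lemma tvf_bdd:
  assumes g: "g \<in> Ccp"
  shows "bdd_above ((\<lambda>h. cmod (\<nu> h)) ` {h\<in>Cc. \<forall>x. cmod (h x) \<le> g x})"
proof -
  let ?K = "closure {x. g x \<noteq> 0}"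
  have "compact ?K" using CcpD(3)[OF g] by (simp add: compact_closure)
  then obtain a where a: "\<And>h. h \<in> Cc \<Longrightarrow> supp h \<subseteq> ?K \<Longrightarrow> cmod (\<nu> h) \<le> a * supn h"
    using meas unfolding is_measure_def by metis
  obtain B where B: "\<And>x. g x \<le> B" using Ccp_bounded[OF g] by metis
  \<comment> \<open>The constant supplied by \<open>is_measure\<close> may be negative, hence the
    absolute value.\<close>
  have "cmod (\<nu> h) \<le> \<bar>a\<bar> * B" if h: "h \<in> Cc" "\<And>x. cmod (h x) \<le> g x" for h
  proof -
    have "{x. h x \<noteq> 0} \<subseteq> {x. g x \<noteq> 0}" using h(2) by (metis (mono_tags, lifting) Collect_mono norm_le_zero_iff)
    then have "supp h \<subseteq> ?K" unfolding supp_def by (rule closure_mono)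
    then have "cmod (\<nu> h) \<le> a * supn h" by (rule a[OF h(1)])
    also have "\<dots> \<le> \<bar>a\<bar> * supn h"
      using supn_upper[OF h(1), of undefined] by (intro mult_right_mono) (auto intro: order_trans[OF norm_ge_zero])
    also have "\<dots> \<le> \<bar>a\<bar> * B" by (intro mult_left_mono supn_le) (auto intro: order_trans[OF h(2) B])
    finally show ?thesis .
  qed
  then show ?thesis by (intro bdd_aboveI[of _ "\<bar>a\<bar> * B"]) auto
qed

lemma tvf_upper: "g \<in> Ccp \<Longrightarrow> h \<in> Cc \<Longrightarrow> (\<And>x. cmod (h x) \<le> g x) \<Longrightarrow> cmod (\<nu> h) \<le> tvf \<nu> g"
  unfolding tvf_def by (rule cSUP_upper[OF _ tvf_bdd]) auto

lemma tvf_least: "g \<in> Ccp \<Longrightarrow> (\<And>h. h \<in> Cc \<Longrightarrow> (\<And>x. cmod (h x) \<le> g x) \<Longrightarrow> cmod (\<nu> h) \<le> B) \<Longrightarrow> tvf \<nu> g \<le> B"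
  unfolding tvf_def by (rule cSUP_least) (auto intro!: exI[of _ "\<lambda>x. 0"] simp: Cc_zero CcpD)

lemma tvf_add:
  assumes g: "g1 \<in> Ccp" "g2 \<in> Ccp"
  shows "tvf \<nu> (\<lambda>x. g1 x + g2 x) = tvf \<nu> g1 + tvf \<nu> g2"
proof (rule antisym)
  note gs = Ccp_add[OF g]
  show "tvf \<nu> (\<lambda>x. g1 x + g2 x) \<le> tvf \<nu> g1 + tvf \<nu> g2"
  proof (rule tvf_least[OF gs])
    fix h assume h: "h \<in> Cc" "\<And>x. cmod (h x) \<le> g1 x + g2 x"
    \<comment> \<open>A competitor \<open>h\<close> is split in the proportion
      \<open>g1 : g2\<close>. Where \<open>g1 + g2\<close> vanishes so does \<open>h\<close>, and
      division by zero gives 0, so the parts still add up to \<open>h\<close>.\<close>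
    define part where "part = (\<lambda>u x. h x * complex_of_real (u x / (g1 x + g2 x)))"
    have part: "part u \<in> Cc \<and> (\<forall>x. cmod (part u x) \<le> u x)" 
      if u: "u \<in> Ccp" "\<And>x. u x \<le> g1 x + g2 x" for u
    proof -
      have "continuous_on UNIV (part u)" unfolding part_def
      proof (rule continuous_mult_bounded[OF Cc_continuous[OF h(1)], where U = "{x. g1 x + g2 x \<noteq> 0}"])
        show "open {x. g1 x + g2 x \<noteq> 0}"
          by (intro open_Collect_neq continuous_intros CcpD[OF g(1)] CcpD[OF g(2)])
        have c: "continuous_on A u" "continuous_on A g1" "continuous_on A g2" for A
          using CcpD(1)[OF u(1)] CcpD(1)[OF g(1)] CcpD(1)[OF g(2)] by (auto intro: continuous_on_subset)
        show "continuous_on {x. g1 x + g2 x \<noteq> 0} (\<lambda>x. complex_of_real (u x / (g1 x + g2 x)))"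
          by (intro continuous_intros c) auto
        show "cmod (complex_of_real (u x / (g1 x + g2 x))) \<le> 1" for x
          using u(2)[of x] CcpD(2)[OF u(1), of x] CcpD(2)[OF gs, of x] 
          by (simp add: norm_of_real abs_div_pos divide_le_eq_1 del: of_real_divide) linarith
        show "h x = 0" if "x \<notin> {x. g1 x + g2 x \<noteq> 0}" for x using h(2)[of x] that by auto
      qed
      then have "part u \<in> Cc" by (rule Cc_dominated[OF h(1)]) (simp add: part_def)
      moreover have "cmod (part u x) \<le> u x" for x
      proof -
        have "cmod (part u x) = cmod (h x) * (u x / (g1 x + g2 x))"
          using CcpD(2)[OF u(1), of x] CcpD(2)[OF gs, of x] 
          by (simp add: part_def norm_mult abs_div_pos del: of_real_divide of_real_add)
        also have "\<dots> \<le> (g1 x + g2 x) * (u x / (g1 x + g2 x))"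
          using CcpD(2)[OF u(1), of x] CcpD(2)[OF gs, of x] by (intro mult_right_mono h) auto
        also have "\<dots> \<le> u x" using CcpD(2)[OF u(1), of x] by simp
        finally show ?thesis .
      qed
      ultimately show ?thesis by blast
    qed
    have p1: "part g1 \<in> Cc" "\<And>x. cmod (part g1 x) \<le> g1 x" using part[OF g(1)] CcpD(2)[OF g(2)] by auto
    have p2: "part g2 \<in> Cc" "\<And>x. cmod (part g2 x) \<le> g2 x" using part[OF g(2)] CcpD(2)[OF g(1)] by auto
    have "h = (\<lambda>x. part g1 x + part g2 x)"
    proof
      fix x
      have "part g1 x + part g2 x = h x * complex_of_real ((g1 x + g2 x) / (g1 x + g2 x))"
        unfolding part_def by (simp only: add_divide_distrib distrib_left of_real_add)
      moreover have "g1 x + g2 x = 0 \<Longrightarrow> h x = 0" using h(2)[of x] by auto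
      ultimately show "h x = part g1 x + part g2 x" by (cases "g1 x + g2 x = 0") auto
    qed
    then have "\<nu> h = \<nu> (part g1) + \<nu> (part g2)" using meas_add[OF p1(1) p2(1)] by simp
    then have "cmod (\<nu> h) \<le> cmod (\<nu> (part g1)) + cmod (\<nu> (part g2))" by (simp add: norm_triangle_ineq)
    then show "cmod (\<nu> h) \<le> tvf \<nu> g1 + tvf \<nu> g2"
      using tvf_upper[OF g(1) p1] tvf_upper[OF g(2) p2] by simp
  qed
  \<comment> \<open>Multiplying \<open>h1\<close> and \<open>h2\<close> by suitable phases makes
    both values nonnegative reals, so that their moduli add inside one competitor for the
    sum.\<close>
  have *: "cmod (\<nu> h1) + cmod (\<nu> h2) \<le> tvf \<nu> (\<lambda>x. g1 x + g2 x)" 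
    if h: "h1 \<in> Cc" "\<And>x. cmod (h1 x) \<le> g1 x" "h2 \<in> Cc" "\<And>x. cmod (h2 x) \<le> g2 x" for h1 h2
  proof -
    obtain c1 where c1: "cmod c1 = 1" "c1 * \<nu> h1 = complex_of_real (cmod (\<nu> h1))" using unimodular_rotation by blast
    obtain c2 where c2: "cmod c2 = 1" "c2 * \<nu> h2 = complex_of_real (cmod (\<nu> h2))" using unimodular_rotation by blast
    have "\<nu> (\<lambda>x. c1 * h1 x + c2 * h2 x) = complex_of_real (cmod (\<nu> h1) + cmod (\<nu> h2))"
      by (simp add: meas_add Cc_scale h meas_scale c1 c2)
    then have "cmod (\<nu> (\<lambda>x. c1 * h1 x + c2 * h2 x)) = cmod (\<nu> h1) + cmod (\<nu> h2)"
      by (simp only: norm_of_real) simp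
    moreover have "cmod (\<nu> (\<lambda>x. c1 * h1 x + c2 * h2 x)) \<le> tvf \<nu> (\<lambda>x. g1 x + g2 x)"
    proof (rule tvf_upper[OF gs Cc_add[OF Cc_scale[OF h(1)] Cc_scale[OF h(3)]]])
      show "cmod (c1 * h1 x + c2 * h2 x) \<le> g1 x + g2 x" for x
        using norm_triangle_ineq[of "c1 * h1 x" "c2 * h2 x"] h(2)[of x] h(4)[of x] by (simp add: norm_mult c1 c2)
    qed
    ultimately show ?thesis by simp
  qed
  have "tvf \<nu> g1 \<le> tvf \<nu> (\<lambda>x. g1 x + g2 x) - cmod (\<nu> h2)" if "h2 \<in> Cc" "\<And>x. cmod (h2 x) \<le> g2 x" for h2
    by (rule tvf_least[OF g(1)]) (use *[OF _ _ that] in \<open>simp add: algebra_simps\<close>)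
  then have "tvf \<nu> g2 \<le> tvf \<nu> (\<lambda>x. g1 x + g2 x) - tvf \<nu> g1"
    by (intro tvf_least[OF g(2)]) (simp add: algebra_simps)
  then show "tvf \<nu> g1 + tvf \<nu> g2 \<le> tvf \<nu> (\<lambda>x. g1 x + g2 x)" by simp
qed

lemma tvf_scale:
  assumes g: "g \<in> Ccp" and c: "0 \<le> c"
  shows "tvf \<nu> (\<lambda>x. c * g x) = c * tvf \<nu> g"
proof -
  \<comment> \<open>Only one inequality, for positive factors; the reverse is the same bound with
    factor \<open>1/c\<close> applied to \<open>c * g\<close>.\<close>
  have le: "tvf \<nu> (\<lambda>x. c * g x) \<le> c * tvf \<nu> g" if g: "g \<in> Ccp" and c: "0 < c" for c g
  proof (rule tvf_least)
    show "(\<lambda>x. c * g x) \<in> Ccp" using Ccp_mult[OF g continuous_on_const, of c] c by (simp add: mult.commute)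
    fix h assume h: "h \<in> Cc" "\<And>x. cmod (h x) \<le> c * g x"
    have "cmod (\<nu> (\<lambda>x. complex_of_real (1/c) * h x)) \<le> tvf \<nu> g"
      by (rule tvf_upper[OF g Cc_scale[OF h(1)]]) (use h(2) c in \<open>simp add: norm_mult norm_divide field_simps\<close>)
    then have "c * cmod (\<nu> (\<lambda>x. complex_of_real (1/c) * h x)) \<le> c * tvf \<nu> g" using c by simp
    moreover have "\<nu> h = complex_of_real c * \<nu> (\<lambda>x. complex_of_real (1/c) * h x)"
      using c by (subst meas_scale[OF h(1)]) simp
    ultimately show "cmod (\<nu> h) \<le> c * tvf \<nu> g" using c by (simp only: norm_mult) simp
  qed
  show ?thesis
  proof (cases "c = 0")
    case True
    have "tvf \<nu> (\<lambda>x. 0) = 0"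
    proof (rule antisym)
      show "tvf \<nu> (\<lambda>x. 0) \<le> 0"
      proof (rule tvf_least[OF Ccp_zero])
        fix h :: "'a \<Rightarrow> complex" assume "\<And>x. cmod (h x) \<le> 0"
        then have "h = (\<lambda>x. 0)" by auto
        then show "cmod (\<nu> h) \<le> 0" by (simp add: meas_zero)
      qed
      show "0 \<le> tvf \<nu> (\<lambda>x. 0)" using tvf_upper[OF Ccp_zero Cc_zero] by (simp add: meas_zero)
    qed
    then show ?thesis using True by simp
  next
    case False
    then have c: "0 < c" using c by simp
    have gc: "(\<lambda>x. c * g x) \<in> Ccp" using Ccp_mult[OF g continuous_on_const, of c] c by (simp add: mult.commute)
    have "tvf \<nu> (\<lambda>x. (1/c) * (c * g x)) \<le> (1/c) * tvf \<nu> (\<lambda>x. c * g x)"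
      by (rule le[OF gc]) (use c in auto)
    then have "c * tvf \<nu> g \<le> tvf \<nu> (\<lambda>x. c * g x)" using c by (simp add: field_simps)
    then show ?thesis using le[OF g c] by simp
  qed
qed

lemma tvf_nonneg: "g \<in> Ccp \<Longrightarrow> 0 \<le> tvf \<nu> g"
  using tvf_upper[OF _ Cc_zero, of g] CcpD(2)[of g] by (auto simp: meas_zero)

lemma tvf_of_real: "g \<in> Ccp \<Longrightarrow> cmod (\<nu> (\<lambda>x. complex_of_real (g x))) \<le> tvf \<nu> g"
  by (rule tvf_upper) (auto intro: Ccp_of_real simp: CcpD(2))

text \<open>Every competitor in \<open>tvf \<nu> g\<close> has support inside that of
  \<open>g\<close> and sup norm at most 1, hence also competes in \<open>tv_open \<nu> U\<close>.
  This links the functional total variation to the set function \<open>tv\<close>.\<close>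

lemma tvf_le_tv_open:
  assumes g: "g \<in> Ccp" "\<And>x. g x \<le> 1" "closure {x. g x \<noteq> 0} \<subseteq> U"
  shows "ennreal (tvf \<nu> g) \<le> tv_open \<nu> U"
proof -
  have *: "ennreal (cmod (\<nu> h)) \<le> tv_open \<nu> U" if h: "h \<in> Cc" "\<And>x. cmod (h x) \<le> g x" for h
    unfolding tv_open_def
  proof (rule SUP_upper, safe)
    have "{x. h x \<noteq> 0} \<subseteq> {x. g x \<noteq> 0}" using h(2) by (metis (mono_tags, lifting) Collect_mono norm_le_zero_iff)
    then have "supp h \<subseteq> closure {x. g x \<noteq> 0}" unfolding supp_def by (rule closure_mono)
    then show "x \<in> U" if "x \<in> supp h" for x using that g(3) by auto
    show "supn h \<le> 1" by (rule supn_le) (rule order_trans[OF h(2) g(2)])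
  qed (rule h)
  show ?thesis
  proof (cases "tv_open \<nu> U")
    case (real r)
    have "tvf \<nu> g \<le> r" by (rule tvf_least[OF g(1)]) (use *[unfolded real(2) ennreal_le_iff[OF real(1)]] in blast)
    then show ?thesis using real by (simp add: ennreal_leI)
  qed simp
qed

end

section \<open>Densities between the measures of comparable positive functionals\<close>

lemma sigma_finite_locally_finite:
  fixes M :: "'a::euclidean_space measure"
  assumes "sets M = sets borel" "\<And>K. compact K \<Longrightarrow> emeasure M K < \<infinity>"
  shows "sigma_finite_measure M"
proof
  have sp: "space M = UNIV" using sets_eq_imp_space_eq[OF assms(1)] by simp
  have "(\<Union>n. cball (0::'a) (real n)) = UNIV" using real_arch_simple by (auto simp: dist_norm)
  then show "\<exists>A. countable A \<and> A \<subseteq> sets M \<and> \<Union>A = space M \<and> (\<forall>a\<in>A. emeasure M a \<noteq> \<infinity>)"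
    using assms(2)[OF compact_cball] 
    by (intro exI[of _ "range (\<lambda>n. cball 0 (real n))"]) (auto simp: assms(1) sp less_top)
qed

lemma (in positive_functional) emeasure_rmeasure_mono:
  assumes "positive_functional L'" "\<And>f. f \<in> Ccp \<Longrightarrow> L' f \<le> L f" "A \<in> sets borel"
  shows "emeasure (positive_functional.rmeasure L') A \<le> emeasure rmeasure A"
  unfolding positive_functional.emeasure_rmeasure[OF assms(1,3)] emeasure_rmeasure[OF assms(3)]
    positive_functional.outer_def[OF assms(1)] outer_def
  by (rule INF_mono) (use assms(2) in \<open>auto intro!: suminf_le ennreal_leI\<close>)

lemma (in positive_functional) integrable_rmeasure:
  assumes "g \<in> Cc" shows "integrable rmeasure g"
proof (rule integrableI_bounded)
  show "g \<in> borel_measurable rmeasure" using Cc_measurable[OF assms] by simp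
  show "(\<integral>\<^sup>+ x. ennreal (norm (g x)) \<partial>rmeasure) < \<infinity>"
    using nn_integral_rmeasure[OF Cc_norm[OF assms]] by simp
qed

lemma (in positive_functional) integral_rmeasure:
  assumes g: "g \<in> Ccp" shows "(\<integral>x. complex_of_real (g x) \<partial>rmeasure) = complex_of_real (L g)"
proof -
  have [measurable]: "g \<in> borel_measurable borel" by (rule borel_measurable_continuous_onI[OF CcpD(1)[OF g]])
  have "(\<integral>x. g x \<partial>rmeasure) = L g"
    using nn_integral_rmeasure[OF g] L_nonneg[OF g] by (subst integral_eq_nn_integral) (auto simp: CcpD(2)[OF g])
  then show ?thesis by simp
qed

text \<open>Domination of functionals gives domination of measures, hence absolute continuity and a
  Radon-Nikodym density. It is finite almost everywhere because the smaller measure is sigma-finite,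
  so a real-valued version \<open>D\<close> can be chosen.\<close>

lemma rmeasure_density:
  assumes L0: "positive_functional L0" and L1: "positive_functional L1" and le: "\<And>f. f \<in> Ccp \<Longrightarrow> L1 f \<le> L0 f"
  obtains D :: "'a::euclidean_space \<Rightarrow> real" where "D \<in> borel_measurable borel" "\<And>x. 0 \<le> D x"
    "positive_functional.rmeasure L1 = density (positive_functional.rmeasure L0) (\<lambda>x. ennreal (D x))"
proof -
  interpret L0: positive_functional L0 by fact
  interpret L1: positive_functional L1 by fact
  interpret P0: sigma_finite_measure L0.rmeasure 
    by (rule sigma_finite_locally_finite[OF L0.sets_rmeasure L0.rmeasure_compact_finite])
  have sf1: "sigma_finite_measure L1.rmeasure"
    by (rule sigma_finite_locally_finite[OF L1.sets_rmeasure L1.rmeasure_compact_finite])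
  have ac: "absolutely_continuous L0.rmeasure L1.rmeasure"
    unfolding absolutely_continuous_def null_sets_def
  proof clarify
    fix A assume "emeasure L0.rmeasure A = 0" "A \<in> sets L0.rmeasure"
    then show "A \<in> sets L1.rmeasure \<and> emeasure L1.rmeasure A = 0"
      using L0.emeasure_rmeasure_mono[OF L1 le, of A] by simp
  qed
  have ss: "sets L1.rmeasure = sets L0.rmeasure" by simp
  define D where "D = (\<lambda>x. enn2real (RN_deriv L0.rmeasure L1.rmeasure x))"
  have rn[measurable]: "RN_deriv L0.rmeasure L1.rmeasure \<in> borel_measurable borel"
    using borel_measurable_RN_deriv[of L0.rmeasure L1.rmeasure] by (simp cong: measurable_cong_sets)
  have Dm[measurable]: "D \<in> borel_measurable borel" unfolding D_def by measurable
  have "L1.rmeasure = density L0.rmeasure (RN_deriv L0.rmeasure L1.rmeasure)"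
    by (rule P0.density_RN_deriv[OF ac ss, symmetric])
  also have "\<dots> = density L0.rmeasure (\<lambda>x. ennreal (D x))"
  proof (rule density_cong)
    show "AE x in L0.rmeasure. RN_deriv L0.rmeasure L1.rmeasure x = ennreal (D x)"
      using P0.RN_deriv_finite[OF sf1 ac ss] by eventually_elim (simp add: D_def top.not_eq_extremum)
  qed auto
  finally have "L1.rmeasure = density L0.rmeasure (\<lambda>x. ennreal (D x))" .
  moreover have "0 \<le> D x" for x by (simp add: D_def)
  ultimately show ?thesis using that[OF Dm] by blast
qed

text \<open>With \<open>L0 = 2 |\<nu>|\<close>, \<open>L1 = |\<nu>| + Re \<nu>\<close> and \<open>L2 = |\<nu>| + Im \<nu>\<close> all positive and
  \<open>L1, L2 \<le> L0\<close>, the functional \<open>\<nu>\<close> has a density with respect to the measure of \<open>L0\<close>.\<close>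

theorem complex_riesz_representation:
  fixes \<nu> :: "('a::euclidean_space \<Rightarrow> complex) \<Rightarrow> complex"
  assumes meas: "is_measure \<nu>"
  obtains M h where "radon_rep \<nu> M h" "\<And>K. compact K \<Longrightarrow> emeasure M K \<le> 6 * tv \<nu> K"
proof -
  define L0 where "L0 = (\<lambda>g. 2 * tvf \<nu> g)"
  define L1 where "L1 = (\<lambda>g. tvf \<nu> g + Re (\<nu> (\<lambda>x. complex_of_real (g x))))"
  define L2 where "L2 = (\<lambda>g. tvf \<nu> g + Im (\<nu> (\<lambda>x. complex_of_real (g x))))"
  note T = tvf_add[OF meas] tvf_scale[OF meas] tvf_nonneg[OF meas]
  have R: "\<nu> (\<lambda>x. complex_of_real (f x + g x)) = \<nu> (\<lambda>x. complex_of_real (f x)) + \<nu> (\<lambda>x. complex_of_real (g x))"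
    if "f \<in> Ccp" "g \<in> Ccp" for f g 
    using meas_add[OF meas Ccp_of_real[OF that(1)] Ccp_of_real[OF that(2)]] by simp
  have S: "\<nu> (\<lambda>x. complex_of_real (c * g x)) = complex_of_real c * \<nu> (\<lambda>x. complex_of_real (g x))"
    if "g \<in> Ccp" for c g 
    using meas_scale[OF meas Ccp_of_real[OF that]] by simp
  interpret L0: positive_functional L0
    by unfold_locales (auto simp: L0_def T algebra_simps)
  have abs: "\<bar>Re (\<nu> (\<lambda>x. complex_of_real (g x)))\<bar> \<le> tvf \<nu> g" "\<bar>Im (\<nu> (\<lambda>x. complex_of_real (g x)))\<bar> \<le> tvf \<nu> g"
    if "g \<in> Ccp" for g
    using tvf_of_real[OF meas that] abs_Re_le_cmod abs_Im_le_cmod order_trans by blast+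
  interpret L1: positive_functional L1
  proof
    show "0 \<le> L1 f" if "f \<in> Ccp" for f using abs(1)[OF that] by (simp add: L1_def)
  qed (simp_all add: L1_def T R[simplified] S[simplified] algebra_simps)
  interpret L2: positive_functional L2
  proof
    show "0 \<le> L2 f" if "f \<in> Ccp" for f using abs(2)[OF that] by (simp add: L2_def)
  qed (simp_all add: L2_def T R[simplified] S[simplified] algebra_simps)
  have le1: "L1 f \<le> L0 f" and le2: "L2 f \<le> L0 f" if "f \<in> Ccp" for f
    using abs[OF that] by (simp_all add: L0_def L1_def L2_def)
  let ?P0 = L0.rmeasure and ?P1 = L1.rmeasure and ?P2 = L2.rmeasure
  obtain D1 where D1[measurable]: "D1 \<in> borel_measurable borel" "\<And>x. 0 \<le> D1 x"
    "?P1 = density ?P0 (\<lambda>x. ennreal (D1 x))"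
    using rmeasure_density[OF L0.positive_functional_axioms L1.positive_functional_axioms le1] by metis
  obtain D2 where D2[measurable]: "D2 \<in> borel_measurable borel" "\<And>x. 0 \<le> D2 x"
    "?P2 = density ?P0 (\<lambda>x. ennreal (D2 x))"
    using rmeasure_density[OF L0.positive_functional_axioms L2.positive_functional_axioms le2] by metis
  \<comment> \<open>The shifts by 1/2 remove the summand that made \<open>L1\<close> and
    \<open>L2\<close> positive: \<open>L1 - L0 / 2\<close> is the real part of \<open>\<nu>\<close>
    and \<open>L2 - L0 / 2\<close> the imaginary part. So \<open>k\<close> is the density of
    \<open>\<nu>\<close> with respect to the measure of \<open>L0\<close>.\<close>
  define k where "k = (\<lambda>x. Complex (D1 x - 1/2) (D2 x - 1/2))"
  have k_eq: "k x = (complex_of_real (D1 x) - 1/2) + \<i> * (complex_of_real (D2 x) - 1/2)" for x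
    by (simp add: k_def complex_eq_iff)
  have km[measurable]: "k \<in> borel_measurable borel" unfolding k_eq[abs_def] by measurable
  have kle: "cmod (k x) \<le> D1 x + D2 x + 1" for x
  proof -
    have "cmod (k x) \<le> \<bar>D1 x - 1/2\<bar> + \<bar>D2 x - 1/2\<bar>" using cmod_le[of "k x"] by (simp add: k_def)
    then show ?thesis using D1(2)[of x] D2(2)[of x] by linarith
  qed
  have I0: "integrable ?P0 g" and I1: "integrable ?P0 (\<lambda>x. g x * complex_of_real (D1 x))"
    and I2: "integrable ?P0 (\<lambda>x. g x * complex_of_real (D2 x))"
    and E1: "(\<integral>x. g x * complex_of_real (D1 x) \<partial>?P0) = (\<integral>x. g x \<partial>?P1)"
    and E2: "(\<integral>x. g x * complex_of_real (D2 x) \<partial>?P0) = (\<integral>x. g x \<partial>?P2)"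
    if g: "g \<in> Cc" for g
  proof -
    have [measurable]: "g \<in> borel_measurable borel" by (rule Cc_measurable[OF g])
    show "integrable ?P0 g" by (rule L0.integrable_rmeasure[OF g])
    have "integrable ?P1 g" by (rule L1.integrable_rmeasure[OF g])
    then show "integrable ?P0 (\<lambda>x. g x * complex_of_real (D1 x))"
      unfolding D1(3) by (subst (asm) integrable_density) (auto simp: D1(2) scaleR_conv_of_real mult.commute)
    have "integrable ?P2 g" by (rule L2.integrable_rmeasure[OF g])
    then show "integrable ?P0 (\<lambda>x. g x * complex_of_real (D2 x))"
      unfolding D2(3) by (subst (asm) integrable_density) (auto simp: D2(2) scaleR_conv_of_real mult.commute)
    show "(\<integral>x. g x * complex_of_real (D1 x) \<partial>?P0) = (\<integral>x. g x \<partial>?P1)"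
      unfolding D1(3) by (subst integral_density) (auto simp: D1(2) scaleR_conv_of_real mult.commute)
    show "(\<integral>x. g x * complex_of_real (D2 x) \<partial>?P0) = (\<integral>x. g x \<partial>?P2)"
      unfolding D2(3) by (subst integral_density) (auto simp: D2(2) scaleR_conv_of_real mult.commute)
  qed
  have gk_eq: "g x * k x = g x * complex_of_real (D1 x) - (1/2) * g x + \<i> * (g x * complex_of_real (D2 x) - (1/2) * g x)" 
    for g :: "'a \<Rightarrow> complex" and x by (simp add: k_eq algebra_simps)
  have Ik: "integrable ?P0 (\<lambda>x. g x * k x)" if g: "g \<in> Cc" for g
    unfolding gk_eq using I0[OF g] I1[OF g] I2[OF g] by simp
  have Ek: "(\<integral>x. g x * k x \<partial>?P0) = (\<integral>x. g x \<partial>?P1) - (1/2) * (\<integral>x. g x \<partial>?P0) + \<i> * ((\<integral>x. g x \<partial>?P2) - (1/2) * (\<integral>x. g x \<partial>?P0))"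
    if g: "g \<in> Cc" for g
    unfolding gk_eq E1[OF g, symmetric] E2[OF g, symmetric] using I0[OF g] I1[OF g] I2[OF g] by simp
  have nu: "\<nu> g = (\<integral>x. g x * k x \<partial>?P0)" if g: "g \<in> Cc" for g
  proof (rule Cc_linear_ext[OF meas_add[OF meas] meas_scale[OF meas] _ _ _ g])
    show "(\<integral>x. (f x + g x) * k x \<partial>?P0) = (\<integral>x. f x * k x \<partial>?P0) + (\<integral>x. g x * k x \<partial>?P0)" if "f \<in> Cc" "g \<in> Cc" for f g
      using Ik[OF that(1)] Ik[OF that(2)] by (simp add: distrib_right)
    show "(\<integral>x. (c * g x) * k x \<partial>?P0) = c * (\<integral>x. g x * k x \<partial>?P0)" if "g \<in> Cc" for c g
      by (simp add: mult.assoc)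
    show "\<nu> (\<lambda>x. complex_of_real (f x)) = (\<integral>x. complex_of_real (f x) * k x \<partial>?P0)" if f: "f \<in> Ccp" for f
      unfolding Ek[OF Ccp_of_real[OF f]] L0.integral_rmeasure[OF f] L1.integral_rmeasure[OF f] L2.integral_rmeasure[OF f]
      by (simp add: L0_def L1_def L2_def complex_eq_iff)
  qed
  \<comment> \<open>Polar decomposition of \<open>k\<close>: the modulus goes into \<open>M\<close>,
    the phase into \<open>h\<close>. The default value 1 at zeros of \<open>k\<close> makes
    \<open>h\<close> unimodular everywhere; \<open>M\<close> gives those points no mass.\<close>
  define M where "M = density ?P0 (\<lambda>x. ennreal (cmod (k x)))"
  define h where "h = (\<lambda>x. if k x = 0 then 1 else k x / complex_of_real (cmod (k x)))"
  have hm[measurable]: "h \<in> borel_measurable borel" unfolding h_def by measurable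
  have hk: "cmod (k x) *\<^sub>R (g x * h x) = g x * k x" for g x by (simp add: h_def scaleR_conv_of_real)
  have sM[simp]: "sets M = sets borel" by (simp add: M_def)
  \<comment> \<open>The factor 2 comes from \<open>L0 = 2 * tvf\<close>. A bump equal to 1 on
    \<open>K\<close> and supported in \<open>U\<close> compares the measure of \<open>K\<close> with
    \<open>tv_open \<nu> U\<close> for each admissible \<open>U\<close>.\<close>
  have le0: "emeasure ?P0 K \<le> 2 * tv \<nu> K" if K: "compact K" for K
  proof -
    have "emeasure ?P0 K / 2 \<le> tv \<nu> K" unfolding tv_def
    proof (rule INF_greatest, clarify)
      fix U assume U: "open U" "K \<subseteq> U"
      obtain f where f: "f \<in> Ccp" "\<And>x. x \<in> K \<Longrightarrow> f x = 1" "\<And>x. f x \<le> 1" "closure {x. f x \<noteq> 0} \<subseteq> U"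
        using Ccp_bump[OF K U] by metis
      have "ennreal 1 * emeasure ?P0 K \<le> ennreal (L0 f)"
        by (rule L0.emeasure_le_L) (use f K in \<open>auto simp: borel_compact\<close>)
      also have "\<dots> = ennreal (tvf \<nu> f) * 2" using T(3)[OF f(1)] by (simp add: L0_def ennreal_mult mult.commute)
      finally have "emeasure ?P0 K / 2 \<le> ennreal (tvf \<nu> f)" by (intro divide_le_posI_ennreal) (simp_all add: mult.commute)
      then show "emeasure ?P0 K / 2 \<le> tv_open \<nu> U" using tvf_le_tv_open[OF meas f(1,3,4)] by simp
    qed
    then have "emeasure ?P0 K / 2 * 2 \<le> tv \<nu> K * 2" by (rule mult_right_mono) simp
    moreover have "emeasure ?P0 K / 2 * 2 = emeasure ?P0 K" by (simp only: ennreal_divide_times) simp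
    ultimately show ?thesis by (simp only: mult.commute)
  qed
  \<comment> \<open>By \<open>kle\<close> the modulus of \<open>k\<close> is at most
    \<open>D1 + D2 + 1\<close>, and each of the three summands contributes a measure dominated by
    that of \<open>L0\<close>.\<close>
  have MK: "emeasure M K \<le> 3 * emeasure ?P0 K" if K: "compact K" for K
  proof -
    have [measurable]: "K \<in> sets borel" by (rule borel_compact[OF K])
    have "emeasure M K = (\<integral>\<^sup>+x. ennreal (cmod (k x)) * indicator K x \<partial>?P0)"
      unfolding M_def by (subst emeasure_density) auto
    also have "\<dots> \<le> (\<integral>\<^sup>+x. ennreal (D1 x) * indicator K x + ennreal (D2 x) * indicator K x + indicator K x \<partial>?P0)"
    proof (rule nn_integral_mono)
      fix x
      have "ennreal (cmod (k x)) \<le> ennreal (D1 x + D2 x + 1)" by (rule ennreal_leI[OF kle])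
      also have "\<dots> = ennreal (D1 x) + ennreal (D2 x) + 1" using D1(2)[of x] D2(2)[of x] by simp
      finally show "ennreal (cmod (k x)) * indicator K x \<le> ennreal (D1 x) * indicator K x + ennreal (D2 x) * indicator K x + indicator K x"
        by (simp add: indicator_def)
    qed
    also have "\<dots> = (\<integral>\<^sup>+x. ennreal (D1 x) * indicator K x \<partial>?P0) + (\<integral>\<^sup>+x. ennreal (D2 x) * indicator K x \<partial>?P0) + emeasure ?P0 K"
      by (simp add: nn_integral_add)
    also have "(\<integral>\<^sup>+x. ennreal (D1 x) * indicator K x \<partial>?P0) = emeasure ?P1 K"
      unfolding D1(3) by (subst emeasure_density) auto
    also have "(\<integral>\<^sup>+x. ennreal (D2 x) * indicator K x \<partial>?P0) = emeasure ?P2 K"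
      unfolding D2(3) by (subst emeasure_density) auto
    also have "emeasure ?P1 K + emeasure ?P2 K + emeasure ?P0 K \<le> emeasure ?P0 K + emeasure ?P0 K + emeasure ?P0 K"
      by (intro add_mono order_refl L0.emeasure_rmeasure_mono L1.positive_functional_axioms L2.positive_functional_axioms le1 le2) auto
    also have "\<dots> = 3 * emeasure ?P0 K" 
    proof -
      have "(3::ennreal) = 1 + 1 + 1" by simp
      then show ?thesis by (simp only: distrib_right mult_1)
    qed
    finally show ?thesis .
  qed
  have rep: "radon_rep \<nu> M h" unfolding radon_rep_def
  proof (intro conjI ballI allI impI)
    show "emeasure M K < \<infinity>" if K: "compact K" for K
      by (rule le_less_trans[OF MK[OF K]])
         (use L0.rmeasure_compact_finite[OF K] in \<open>simp add: ennreal_mult_less_top\<close>)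
    show "h \<in> borel_measurable M" by (simp add: M_def)
    show "AE x in M. cmod (h x) = 1" by (auto simp: h_def norm_divide)
    show "integrable M (\<lambda>x. g x * h x)" if g: "g \<in> Cc" for g
      unfolding M_def by (subst integrable_density) (use Ik[OF g] Cc_measurable[OF g] in \<open>auto simp: hk\<close>)
    show "\<nu> g = (\<integral>x. g x * h x \<partial>M)" if g: "g \<in> Cc" for g
      unfolding M_def nu[OF g] by (subst integral_density) (use Cc_measurable[OF g] in \<open>auto simp: hk\<close>)
  qed simp
  have "emeasure M K \<le> 6 * tv \<nu> K" if K: "compact K" for K
  proof -
    have "3 * emeasure ?P0 K \<le> 3 * (2 * tv \<nu> K)" by (intro mult_left_mono le0 K) simp
    then show ?thesis using MK[OF K] by (simp add: mult.assoc[symmetric])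
  qed
  then show ?thesis using that[OF rep] by blast
qed

section \<open>Transforms of compactly supported functions\<close>

definition wave :: "'a::euclidean_space \<Rightarrow> 'a \<Rightarrow> complex" where
  "wave x y = exp (complex_of_real (2 * pi * (x \<bullet> y)) * \<i>)"

lemma norm_wave [simp]: "cmod (wave x y) = 1"
  unfolding wave_def by (subst mult.commute) (rule norm_exp_i_times)

lemma wave_add_left: "wave (x + x') y = wave x y * wave x' y"
  by (simp add: wave_def inner_add_left distrib_left distrib_right exp_add)

lemma wave_diff_left: "wave (x - x') y = wave x y * cnj (wave x' y)"
  by (simp add: wave_def inner_diff_left right_diff_distrib left_diff_distrib exp_cnj exp_diff exp_minus divide_inverse)

lemma wave_commute: "wave x y = wave y x"
  by (simp add: wave_def inner_commute)

lemma continuous_wave [continuous_intros]: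
  "continuous_on A f \<Longrightarrow> continuous_on A g \<Longrightarrow> continuous_on A (\<lambda>x. wave (f x) (g x))"
  unfolding wave_def by (intro continuous_intros)

lemma measurable_wave [measurable]:
  "f \<in> borel_measurable M \<Longrightarrow> g \<in> borel_measurable M \<Longrightarrow> (\<lambda>x. wave (f x) (g x)) \<in> borel_measurable M"
  by (rule borel_measurable_continuous_Pair[of f M g wave]) (auto intro!: continuous_intros)

lemma measurable_cnj [measurable]:
  "f \<in> borel_measurable M \<Longrightarrow> (\<lambda>x. cnj (f x)) \<in> borel_measurable M"
  by (rule borel_measurable_continuous_on[of cnj]) (auto intro!: continuous_intros)

lemma inv_ft_wave: "inv_ft f y = (\<integral>x. f x * wave x y \<partial>lborel)"
  by (simp add: inv_ft_def wave_def)

lemma continuous_integral_dominated: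
  fixes F :: "'b::metric_space \<Rightarrow> 'c \<Rightarrow> complex"
  assumes "\<And>y. continuous_on UNIV (\<lambda>x. F x y)" "\<And>x. F x \<in> borel_measurable M"
    "\<And>x y. norm (F x y) \<le> w y" "integrable M w"
  shows "continuous_on UNIV (\<lambda>x. \<integral>y. F x y \<partial>M)"
proof -
  have "isCont (\<lambda>x. \<integral>y. F x y \<partial>M) x" for x
    unfolding continuous_at_sequentially comp_def
  proof (intro allI impI)
    fix X assume X: "X \<longlonglongrightarrow> x"
    show "(\<lambda>n. \<integral>y. F (X n) y \<partial>M) \<longlonglongrightarrow> (\<integral>y. F x y \<partial>M)"
    proof (rule integral_dominated_convergence[OF assms(2) assms(2) assms(4)])
      show "AE y in M. (\<lambda>n. F (X n) y) \<longlonglongrightarrow> F x y"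
      proof (rule AE_I2)
        fix y
        have "isCont (\<lambda>x. F x y) x" using assms(1)[of y] by (simp add: continuous_on_eq_continuous_at)
        then show "(\<lambda>n. F (X n) y) \<longlonglongrightarrow> F x y" using X isCont_tendsto_compose by blast
      qed
    qed (use assms(3) in auto)
  qed
  then show ?thesis by (simp add: continuous_at_imp_continuous_on)
qed

lemma Cc_integrable:
  assumes f: "f \<in> Cc" shows "integrable lborel f"
proof -
  let ?S = "closure {x. f x \<noteq> 0}"
  have "compact ?S" using f by (simp add: Cc_iff compact_closure)
  moreover have "continuous_on ?S f" using f by (auto simp: Cc_iff intro: continuous_on_subset)
  ultimately have "integrable lborel (\<lambda>x. indicator ?S x *\<^sub>R f x)" by (rule borel_integrable_compact)
  moreover have "indicator ?S x *\<^sub>R f x = f x" for x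
    using closure_subset[of "{x. f x \<noteq> 0}"] by (auto simp: indicator_def)
  ultimately show ?thesis by simp
qed

lemma inv_ft_continuous:
  assumes "integrable lborel f" shows "continuous_on UNIV (inv_ft f)"
  unfolding inv_ft_wave[abs_def]
  by (rule continuous_integral_dominated[where w = "\<lambda>x. norm (f x)"])
     (use assms in \<open>auto intro!: continuous_intros simp: norm_mult\<close>)

lemma norm_inv_ft_le:
  assumes "integrable lborel f" shows "cmod (inv_ft f y) \<le> (\<integral>x. cmod (f x) \<partial>lborel)"
  unfolding inv_ft_wave using integral_norm_bound[of lborel "\<lambda>x. f x * wave x y"] by (simp add: norm_mult)

lemma inv_ft_measurable [measurable]:
  "integrable lborel f \<Longrightarrow> inv_ft f \<in> borel_measurable borel"
  by (rule borel_measurable_continuous_onI[OF inv_ft_continuous])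

text \<open>A bounded kernel keeps the product of two integrable functions integrable on the product
  space. Every exchange of Bochner integrals below goes through this form.\<close>

lemma Fubini_kernel:
  fixes f :: "'b \<Rightarrow> complex" and g :: "'c \<Rightarrow> complex"
  assumes "sigma_finite_measure M" "sigma_finite_measure N"
    and f: "integrable M f" and g: "integrable N g"
    and k[measurable]: "case_prod k \<in> borel_measurable (M \<Otimes>\<^sub>M N)" and b: "\<And>x y. cmod (k x y) \<le> B"
  shows "(\<integral>x. f x * (\<integral>y. g y * k x y \<partial>N) \<partial>M) = (\<integral>y. g y * (\<integral>x. f x * k x y \<partial>M) \<partial>N)"
proof -
  interpret M: sigma_finite_measure M by fact
  interpret N: sigma_finite_measure N by fact
  interpret P: pair_sigma_finite M N ..
  have [measurable]: "f \<in> borel_measurable M" "g \<in> borel_measurable N" using f g by auto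
  have 1: "integrable (M \<Otimes>\<^sub>M N) (\<lambda>p. f (fst p) * g (snd p))"
    by (rule P.Fubini_integrable) (use f g in \<open>auto simp: norm_mult\<close>)
  have "integrable (M \<Otimes>\<^sub>M N) (\<lambda>p. complex_of_real B * (f (fst p) * g (snd p)))" using 1 by simp
  then have 2: "integrable (M \<Otimes>\<^sub>M N) (\<lambda>p. f (fst p) * g (snd p) * k (fst p) (snd p))"
  proof (rule Bochner_Integration.integrable_bound)
    have "(\<lambda>p. k (fst p) (snd p)) \<in> borel_measurable (M \<Otimes>\<^sub>M N)" using k by (simp add: split_beta')
    then show "(\<lambda>p. f (fst p) * g (snd p) * k (fst p) (snd p)) \<in> borel_measurable (M \<Otimes>\<^sub>M N)" by measurable
    have "0 \<le> B" using b[of undefined undefined] norm_ge_zero order_trans by blast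
    then have "cmod (f x * g y * k x y) \<le> cmod (complex_of_real B * (f x * g y))" for x y
      using mult_left_mono[OF b[of x y], of "cmod (f x * g y)"] by (simp add: norm_mult mult.commute mult.left_commute)
    then show "AE p in M \<Otimes>\<^sub>M N. cmod (f (fst p) * g (snd p) * k (fst p) (snd p)) \<le> cmod (complex_of_real B * (f (fst p) * g (snd p)))"
      by simp
  qed
  have "(\<integral>x. \<integral>y. f x * g y * k x y \<partial>N \<partial>M) = (\<integral>y. \<integral>x. f x * g y * k x y \<partial>M \<partial>N)"
    by (rule P.Fubini_integral[symmetric]) (use 2 in \<open>simp add: split_beta'\<close>)
  moreover have "(\<integral>y. f x * g y * k x y \<partial>N) = f x * (\<integral>y. g y * k x y \<partial>N)" for x by (simp add: mult.assoc)
  moreover have "(\<integral>x. f x * g y * k x y \<partial>M) = g y * (\<integral>x. f x * k x y \<partial>M)" for y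
    by (simp add: mult.assoc mult.left_commute[of _ "g y"])
  ultimately show ?thesis by simp
qed

lemma sigma_finite_lborel: "sigma_finite_measure lborel"
  by (rule lborel.sigma_finite_measure_axioms)

lemma lborel_distr_reflect: "distr lborel borel (\<lambda>x. t - x) = (lborel :: 'a::euclidean_space measure)"
  using lborel_affine[of "-1" t] by (simp add: density_1)

lemma lborel_integral_reflect:
  fixes g :: "'a::euclidean_space \<Rightarrow> 'b::{banach, second_countable_topology}"
  assumes "g \<in> borel_measurable borel"
  shows "(\<integral>x. g (t - x) \<partial>lborel) = (\<integral>x. g x \<partial>lborel)"
  by (subst (2) lborel_distr_reflect[of t, symmetric], subst integral_distr) (use assms in auto)

lemma conv_tilde_eq: "conv f (tilde f) x = (\<integral>y. f y * cnj (f (y - x)) \<partial>lborel)"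
  by (simp add: conv_def tilde_def)

lemma conv_tilde_Cc:
  assumes f: "f \<in> Cc" shows "conv f (tilde f) \<in> Cc"
proof -
  obtain B where B: "B > 0" "\<And>x. cmod (f x) \<le> B" using Cc_bounded[OF f] by metis
  obtain R where R: "\<And>x. f x \<noteq> 0 \<Longrightarrow> norm x \<le> R" using f unfolding Cc_iff bounded_iff by auto
  note [measurable] = Cc_measurable[OF f]
  have "continuous_on UNIV (\<lambda>x. \<integral>y. f y * cnj (f (y - x)) \<partial>lborel)"
  proof (rule continuous_integral_dominated)
    show "continuous_on UNIV (\<lambda>x. f y * cnj (f (y - x)))" for y
      by (intro continuous_intros continuous_on_compose2[OF Cc_continuous[OF f]]) auto
    show "norm (f y * cnj (f (y - x))) \<le> B * norm (f y)" for x y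
      using mult_left_mono[OF B(2)[of "y - x"], of "cmod (f y)"] by (simp add: norm_mult mult.commute)
    show "integrable lborel (\<lambda>y. B * norm (f y))" using Cc_integrable[OF f] by simp
  qed measurable
  moreover have "bounded {x. conv f (tilde f) x \<noteq> 0}"
  proof (rule boundedI)
    fix x assume "x \<in> {x. conv f (tilde f) x \<noteq> 0}"
    then have "\<exists>y. f y * cnj (f (y - x)) \<noteq> 0" unfolding conv_tilde_eq by (metis (mono_tags, lifting) integral_zero mem_Collect_eq Bochner_Integration.integral_cong)
    then obtain y where "f y \<noteq> 0" "f (y - x) \<noteq> 0" by auto
    then have "norm y \<le> R" "norm (y - x) \<le> R" using R by auto
    then show "norm x \<le> 2 * R" using norm_triangle_ineq4[of y "y - x"] by simp
  qed
  ultimately show ?thesis unfolding Cc_iff conv_tilde_eq[abs_def] by blast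
qed

lemma inv_ft_conv_tilde:
  assumes f: "f \<in> Cc" shows "inv_ft (conv f (tilde f)) z = complex_of_real ((cmod (inv_ft f z))\<^sup>2)"
proof -
  obtain B where B: "B > 0" "\<And>x. cmod (f x) \<le> B" using Cc_bounded[OF f] by metis
  obtain R where R: "\<And>x. f x \<noteq> 0 \<Longrightarrow> norm x \<le> R" using f unfolding Cc_iff bounded_iff by auto
  note [measurable] = Cc_measurable[OF f]
  \<comment> \<open>Since \<open>f y\<close> and \<open>f (y - x)\<close> are both nonzero only if
    \<open>norm x \<le> 2 * R\<close>, inserting this indicator changes nothing; it provides the
    integrable factor in \<open>x\<close> that \<open>Fubini_kernel\<close> asks for.\<close>
  let ?I = "\<lambda>x. complex_of_real (indicator (cball 0 (2 * R)) x)"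
  let ?k = "\<lambda>x y. cnj (f (y - x)) * wave x z"
  have Ik: "f y * (?I x * ?k x y) = f y * ?k x y" for x y
  proof (cases "f y \<noteq> 0 \<and> f (y - x) \<noteq> 0")
    case True
    then have "norm y \<le> R" "norm (y - x) \<le> R" using R by auto
    then have "norm x \<le> 2 * R" using norm_triangle_ineq4[of y "y - x"] by simp
    then show ?thesis by simp
  qed auto
  have int: "integrable lborel ?I" 
    by (intro integrable_of_real integrable_real_indicator) (use emeasure_lborel_cball_finite[of 0 "2 * R"] in auto)
  have shift: "(\<integral>x. ?k x y \<partial>lborel) = (\<integral>x. cnj (f x) * wave (y - x) z \<partial>lborel)" for y
    using lborel_integral_reflect[of "\<lambda>x. cnj (f x) * wave (y - x) z" y] by simp
  have "inv_ft (conv f (tilde f)) z = (\<integral>x. \<integral>y. f y * ?k x y \<partial>lborel \<partial>lborel)"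
    unfolding inv_ft_wave conv_tilde_eq by (subst integral_mult_left_zero[symmetric]) (simp add: mult.assoc)
  also have "\<dots> = (\<integral>x. ?I x * (\<integral>y. f y * ?k x y \<partial>lborel) \<partial>lborel)"
    by (subst integral_mult_right_zero[symmetric], subst mult.left_commute, subst Ik) simp
  also have "\<dots> = (\<integral>y. f y * (\<integral>x. ?I x * ?k x y \<partial>lborel) \<partial>lborel)"
    by (rule Fubini_kernel[OF sigma_finite_lborel sigma_finite_lborel int Cc_integrable[OF f], where B = B])
       (auto simp: norm_mult B(2))
  also have "\<dots> = (\<integral>y. f y * (\<integral>x. ?k x y \<partial>lborel) \<partial>lborel)"
    by (subst (1 2) integral_mult_right_zero[symmetric], subst Ik) simp
  also have "\<dots> = (\<integral>y. f y * (\<integral>x. cnj (f x) * wave (y - x) z \<partial>lborel) \<partial>lborel)"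
    by (simp only: shift)
  also have "\<dots> = (\<integral>y. f y * (wave y z * cnj (inv_ft f z)) \<partial>lborel)"
  proof -
    have "(\<integral>x. cnj (f x) * wave (y - x) z \<partial>lborel) = (\<integral>x. wave y z * cnj (f x * wave x z) \<partial>lborel)" for y
      by (simp add: wave_diff_left mult_ac)
    also have "\<dots> y = wave y z * cnj (inv_ft f z)" for y
      by (simp only: inv_ft_wave integral_mult_right_zero Bochner_Integration.integral_cnj)
    finally show ?thesis by simp
  qed
  also have "\<dots> = inv_ft f z * cnj (inv_ft f z)"
    unfolding inv_ft_wave[of f z] by (simp add: mult.assoc[symmetric])
  also have "\<dots> = complex_of_real ((cmod (inv_ft f z))\<^sup>2)" by (simp add: complex_norm_square del: of_real_power)
  finally show ?thesis .
qed

section \<open>Division by the transform of a bump\<close>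

lemma Cc_closure_nonzero:
  assumes "f \<in> Cc" shows "compact (closure {x. f x \<noteq> 0})"
  using assms by (simp add: Cc_iff compact_closure)

text \<open>The set where \<open>q\<close> is nonzero and the complement of the support of
  \<open>g\<close> are open and cover the space; on the second the quotient is identically
  0.\<close>

lemma Cc_divide:
  assumes g: "g \<in> Cc" and q: "continuous_on UNIV q" and nz: "\<And>x. x \<in> closure {x. g x \<noteq> 0} \<Longrightarrow> q x \<noteq> 0"
  shows "(\<lambda>x. g x / q x) \<in> Cc"
proof (rule Cc_dominated[OF g])
  let ?S = "closure {x. g x \<noteq> 0}"
  have "continuous_on ({x. q x \<noteq> 0} \<union> - ?S) (\<lambda>x. g x / q x)"
  proof (rule continuous_on_open_Un)
    show "open {x. q x \<noteq> 0}" by (intro open_Collect_neq q continuous_intros)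
    show "continuous_on {x. q x \<noteq> 0} (\<lambda>x. g x / q x)"
      by (intro continuous_intros continuous_on_subset[OF q] continuous_on_subset[OF Cc_continuous[OF g]]) auto
    have "continuous_on (- ?S) (\<lambda>x. 0 :: complex)" by simp
    then show "continuous_on (- ?S) (\<lambda>x. g x / q x)"
      by (rule continuous_on_eq) (use closure_subset[of "{x. g x \<noteq> 0}"] in auto)
  qed auto
  moreover have "{x. q x \<noteq> 0} \<union> - ?S = UNIV" using nz by auto
  ultimately show "continuous_on UNIV (\<lambda>x. g x / q x)" by simp
qed simp

text \<open>If the bump is so narrow that \<open>wave x y\<close> stays within 1/2 of 1 on its
  support, for all \<open>y\<close> in \<open>S\<close>, its transform differs from its mass by at
  most half the mass and cannot vanish on \<open>S\<close>.\<close>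

lemma inv_ft_bump:
  fixes S :: "'a::euclidean_space set"
  assumes S: "compact S"
  obtains \<phi> where "\<phi> \<in> Ccp" "\<And>x. \<phi> x \<le> 1" "\<And>x. 1 < norm x \<Longrightarrow> \<phi> x = 0" "0 < (\<integral>x. \<phi> x \<partial>lborel)"
    "\<And>y. y \<in> S \<Longrightarrow> inv_ft (\<lambda>x. complex_of_real (\<phi> x)) y \<noteq> 0"
proof -
  obtain R where R: "R > 0" "\<And>y. y \<in> S \<Longrightarrow> norm y \<le> R" 
    using S compact_imp_bounded bounded_pos by metis
  \<comment> \<open>The bound 1 keeps the support in the unit ball; \<open>1 / (4 * pi * R)\<close>
    keeps the phase \<open>2 * pi * (x \<bullet> y)\<close> below 1/2 in modulus for
    \<open>norm y \<le> R\<close>.\<close>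
  define r where "r = min 1 (1 / (4 * pi * R))"
  have r: "0 < r" "r \<le> 1" "r \<le> 1 / (4 * pi * R)" using R by (auto simp: r_def)
  define \<phi> where "\<phi> = (\<lambda>x::'a. max 0 (r - norm x))"
  have nz: "\<phi> x \<noteq> 0 \<Longrightarrow> norm x < r" and nn: "0 \<le> \<phi> x" for x by (auto simp: \<phi>_def max_def split: if_splits)
  have "bounded {x. \<phi> x \<noteq> 0}" by (rule boundedI[where B = r]) (use nz in fastforce)
  then have C: "\<phi> \<in> Ccp" unfolding Ccp_def \<phi>_def by (auto intro!: continuous_intros)
  have int: "integrable lborel \<phi>" using integrable_Re[OF Cc_integrable[OF Ccp_of_real[OF C]]] by simp
  have pos: "0 < (\<integral>x. \<phi> x \<partial>lborel)"
  proof -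
    have "(\<integral>x. indicator (ball (0::'a) (r/2)) x * (r/2) \<partial>lborel) \<le> (\<integral>x. \<phi> x \<partial>lborel)"
    proof (rule Bochner_Integration.integral_mono)
      show "integrable lborel (\<lambda>x::'a. indicator (ball 0 (r/2)) x * (r/2))"
        by (intro integrable_mult_left integrable_real_indicator)
           (use emeasure_lborel_ball_finite[of "0::'a" "r/2"] in auto)
      show "indicator (ball 0 (r/2)) x * (r/2) \<le> \<phi> x" for x
        by (auto simp: \<phi>_def indicator_def max_def)
    qed (rule int)
    moreover have "0 < measure lborel (ball (0::'a) (r/2))" using r content_ball_pos[of "r/2" "0::'a"] by simp
    then have *: "0 < measure lborel (ball (0::'a) (r/2)) * (r/2)" using r by simp
    ultimately show ?thesis using * by simp
  qed
  have "inv_ft (\<lambda>x. complex_of_real (\<phi> x)) y \<noteq> 0" if y: "y \<in> S" for y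
  proof
    assume 0: "inv_ft (\<lambda>x. complex_of_real (\<phi> x)) y = 0"
    have intw: "integrable lborel (\<lambda>x. complex_of_real (\<phi> x) * wave x y)"
      by (rule Bochner_Integration.integrable_bound[OF int]) 
         (use int in \<open>auto simp: norm_mult intro!: borel_measurable_times borel_measurable_of_real\<close>)
    have "complex_of_real (\<integral>x. \<phi> x \<partial>lborel) = (\<integral>x. complex_of_real (\<phi> x) - complex_of_real (\<phi> x) * wave x y \<partial>lborel)"
      using 0 int intw unfolding inv_ft_wave by (subst Bochner_Integration.integral_diff) auto
    then have "cmod (complex_of_real (\<integral>x. \<phi> x \<partial>lborel)) \<le> (\<integral>x. cmod (complex_of_real (\<phi> x) - complex_of_real (\<phi> x) * wave x y) \<partial>lborel)"
      by (simp only: integral_norm_bound)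
    also have "\<dots> \<le> (\<integral>x. (1/2) * \<phi> x \<partial>lborel)"
    proof (rule Bochner_Integration.integral_mono)
      show "integrable lborel (\<lambda>x. cmod (complex_of_real (\<phi> x) - complex_of_real (\<phi> x) * wave x y))"
        using int intw by (intro integrable_norm Bochner_Integration.integrable_diff) auto
      show "integrable lborel (\<lambda>x. (1/2) * \<phi> x)" using int by simp
      fix x
      show "cmod (complex_of_real (\<phi> x) - complex_of_real (\<phi> x) * wave x y) \<le> (1/2) * \<phi> x"
      proof (cases "\<phi> x = 0")
        case False
        have "cmod (wave x y - 1) \<le> \<bar>2 * pi * (x \<bullet> y)\<bar>"
          using iexp_approx1[of "2 * pi * (x \<bullet> y)" 0] by (simp add: wave_def mult.commute)
        also have "\<dots> = 2 * pi * \<bar>x \<bullet> y\<bar>" by (simp add: abs_mult)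
        also have "\<dots> \<le> 2 * pi * (norm x * norm y)" by (intro mult_left_mono Cauchy_Schwarz_ineq2) simp
        also have "\<dots> \<le> 2 * pi * (1 / (4 * pi * R) * R)"
          using nz[OF False] r R(1) R(2)[OF y] by (intro mult_left_mono mult_mono) auto
        also have "\<dots> = 1/2" using R by simp
        finally have "cmod (1 - wave x y) \<le> 1/2" by (simp add: norm_minus_commute)
        then have "\<phi> x * cmod (1 - wave x y) \<le> \<phi> x * (1/2)" by (intro mult_left_mono nn)
        moreover have "cmod (complex_of_real (\<phi> x) * (1 - wave x y)) = \<phi> x * cmod (1 - wave x y)"
          using nn[of x] by (simp add: norm_mult)
        ultimately show ?thesis by (simp add: right_diff_distrib)
      qed simp
    qed
    finally show False using pos by simp
  qed
  then show ?thesis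
  proof (rule that[OF C _ _ pos, rotated 2])
    show "\<phi> x \<le> 1" for x using r norm_ge_zero[of x] by (simp add: \<phi>_def del: norm_ge_zero)
    show "\<phi> x = 0" if "1 < norm x" for x using that r by (simp add: \<phi>_def)
  qed
qed

section \<open>Gaussians, square integrability and uniform tails\<close>

text \<open>A rescaling of the characteristic function of the standard normal law.\<close>

lemma gauss_integral_real:
  fixes a \<theta> :: real
  assumes a: "0 < a"
  shows "integrable lborel (\<lambda>t. complex_of_real (exp (- (a * t)\<^sup>2 / 2)) * iexp (\<theta> * t))"
    and "(\<integral>t. complex_of_real (exp (- (a * t)\<^sup>2 / 2)) * iexp (\<theta> * t) \<partial>lborel)
      = complex_of_real (sqrt (2 * pi) / a * exp (- (\<theta> / a)\<^sup>2 / 2))"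
proof -
  define F where "F = (\<lambda>\<theta> t::real. complex_of_real (exp (- t\<^sup>2 / 2)) * iexp (\<theta> * t))"
  have F_eq: "F \<theta> t = complex_of_real (sqrt (2 * pi)) * (std_normal_density t *\<^sub>R iexp (\<theta> * t))" for \<theta> t
    by (simp add: F_def std_normal_density_def scaleR_conv_of_real)
  have sd: "integrable lborel (\<lambda>t. std_normal_density t *\<^sub>R iexp (\<theta> * t))" for \<theta>
    by (rule Bochner_Integration.integrable_bound[OF integrable_normal_density[where \<mu> = 0 and \<sigma> = 1]]) auto
  have intF: "integrable lborel (F \<theta>)" for \<theta>
    unfolding F_eq[abs_def] by (intro integrable_mult_right sd)
  have "(\<integral>t. std_normal_density t *\<^sub>R iexp (\<theta> * t) \<partial>lborel) = char std_normal_distribution \<theta>" for \<theta>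
    unfolding char_def by (subst integral_density) auto
  note ch = this[unfolded char_std_normal_distribution]
  have IF: "(\<integral>t. F \<theta> t \<partial>lborel) = complex_of_real (sqrt (2 * pi)) * complex_of_real (exp (- \<theta>\<^sup>2 / 2))" for \<theta>
    unfolding F_eq[abs_def] integral_mult_right_zero ch ..
  have scale: "F (\<theta> / a) (0 + a * t) = complex_of_real (exp (- (a * t)\<^sup>2 / 2)) * iexp (\<theta> * t)" for t
    using a by (simp add: F_def)
  show "integrable lborel (\<lambda>t. complex_of_real (exp (- (a * t)\<^sup>2 / 2)) * iexp (\<theta> * t))"
    using lborel_integrable_real_affine[OF intF[of "\<theta> / a"], of a 0] a unfolding scale by simp
  have "(\<integral>t. F (\<theta> / a) t \<partial>lborel) = \<bar>a\<bar> *\<^sub>R (\<integral>t. F (\<theta> / a) (0 + a * t) \<partial>lborel)"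
    by (rule lborel_integral_real_affine) (use a in simp)
  then show "(\<integral>t. complex_of_real (exp (- (a * t)\<^sup>2 / 2)) * iexp (\<theta> * t) \<partial>lborel)
      = complex_of_real (sqrt (2 * pi) / a * exp (- (\<theta> / a)\<^sup>2 / 2))"
    unfolding scale IF using a by (simp add: scaleR_conv_of_real field_simps)
qed

text \<open>\<open>lborel\<close> is the image of a product of one-dimensional Lebesgue measures
  under the coordinate map, so products over the coordinates integrate factor by factor.\<close>

lemma lborel_integral_prod_Basis:
  fixes F :: "'a::euclidean_space \<Rightarrow> real \<Rightarrow> complex"
  assumes F: "\<And>b. b \<in> Basis \<Longrightarrow> integrable lborel (F b)"
  shows "integrable lborel (\<lambda>x. \<Prod>b\<in>Basis. F b (x \<bullet> b))"
    and "(\<integral>x. (\<Prod>b\<in>Basis. F b (x \<bullet> b)) \<partial>lborel) = (\<Prod>b\<in>Basis. \<integral>t. F b t \<partial>lborel)"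
proof -
  interpret product_sigma_finite "\<lambda>_::'a. lborel :: real measure" by standard
  have [measurable]: "b \<in> Basis \<Longrightarrow> F b \<in> borel_measurable borel" for b using F[of b] by auto
  have meas: "(\<lambda>x. \<Prod>b\<in>Basis. F b (x \<bullet> b)) \<in> borel_measurable borel" by measurable
  have T: "(\<lambda>f. \<Sum>b\<in>Basis. f b *\<^sub>R b) \<in> measurable (\<Pi>\<^sub>M b\<in>Basis. lborel) borel" by measurable
  have eq: "(\<Prod>b\<in>Basis. F b ((\<Sum>b\<in>Basis. f b *\<^sub>R b) \<bullet> b)) = (\<Prod>b\<in>Basis. F b (f b))" for f :: "'a \<Rightarrow> real"
    by (rule prod.cong) auto
  show "integrable lborel (\<lambda>x. \<Prod>b\<in>Basis. F b (x \<bullet> b))"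
    by (subst lborel_eq, subst integrable_distr_eq[OF T meas]) (simp add: eq product_integrable_prod F)
  show "(\<integral>x. (\<Prod>b\<in>Basis. F b (x \<bullet> b)) \<partial>lborel) = (\<Prod>b\<in>Basis. \<integral>t. F b t \<partial>lborel)"
    by (subst lborel_eq, subst integral_distr[OF T meas]) (simp add: eq product_integral_prod F)
qed

definition gauss :: "real \<Rightarrow> 'a::euclidean_space \<Rightarrow> real" where
  "gauss a x = exp (- (a * norm x)\<^sup>2 / 2)"

lemma gauss_pos: "0 < gauss a x" and gauss_le_1: "gauss a x \<le> 1" and gauss_0 [simp]: "gauss a 0 = 1"
  by (simp_all add: gauss_def)

lemma continuous_gauss: "continuous_on UNIV (gauss a)"
  unfolding gauss_def[abs_def] by (intro continuous_intros) auto

lemma gauss_prod: "gauss a x = (\<Prod>b\<in>Basis. exp (- (a * (x \<bullet> b))\<^sup>2 / 2))"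
proof -
  have "(norm x)\<^sup>2 = (\<Sum>b\<in>Basis. (x \<bullet> b)\<^sup>2)"
    unfolding power2_norm_eq_inner by (subst euclidean_inner) (simp add: power2_eq_square)
  then have "- (a * norm x)\<^sup>2 / 2 = (\<Sum>b\<in>Basis. - (a * (x \<bullet> b))\<^sup>2 / 2)"
    by (simp add: power_mult_distrib sum_divide_distrib[symmetric] sum_distrib_left[symmetric] sum_negf)
  then show ?thesis by (simp add: gauss_def exp_sum)
qed

lemma wave_prod: "wave x y = (\<Prod>b\<in>Basis. iexp (2 * pi * (y \<bullet> b) * (x \<bullet> b)))"
proof -
  have "complex_of_real (2 * pi * (x \<bullet> y)) * \<i> = (\<Sum>b\<in>Basis. \<i> * complex_of_real (2 * pi * (y \<bullet> b) * (x \<bullet> b)))"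
    by (subst euclidean_inner) (simp add: sum_distrib_left sum_distrib_right mult_ac)
  then show ?thesis unfolding wave_def by (simp only: exp_sum[OF finite_Basis])
qed

lemma integrable_gauss: "0 < a \<Longrightarrow> integrable lborel (\<lambda>x::'a::euclidean_space. complex_of_real (gauss a x))"
  and inv_ft_gauss: "0 < a \<Longrightarrow> inv_ft (\<lambda>x. complex_of_real (gauss a x)) (y::'a) =
    complex_of_real ((sqrt (2 * pi) / a) ^ DIM('a) * gauss (2 * pi / a) y)"
proof -
  assume a: "0 < a"
  define F where "F = (\<lambda>(y::'a) b t. complex_of_real (exp (- (a * t)\<^sup>2 / 2)) * iexp (2 * pi * (y \<bullet> b) * t))"
  have gw: "complex_of_real (gauss a x) * wave x y = (\<Prod>b\<in>Basis. F y b (x \<bullet> b))" for x y :: 'a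
    by (simp add: F_def prod.distrib gauss_prod wave_prod)
  have int: "integrable lborel (F y b)" for y b unfolding F_def by (rule gauss_integral_real(1)[OF a])
  have 1: "integrable lborel (\<lambda>x. complex_of_real (gauss a x) * wave x y)" for y :: 'a
    unfolding gw by (rule lborel_integral_prod_Basis(1)[OF int])
  show "integrable lborel (\<lambda>x::'a. complex_of_real (gauss a x))"
    using 1[of 0] by (simp add: wave_def)
  show "inv_ft (\<lambda>x. complex_of_real (gauss a x)) (y::'a) =
    complex_of_real ((sqrt (2 * pi) / a) ^ DIM('a) * gauss (2 * pi / a) y)"
  proof -
    have "inv_ft (\<lambda>x. complex_of_real (gauss a x)) y = (\<Prod>b\<in>Basis. \<integral>t. F y b t \<partial>lborel)"
      unfolding inv_ft_wave gw by (rule lborel_integral_prod_Basis(2)[OF int])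
    also have "\<dots> = (\<Prod>b\<in>(Basis::'a set). complex_of_real (sqrt (2 * pi) / a * exp (- (2 * pi / a * (y \<bullet> b))\<^sup>2 / 2)))"
      unfolding F_def gauss_integral_real(2)[OF a] by simp
    also have "\<dots> = complex_of_real (\<Prod>b\<in>(Basis::'a set). sqrt (2 * pi) / a * exp (- (2 * pi / a * (y \<bullet> b))\<^sup>2 / 2))"
      by (rule of_real_prod[symmetric])
    finally show ?thesis by (simp only: prod.distrib prod_constant gauss_prod)
  qed
qed

lemma integrable_gauss_real: "0 < a \<Longrightarrow> integrable lborel (gauss a :: 'a::euclidean_space \<Rightarrow> real)"
  using integrable_Re[OF integrable_gauss] by simp

lemma integral_gauss:
  assumes "0 < a" shows "integral\<^sup>L lborel (gauss a :: 'a \<Rightarrow> real) = (sqrt (2 * pi) / a) ^ DIM('a::euclidean_space)"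
proof -
  have "complex_of_real (integral\<^sup>L lborel (gauss a :: 'a \<Rightarrow> real)) = inv_ft (\<lambda>x::'a. complex_of_real (gauss a x)) 0"
    unfolding inv_ft_wave by (simp add: wave_def)
  then show ?thesis unfolding inv_ft_gauss[OF assms] by (simp only: of_real_eq_iff gauss_0 mult_1_right)
qed

text \<open>The transform of \<open>gauss a\<close>, by \<open>inv_ft_gauss\<close>: a Gaussian
  probability density that concentrates at 0 as \<open>a\<close> tends to 0.\<close>

definition heat :: "real \<Rightarrow> 'a::euclidean_space \<Rightarrow> real" where
  "heat a x = (sqrt (2 * pi) / a) ^ DIM('a) * gauss (2 * pi / a) x"

lemma heat_nonneg: "0 < a \<Longrightarrow> 0 \<le> heat a x"
  by (simp add: heat_def less_imp_le[OF gauss_pos])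

lemma integrable_heat: "0 < a \<Longrightarrow> integrable lborel (heat a)"
  unfolding heat_def[abs_def] by (intro integrable_mult_right integrable_gauss_real) simp

lemma integral_heat:
  assumes "0 < a" shows "(\<integral>x. heat a x \<partial>lborel) = 1"
proof -
  have "(sqrt (2 * pi) / a) * (sqrt (2 * pi) / (2 * pi / a)) = 1"
    using assms by (simp add: field_simps)
  then show ?thesis using assms
    by (simp add: heat_def integral_gauss power_mult_distrib[symmetric] del: power_mult_distrib)
qed

text \<open>The energy is the transform of \<open>conv f (tilde f)\<close>. Damped by
  \<open>gauss a\<close>, its integral equals that of \<open>conv f (tilde f)\<close> against the
  probability density \<open>heat a\<close>, so the sup norm of the convolution bounds it for every
  \<open>a\<close>. Fatou's lemma removes the damping as \<open>a\<close> tends to 0.\<close>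

theorem inv_ft_square_integrable:
  fixes f :: "'a::euclidean_space \<Rightarrow> complex"
  assumes f: "f \<in> Cc" shows "integrable lborel (\<lambda>y. (cmod (inv_ft f y))\<^sup>2)"
proof -
  let ?p = "conv f (tilde f)"
  have p: "?p \<in> Cc" by (rule conv_tilde_Cc[OF f])
  note [measurable] = Cc_measurable[OF f] inv_ft_measurable[OF Cc_integrable[OF f]] 
    borel_measurable_continuous_onI[OF continuous_gauss]
  obtain B where B: "B > 0" "\<And>x. cmod (?p x) \<le> B" using Cc_bounded[OF p] by metis
  have bound: "(\<integral>\<^sup>+y. ennreal (gauss a y * (cmod (inv_ft f y))\<^sup>2) \<partial>lborel) \<le> ennreal B" if a: "0 < a" for a
  proof -
    have "(\<integral>x. ?p x * (\<integral>y. complex_of_real (gauss a y) * wave x y \<partial>lborel) \<partial>lborel) =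
      (\<integral>y. complex_of_real (gauss a y) * (\<integral>x. ?p x * wave x y \<partial>lborel) \<partial>lborel)"
      by (rule Fubini_kernel[OF sigma_finite_lborel sigma_finite_lborel Cc_integrable[OF p] integrable_gauss[OF a], where B = 1])
         auto
    moreover have "(\<integral>y. complex_of_real (gauss a y) * wave x y \<partial>lborel) = complex_of_real (heat a x)" for x :: 'a
      unfolding heat_def inv_ft_gauss[OF a, symmetric] inv_ft_wave by (simp add: wave_commute)
    ultimately have eq: "(\<integral>y. complex_of_real (gauss a y * (cmod (inv_ft f y))\<^sup>2) \<partial>lborel) = (\<integral>x. ?p x * complex_of_real (heat a x) \<partial>lborel)"
      unfolding inv_ft_wave[symmetric] inv_ft_conv_tilde[OF f] by simp
    obtain C where C: "\<And>y. (cmod (inv_ft f y))\<^sup>2 \<le> C"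
      using norm_inv_ft_le[OF Cc_integrable[OF f]] by (meson norm_ge_zero power_mono)
    have C0: "0 \<le> C" using C[of 0] zero_le_power2 order_trans by blast
    have int: "integrable lborel (\<lambda>y. gauss a y * (cmod (inv_ft f y))\<^sup>2)"
    proof (rule Bochner_Integration.integrable_bound)
      show "integrable lborel (\<lambda>y::'a. C * gauss a y)" by (intro integrable_mult_right integrable_gauss_real a)
      have "gauss a y * (cmod (inv_ft f y))\<^sup>2 \<le> C * gauss a y" for y
        using mult_right_mono[OF C[of y] less_imp_le[OF gauss_pos[of a y]]] by (simp add: mult.commute)
      then show "AE y in lborel. norm (gauss a y * (cmod (inv_ft f y))\<^sup>2) \<le> norm (C * gauss a y)"
        by (intro AE_I2) (simp add: less_imp_le[OF gauss_pos] abs_mult C0)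
    qed simp
    have "(\<integral>y. gauss a y * (cmod (inv_ft f y))\<^sup>2 \<partial>lborel) \<le> cmod (\<integral>x. ?p x * complex_of_real (heat a x) \<partial>lborel)"
      by (simp only: eq[symmetric] integral_complex_of_real norm_of_real abs_ge_self)
    also have "\<dots> \<le> (\<integral>x. cmod (?p x * complex_of_real (heat a x)) \<partial>lborel)" by (rule integral_norm_bound)
    also have "\<dots> \<le> (\<integral>x. B * heat a (x::'a) \<partial>lborel)"
    proof (rule Bochner_Integration.integral_mono')
      show "integrable lborel (\<lambda>x::'a. B * heat a x)" by (intro integrable_mult_right integrable_heat a)
      show "cmod (?p x * complex_of_real (heat a x)) \<le> B * heat a x" for x
        using mult_right_mono[OF B(2)[of x] heat_nonneg[OF a, of x]] heat_nonneg[OF a, of x] by (simp add: norm_mult)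
    qed (auto intro!: mult_nonneg_nonneg simp: heat_nonneg[OF a] less_imp_le[OF B(1)])
    also have "\<dots> = B" by (simp add: integral_heat a)
    finally have "(\<integral>y. gauss a y * (cmod (inv_ft f y))\<^sup>2 \<partial>lborel) \<le> B" .
    moreover have "(\<integral>\<^sup>+y. ennreal (gauss a y * (cmod (inv_ft f y))\<^sup>2) \<partial>lborel) = ennreal (\<integral>y. gauss a y * (cmod (inv_ft f y))\<^sup>2 \<partial>lborel)"
      by (rule nn_integral_eq_integral[OF int]) (simp add: less_imp_le[OF gauss_pos])
    ultimately show ?thesis by (simp add: ennreal_leI)
  qed
  define G where "G = (\<lambda>n y. ennreal (gauss (inverse (real (Suc n))) y * (cmod (inv_ft f y))\<^sup>2))"
  have [measurable]: "G n \<in> borel_measurable lborel" for n unfolding G_def by measurable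
  have lim: "(\<lambda>n. G n y) \<longlonglongrightarrow> ennreal ((cmod (inv_ft f y))\<^sup>2)" for y
  proof -
    have "(\<lambda>n. exp (- (inverse (real (Suc n)) * norm y)\<^sup>2 / 2) * (cmod (inv_ft f y))\<^sup>2) \<longlonglongrightarrow> exp (- (0 * norm y)\<^sup>2 / 2) * (cmod (inv_ft f y))\<^sup>2"
      by (intro tendsto_intros LIMSEQ_inverse_real_of_nat) simp
    then show ?thesis unfolding G_def gauss_def by (intro tendsto_ennrealI) simp
  qed
  have "(\<integral>\<^sup>+y. ennreal ((cmod (inv_ft f y))\<^sup>2) \<partial>lborel) = (\<integral>\<^sup>+y. liminf (\<lambda>n. G n y) \<partial>lborel)"
    using lim_imp_Liminf[OF _ lim] by simp
  also have "\<dots> \<le> liminf (\<lambda>n. \<integral>\<^sup>+y. G n y \<partial>lborel)" by (rule nn_integral_liminf) simp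
  also have "\<dots> \<le> liminf (\<lambda>n. ennreal B)"
    by (intro Liminf_mono always_eventually allI) (auto simp: G_def intro!: bound)
  also have "\<dots> = ennreal B" by (simp add: Liminf_const)
  finally have "(\<integral>\<^sup>+y. ennreal ((cmod (inv_ft f y))\<^sup>2) \<partial>lborel) \<le> ennreal B" .
  then show ?thesis by (intro integrableI_bounded) (auto simp: order_le_less_trans)
qed

text \<open>Nonnegativity of the weighted variance of \<open>v\<close> about its weighted mean
  \<open>m\<close>.\<close>

lemma weighted_Cauchy_Schwarz:
  fixes \<phi> v :: "'b \<Rightarrow> real"
  assumes "integrable M \<phi>" "integrable M (\<lambda>x. \<phi> x * v x)" "integrable M (\<lambda>x. \<phi> x * (v x)\<^sup>2)"
    "\<And>x. 0 \<le> \<phi> x" "0 < (\<integral>x. \<phi> x \<partial>M)"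
  shows "(\<integral>x. \<phi> x * v x \<partial>M)\<^sup>2 \<le> (\<integral>x. \<phi> x \<partial>M) * (\<integral>x. \<phi> x * (v x)\<^sup>2 \<partial>M)"
proof -
  let ?P = "\<integral>x. \<phi> x \<partial>M" and ?V = "\<integral>x. \<phi> x * v x \<partial>M"
  define m where "m = ?V / ?P"
  have "0 \<le> (\<integral>x. \<phi> x * (v x - m)\<^sup>2 \<partial>M)" by (rule Bochner_Integration.integral_nonneg) (simp add: assms(4))
  also have "\<dots> = (\<integral>x. \<phi> x * (v x)\<^sup>2 - 2 * m * (\<phi> x * v x) + m\<^sup>2 * \<phi> x \<partial>M)"
    by (simp add: power2_eq_square algebra_simps)
  also have "\<dots> = (\<integral>x. \<phi> x * (v x)\<^sup>2 \<partial>M) - 2 * m * ?V + m\<^sup>2 * ?P"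
    using assms by simp
  also have "\<dots> = (\<integral>x. \<phi> x * (v x)\<^sup>2 \<partial>M) - ?V\<^sup>2 / ?P" 
    using assms(5) by (simp add: m_def power2_eq_square)
  finally show ?thesis using assms(5) by (simp add: field_simps)
qed

text \<open>Dividing \<open>f\<close> by the transform of a small bump \<open>\<phi>\<close> exhibits \<open>inv_ft f\<close> as an average
  of the transform of another function in \<open>Cc\<close>, which tames its oscillation on unit balls.\<close>

lemma inv_ft_local_average:
  fixes f :: "'a::euclidean_space \<Rightarrow> complex"
  assumes f: "f \<in> Cc"
  obtains H where "continuous_on UNIV H" "\<And>s. 0 \<le> H s" "integrable lborel H"
    "\<And>z. ennreal ((cmod (inv_ft f z))\<^sup>2) \<le> (\<integral>\<^sup>+s. ennreal (H s) * indicator (cball z 1) s \<partial>lborel)"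
proof -
  let ?S = "closure {x. f x \<noteq> 0}"
  obtain \<phi> where \<phi>: "\<phi> \<in> Ccp" "\<And>x. \<phi> x \<le> 1" "\<And>x. 1 < norm x \<Longrightarrow> \<phi> x = 0" "0 < (\<integral>x. \<phi> x \<partial>lborel)"
    "\<And>y. y \<in> ?S \<Longrightarrow> inv_ft (\<lambda>x. complex_of_real (\<phi> x)) y \<noteq> 0"
    using inv_ft_bump[OF Cc_closure_nonzero[OF f]] by metis
  define \<eta> where "\<eta> = inv_ft (\<lambda>x. complex_of_real (\<phi> x))"
  note \<phi>C = Ccp_of_real[OF \<phi>(1)]
  define f1 where "f1 = (\<lambda>x. f x / \<eta> x)"
  have f1: "f1 \<in> Cc" unfolding f1_def \<eta>_def
    by (rule Cc_divide[OF f inv_ft_continuous[OF Cc_integrable[OF \<phi>C]] \<phi>(5)])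
  have cf1: "continuous_on UNIV (inv_ft f1)" by (rule inv_ft_continuous[OF Cc_integrable[OF f1]])
  define P where "P = (\<integral>x. \<phi> x \<partial>lborel)"
  \<comment> \<open>The mass \<open>P\<close> is the factor lost in the weighted Cauchy-Schwarz
    inequality below.\<close>
  define H where "H = (\<lambda>s. P * (cmod (inv_ft f1 s))\<^sup>2)"
  have cH: "continuous_on UNIV H" unfolding H_def by (intro continuous_intros cf1)
  have [measurable]: "H \<in> borel_measurable borel" by (rule borel_measurable_continuous_onI[OF cH])
  have H0: "0 \<le> H s" for s using \<phi>(4) by (simp add: H_def P_def)
  have iH: "integrable lborel H" unfolding H_def by (intro integrable_mult_right inv_ft_square_integrable f1)
  have f_eq: "f x = f1 x * \<eta> x" for x
    using \<phi>(5)[of x] closure_subset[of "{x. f x \<noteq> 0}"] by (auto simp: f1_def \<eta>_def)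
  \<comment> \<open>The factor \<open>\<eta>\<close> of \<open>f\<close> is a superposition of
    characters with weights \<open>\<phi> s\<close>, and multiplying \<open>f1\<close> by a
    character shifts its transform by \<open>s\<close>.\<close>
  have avg: "inv_ft f z = (\<integral>s. complex_of_real (\<phi> s) * inv_ft f1 (s + z) \<partial>lborel)" for z
  proof -
    have "(\<integral>s. complex_of_real (\<phi> s) * wave x (s + z) \<partial>lborel) = (\<integral>s. (complex_of_real (\<phi> s) * wave s x) * wave x z \<partial>lborel)" for x
      by (simp add: wave_commute[of x] wave_add_left mult.assoc)
    also have "\<dots> x = \<eta> x * wave x z" for x
      by (simp add: \<eta>_def inv_ft_wave)
    finally have "inv_ft f z = (\<integral>x. f1 x * (\<integral>s. complex_of_real (\<phi> s) * wave x (s + z) \<partial>lborel) \<partial>lborel)"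
      by (simp add: inv_ft_wave[of f] f_eq mult.assoc)
    also have "\<dots> = (\<integral>s. complex_of_real (\<phi> s) * (\<integral>x. f1 x * wave x (s + z) \<partial>lborel) \<partial>lborel)"
      by (rule Fubini_kernel[OF sigma_finite_lborel sigma_finite_lborel Cc_integrable[OF f1] Cc_integrable[OF \<phi>C], where B = 1])
         auto
    finally show ?thesis by (simp add: inv_ft_wave)
  qed
  have "ennreal ((cmod (inv_ft f z))\<^sup>2) \<le> (\<integral>\<^sup>+s. ennreal (H s) * indicator (cball z 1) s \<partial>lborel)" for z
  proof -
    define v where "v = (\<lambda>s. cmod (inv_ft f1 (s + z)))"
    have cv: "continuous_on UNIV v" unfolding v_def
      by (intro continuous_intros continuous_on_compose2[OF cf1]) auto
    have intC: "integrable lborel (\<lambda>s. \<phi> s * w s)" if "continuous_on UNIV w" for w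
      using integrable_Re[OF Cc_integrable[OF Cc_mult[OF \<phi>C, of "\<lambda>s. complex_of_real (w s)"]]] that
      by (simp add: continuous_on_of_real)
    have i1: "integrable lborel \<phi>" using intC[of "\<lambda>_. 1"] by simp
    have i2: "integrable lborel (\<lambda>s. \<phi> s * v s)" by (rule intC[OF cv])
    have i3: "integrable lborel (\<lambda>s. \<phi> s * (v s)\<^sup>2)" by (rule intC) (intro continuous_intros cv)
    have "cmod (inv_ft f z) \<le> (\<integral>s. \<phi> s * v s \<partial>lborel)"
      unfolding avg using integral_norm_bound[of lborel "\<lambda>s. complex_of_real (\<phi> s) * inv_ft f1 (s + z)"] 
      by (simp add: norm_mult v_def CcpD(2)[OF \<phi>(1)])
    then have "(cmod (inv_ft f z))\<^sup>2 \<le> (\<integral>s. \<phi> s * v s \<partial>lborel)\<^sup>2" by (rule power_mono) simp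
    also have "\<dots> \<le> P * (\<integral>s. \<phi> s * (v s)\<^sup>2 \<partial>lborel)" unfolding P_def
      by (rule weighted_Cauchy_Schwarz[OF i1 i2 i3 CcpD(2)[OF \<phi>(1)] \<phi>(4)])
    also have "\<dots> = (\<integral>s. \<phi> s * H (s + z) \<partial>lborel)" by (simp add: H_def v_def mult.left_commute)
    finally have "ennreal ((cmod (inv_ft f z))\<^sup>2) \<le> ennreal (\<integral>s. \<phi> s * H (s + z) \<partial>lborel)" by (rule ennreal_leI)
    also have "\<dots> = (\<integral>\<^sup>+s. ennreal (\<phi> s * H (s + z)) \<partial>lborel)"
    proof (rule nn_integral_eq_integral[symmetric])
      show "integrable lborel (\<lambda>s. \<phi> s * H (s + z))" by (rule intC) (intro continuous_on_compose2[OF cH] continuous_intros; simp)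
    qed (simp add: H0 CcpD(2)[OF \<phi>(1)])
    also have "\<dots> \<le> (\<integral>\<^sup>+s. ennreal (H (z + s)) * indicator (cball z 1) (z + s) \<partial>lborel)"
    proof (rule nn_integral_mono)
      fix s
      show "ennreal (\<phi> s * H (s + z)) \<le> ennreal (H (z + s)) * indicator (cball z 1) (z + s)"
      proof (cases "norm s \<le> 1")
        case True
        then have "z + s \<in> cball z 1" by (simp add: dist_norm)
        moreover have "\<phi> s * H (s + z) \<le> H (z + s)"
          using mult_right_mono[OF \<phi>(2)[of s] H0[of "s + z"]] by (simp add: add.commute)
        ultimately show ?thesis by (simp add: ennreal_leI)
      qed (simp add: \<phi>(3))
    qed
    also have "\<dots> = (\<integral>\<^sup>+s. ennreal (H s) * indicator (cball z 1) s \<partial>lborel)"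
    proof -
      have [measurable]: "cball z 1 \<in> sets borel" by simp
      have "(\<lambda>s. ennreal (H s) * indicator (cball z 1) s) \<in> borel_measurable borel" by measurable
      then show ?thesis by (subst (2) lborel_distr_plus[of z, symmetric], subst nn_integral_distr) auto
    qed
    finally show ?thesis .
  qed
  then show ?thesis using that[OF cH H0 iH] by blast
qed

text \<open>The measure \<open>M\<close> is quantified inside, so \<open>\<tau>\<close> depends on
  \<open>f\<close> alone: one sequence serves all the \<open>M n\<close> and also the measure
  representing the limit.\<close>

definition energy_tail :: "('a::euclidean_space \<Rightarrow> complex) \<Rightarrow> (nat \<Rightarrow> real) \<Rightarrow> bool" where
  "energy_tail f \<tau> \<longleftrightarrow> (\<forall>n. 0 \<le> \<tau> n) \<and>
    (\<forall>M B n. sigma_finite_measure M \<longrightarrow> sets M = sets borel \<longrightarrow> 0 \<le> B \<longrightarrow> (\<forall>s. emeasure M (cball s 1) \<le> ennreal B) \<longrightarrow>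
      (\<integral>\<^sup>+z. ennreal ((cmod (inv_ft f z))\<^sup>2) * indicator {z. real n \<le> norm z} z \<partial>M) \<le> ennreal (B * \<tau> n))"

text \<open>Bound the energy by its local average and exchange the integrals: each \<open>s\<close>
  then carries \<open>H s\<close> times the \<open>M\<close>-mass of the unit ball about
  \<open>s\<close>. What remains is \<open>B\<close> times a Lebesgue tail of the integrable
  \<open>H\<close>.\<close>

lemma energy_tail_exists:
  fixes f :: "'a::euclidean_space \<Rightarrow> complex"
  assumes f: "f \<in> Cc"
  obtains \<tau> where "\<tau> \<longlonglongrightarrow> 0" "energy_tail f \<tau>"
proof -
  obtain H where H: "continuous_on UNIV H" "\<And>s. 0 \<le> H s" "integrable lborel H"
    "\<And>z. ennreal ((cmod (inv_ft f z))\<^sup>2) \<le> (\<integral>\<^sup>+s. ennreal (H s) * indicator (cball z 1) s \<partial>lborel)"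
    using inv_ft_local_average[OF f] by metis
  have Hm[measurable]: "H \<in> borel_measurable borel" by (rule borel_measurable_continuous_onI[OF H(1)])
  \<comment> \<open>The radius is \<open>n - 1\<close> because \<open>s\<close> lies within distance
    1 of some \<open>z\<close> of norm at least \<open>n\<close>.\<close>
  define T where "T = (\<lambda>n::nat. {s::'a. real n - 1 \<le> norm s})"
  have [measurable]: "T n \<in> sets borel" for n unfolding T_def by measurable
  have [measurable]: "{s::'a. real n \<le> norm s} \<in> sets borel" for n by measurable
  define \<tau> where "\<tau> = (\<lambda>n. \<integral>s. indicator (T n) s * H s \<partial>lborel)"
  have int: "integrable lborel (\<lambda>s. indicator (T n) s * H s)" for n
    by (rule Bochner_Integration.integrable_bound[OF H(3)]) (auto simp: indicator_def)
  have "\<tau> \<longlonglongrightarrow> integral\<^sup>L lborel (\<lambda>s::'a. 0)" unfolding \<tau>_def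
  proof (rule integral_dominated_convergence[OF _ _ H(3)])
    show "AE s in lborel. (\<lambda>n. indicator (T n) s * H s) \<longlonglongrightarrow> 0"
    proof (rule AE_I2)
      fix s :: 'a
      obtain N :: nat where N: "norm s + 1 < real N" using reals_Archimedean2 by blast
      have "\<forall>\<^sub>F n in sequentially. indicator (T n) s * H s = 0"
        using eventually_ge_at_top[of N]
      proof eventually_elim
        case (elim n)
        then have "real N \<le> real n" by simp
        then show ?case using N by (auto simp: T_def)
      qed
      then show "(\<lambda>n. indicator (T n) s * H s) \<longlonglongrightarrow> 0" by (rule tendsto_eventually)
    qed
    show "AE s in lborel. norm (indicator (T n) s * H s) \<le> H s" for n
      by (auto simp: indicator_def H(2))
  qed auto
  then have lim: "\<tau> \<longlonglongrightarrow> 0" by simp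
  have nn: "0 \<le> \<tau> n" for n unfolding \<tau>_def by (rule Bochner_Integration.integral_nonneg) (simp add: H(2))
  have "(\<integral>\<^sup>+z. ennreal ((cmod (inv_ft f z))\<^sup>2) * indicator {z. real n \<le> norm z} z \<partial>M) \<le> ennreal (B * \<tau> n)"
    if M: "sigma_finite_measure M" "sets M = sets borel" "0 \<le> B" "\<And>s. emeasure M (cball s 1) \<le> ennreal B" for M B n
  proof -
    interpret M: sigma_finite_measure M by fact
    interpret P: pair_sigma_finite M "lborel :: 'a measure" ..
    note [measurable_cong] = M(2)
    let ?g = "\<lambda>z s. ennreal (H s) * indicator (cball z 1) s * indicator {z. real n \<le> norm z} z"
    have "{p. dist (fst p) (snd p) \<le> 1} \<in> sets (borel :: ('a \<times> 'a) measure)" 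
      by (intro borel_closed closed_Collect_le continuous_intros)
    then have "{p. dist (fst p) (snd p) \<le> 1} \<in> sets (M \<Otimes>\<^sub>M (lborel :: 'a measure))"
      by (simp add: borel_prod[symmetric] M(2) cong: sets_pair_measure_cong)
    then have "(\<lambda>p. indicator {p. dist (fst p) (snd p) \<le> 1} p :: ennreal) \<in> borel_measurable (M \<Otimes>\<^sub>M lborel)" 
      by (rule borel_measurable_indicator)
    then have "(\<lambda>p. indicator (cball (fst p) 1) (snd p) :: ennreal) \<in> borel_measurable (M \<Otimes>\<^sub>M lborel)"
      by (rule measurable_cong[THEN iffD1, rotated]) (auto simp: indicator_def)
    then have [measurable]: "(\<lambda>p. ?g (fst p) (snd p)) \<in> borel_measurable (M \<Otimes>\<^sub>M lborel)"
      by measurable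
    have "(\<integral>\<^sup>+z. ennreal ((cmod (inv_ft f z))\<^sup>2) * indicator {z. real n \<le> norm z} z \<partial>M) \<le> (\<integral>\<^sup>+z. \<integral>\<^sup>+s. ?g z s \<partial>lborel \<partial>M)"
    proof (rule nn_integral_mono)
      fix z
      show "ennreal ((cmod (inv_ft f z))\<^sup>2) * indicator {z. real n \<le> norm z} z \<le> (\<integral>\<^sup>+s. ?g z s \<partial>lborel)"
        using H(4)[of z] by (cases "real n \<le> norm z") (auto simp: indicator_def)
    qed
    also have "\<dots> = (\<integral>\<^sup>+s. \<integral>\<^sup>+z. ?g z s \<partial>M \<partial>lborel)"
      by (rule P.Fubini'[symmetric]) (simp add: split_beta')
    also have "\<dots> \<le> (\<integral>\<^sup>+s. ennreal B * ennreal (indicator (T n) s * H s) \<partial>lborel)"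
    proof (rule nn_integral_mono)
      fix s :: 'a
      have "(\<integral>\<^sup>+z. ?g z s \<partial>M) \<le> (\<integral>\<^sup>+z. ennreal (indicator (T n) s * H s) * indicator (cball s 1) z \<partial>M)"
      proof (rule nn_integral_mono)
        fix z
        have "s \<in> T n" if "dist z s \<le> 1" "real n \<le> norm z"
          using that norm_triangle_ineq2[of z s] by (simp add: T_def dist_norm)
        then show "?g z s \<le> ennreal (indicator (T n) s * H s) * indicator (cball s 1) z"
          by (auto simp: indicator_def dist_commute)
      qed
      also have "\<dots> = ennreal (indicator (T n) s * H s) * emeasure M (cball s 1)"
        by (rule nn_integral_cmult_indicator) (simp add: M(2))
      also have "\<dots> \<le> ennreal (indicator (T n) s * H s) * ennreal B" by (rule mult_left_mono[OF M(4)]) simp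
      finally show "(\<integral>\<^sup>+z. ?g z s \<partial>M) \<le> ennreal B * ennreal (indicator (T n) s * H s)" by (simp add: mult.commute)
    qed
    also have "\<dots> = ennreal B * (\<integral>\<^sup>+s. ennreal (indicator (T n) s * H s) \<partial>lborel)"
      by (rule nn_integral_cmult) measurable
    also have "(\<integral>\<^sup>+s. ennreal (indicator (T n) s * H s) \<partial>lborel) = ennreal (\<tau> n)"
      unfolding \<tau>_def by (rule nn_integral_eq_integral[OF int]) (simp add: H(2))
    finally show ?thesis using M(3) nn[of n] by (simp add: ennreal_mult)
  qed
  then have "energy_tail f \<tau>" unfolding energy_tail_def using nn by blast
  then show ?thesis by (rule that[OF lim])
qed

section \<open>Uniform approximation by Gaussian convolutions\<close>

lemma Cc_uniformly_continuous:
  fixes u :: "'a::euclidean_space \<Rightarrow> complex"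
  assumes u: "u \<in> Cc" and e: "0 < e"
  obtains d where "0 < d" "\<And>y s. norm s < d \<Longrightarrow> cmod (u (y - s) - u y) < e"
proof -
  obtain R where R: "\<And>x. u x \<noteq> 0 \<Longrightarrow> norm x \<le> R" using u unfolding Cc_iff bounded_iff by auto
  let ?K = "cball (0::'a) (R + 1)"
  have "uniformly_continuous_on ?K u"
    by (intro compact_uniformly_continuous continuous_on_subset[OF Cc_continuous[OF u]]) auto
  then obtain d where d: "0 < d" "\<And>x y. x \<in> ?K \<Longrightarrow> y \<in> ?K \<Longrightarrow> dist y x < d \<Longrightarrow> dist (u y) (u x) < e"
    using e unfolding uniformly_continuous_on_def by metis
  show ?thesis
  proof
    show "0 < min d 1" using d by simp
    fix y s :: 'a assume s: "norm s < min d 1"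
    show "cmod (u (y - s) - u y) < e"
    proof (cases "y \<in> ?K \<and> y - s \<in> ?K")
      case True
      then show ?thesis using d(2)[of y "y - s"] s by (simp add: dist_norm)
    next
      case False
      then have "R < norm y" "R < norm (y - s)"
        using s norm_triangle_ineq2[of y s] norm_triangle_ineq4[of y s] norm_triangle_ineq[of "y - s" s] by auto
      then have "u y = 0" "u (y - s) = 0" using R by (meson not_less)+
      then show ?thesis using e by simp
    qed
  qed
qed

text \<open>Half of the Gaussian exponent is spent on decay through
  \<open>exp (- x) \<le> 1 / x\<close>. The other half is again a kernel of mass 1, with parameter
  \<open>sqrt 2 * a\<close>; the power of \<open>sqrt 2\<close> corrects the normalisation.\<close>

lemma heat_tail:
  fixes s :: "'a::euclidean_space"
  assumes a: "0 < a" and d: "0 < d" "d \<le> norm s"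
  shows "heat a s \<le> sqrt 2 ^ DIM('a) * (a\<^sup>2 / (pi * d)\<^sup>2) * heat (sqrt 2 * a) s"
proof -
  let ?x = "(pi * norm s / a)\<^sup>2"
  have x: "(pi * d / a)\<^sup>2 \<le> ?x" using a d by (intro power_mono divide_right_mono mult_left_mono) auto
  have "0 < (pi * d / a)\<^sup>2" using a d by simp
  then have x0: "0 < ?x" using x by linarith
  have g1: "gauss (2 * pi / a) s = exp (- ?x) * exp (- ?x)"
    unfolding gauss_def exp_add[symmetric] by (simp add: power_mult_distrib power_divide)
  have g2: "gauss (2 * pi / (sqrt 2 * a)) s = exp (- ?x)"
    unfolding gauss_def by (simp add: power_mult_distrib power_divide)
  have "exp (- ?x) \<le> 1 / ?x" 
  proof -
    have "?x \<le> exp ?x" using exp_ge_add_one_self[of ?x] by linarith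
    then show ?thesis using x0 unfolding exp_minus inverse_eq_divide by (intro divide_left_mono mult_pos_pos) auto
  qed
  also have "\<dots> \<le> 1 / (pi * d / a)\<^sup>2" 
    by (intro divide_left_mono x mult_pos_pos x0 \<open>0 < (pi * d / a)\<^sup>2\<close>) simp
  also have "\<dots> = a\<^sup>2 / (pi * d)\<^sup>2" by (simp add: power_divide)
  finally have e: "exp (- ?x) \<le> a\<^sup>2 / (pi * d)\<^sup>2" .
  have c: "(sqrt (2 * pi) / a) ^ DIM('a) = sqrt 2 ^ DIM('a) * (sqrt (2 * pi) / (sqrt 2 * a)) ^ DIM('a)"
    by (subst power_mult_distrib[symmetric]) simp
  have "heat a s = sqrt 2 ^ DIM('a) * (exp (- ?x) * heat (sqrt 2 * a) s)"
    unfolding heat_def g1 g2 c by (simp only: mult_ac)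
  also have "\<dots> \<le> sqrt 2 ^ DIM('a) * ((a\<^sup>2 / (pi * d)\<^sup>2) * heat (sqrt 2 * a) s)"
    by (intro mult_left_mono mult_right_mono e heat_nonneg) (use a in auto)
  finally show ?thesis by (simp only: mult.assoc)
qed

text \<open>Uniform in \<open>y\<close>: shifts with \<open>norm s < d\<close> are controlled by
  uniform continuity, the others by \<open>heat_tail\<close>.\<close>

lemma heat_convolution_approx:
  fixes u :: "'a::euclidean_space \<Rightarrow> complex"
  assumes u: "u \<in> Cc" and e: "0 < e"
  obtains a where "0 < a" "\<And>y. cmod ((\<integral>t. u t * complex_of_real (heat a (y - t)) \<partial>lborel) - u y) \<le> e"
proof -
  obtain B where B: "B > 0" "\<And>x. cmod (u x) \<le> B" using Cc_bounded[OF u] by metis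
  obtain d where d: "0 < d" "\<And>y s. norm s < d \<Longrightarrow> cmod (u (y - s) - u y) < e / 2"
    using Cc_uniformly_continuous[OF u, of "e/2"] e by auto
  \<comment> \<open>\<open>C\<close> combines the bound \<open>2 * B\<close> on a difference of
    values of \<open>u\<close> with the constants of \<open>heat_tail\<close>; \<open>a\<close> is
    chosen so that the far part costs \<open>C * a\<^sup>2 = e / 2\<close>.\<close>
  define C where "C = 2 * B * sqrt 2 ^ DIM('a) / (pi * d)\<^sup>2"
  have C: "0 < C" using B d by (simp add: C_def)
  define a where "a = sqrt (e / (2 * C))"
  have a: "0 < a" "C * a\<^sup>2 = e / 2" using C e by (simp_all add: a_def)
  have a2: "0 < sqrt 2 * a" using a by simp
  note [measurable] = Cc_measurable[OF u] borel_measurable_integrable[OF integrable_heat[OF a(1)]]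
  have "cmod ((\<integral>t. u t * complex_of_real (heat a (y - t)) \<partial>lborel) - u y) \<le> e" for y
  proof -
    have i1: "integrable lborel (\<lambda>s. u (y - s) * complex_of_real (heat a s))"
    proof (rule Bochner_Integration.integrable_bound)
      show "integrable lborel (\<lambda>s::'a. B * heat a s)" by (intro integrable_mult_right integrable_heat a)
      show "AE s in lborel. norm (u (y - s) * complex_of_real (heat a s)) \<le> norm (B * heat a s)"
        using B by (auto simp: norm_mult abs_mult heat_nonneg[OF a(1)] intro!: mult_right_mono)
    qed measurable
    have i2: "integrable lborel (\<lambda>s. u y * complex_of_real (heat a s))"
      by (intro integrable_mult_right integrable_of_real integrable_heat a)
    have "(\<integral>t. u t * complex_of_real (heat a (y - t)) \<partial>lborel) = (\<integral>s. u (y - s) * complex_of_real (heat a s) \<partial>lborel)"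
      using lborel_integral_reflect[of "\<lambda>t. u t * complex_of_real (heat a (y - t))" y] by simp
    moreover have "u y = (\<integral>s. u y * complex_of_real (heat a s) \<partial>lborel)"
      by (subst integral_mult_right_zero, subst integral_complex_of_real, subst integral_heat[OF a(1)]) simp
    ultimately have "(\<integral>t. u t * complex_of_real (heat a (y - t)) \<partial>lborel) - u y = 
        (\<integral>s. u (y - s) * complex_of_real (heat a s) - u y * complex_of_real (heat a s) \<partial>lborel)"
      using Bochner_Integration.integral_diff[OF i1 i2] by simp
    also have "cmod \<dots> \<le> (\<integral>s. cmod (u (y - s) * complex_of_real (heat a s) - u y * complex_of_real (heat a s)) \<partial>lborel)"
      by (rule integral_norm_bound)
    also have "\<dots> \<le> (\<integral>s. e / 2 * heat a s + C * a\<^sup>2 * heat (sqrt 2 * a) (s::'a) \<partial>lborel)"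
    proof (rule Bochner_Integration.integral_mono)
      show "integrable lborel (\<lambda>s. cmod (u (y - s) * complex_of_real (heat a s) - u y * complex_of_real (heat a s)))"
        using i1 i2 by (intro integrable_norm Bochner_Integration.integrable_diff)
      show "integrable lborel (\<lambda>s::'a. e / 2 * heat a s + C * a\<^sup>2 * heat (sqrt 2 * a) s)"
        by (intro Bochner_Integration.integrable_add integrable_mult_right integrable_heat a a2)
      fix s :: 'a
      have eq: "cmod (u (y - s) * complex_of_real (heat a s) - u y * complex_of_real (heat a s)) = cmod (u (y - s) - u y) * heat a s"
        unfolding left_diff_distrib[symmetric] by (simp add: norm_mult heat_nonneg[OF a(1)])
      show "cmod (u (y - s) * complex_of_real (heat a s) - u y * complex_of_real (heat a s)) \<le> e / 2 * heat a s + C * a\<^sup>2 * heat (sqrt 2 * a) s"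
      proof (cases "norm s < d")
        case True
        have "cmod (u (y - s) - u y) * heat a s \<le> e / 2 * heat a s"
          by (intro mult_right_mono heat_nonneg a less_imp_le d(2) True)
        moreover have "0 \<le> C * a\<^sup>2 * heat (sqrt 2 * a) s" using C heat_nonneg[OF a2, of s] by (intro mult_nonneg_nonneg) auto
        ultimately show ?thesis unfolding eq by linarith
      next
        case False
        have "cmod (u (y - s) - u y) \<le> 2 * B" 
          using norm_triangle_ineq4[of "u (y - s)" "u y"] B(2)[of "y - s"] B(2)[of y] by linarith
        then have "cmod (u (y - s) - u y) * heat a s \<le> 2 * B * heat a s" by (intro mult_right_mono heat_nonneg a)
        also have "\<dots> \<le> 2 * B * (sqrt 2 ^ DIM('a) * (a\<^sup>2 / (pi * d)\<^sup>2) * heat (sqrt 2 * a) s)"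
          using B False by (intro mult_left_mono heat_tail a d) auto
        also have "\<dots> = C * a\<^sup>2 * heat (sqrt 2 * a) s" by (simp add: C_def)
        moreover have "0 \<le> e / 2 * heat a s" using e heat_nonneg[OF a(1), of s] by simp
        ultimately show ?thesis unfolding eq by linarith
      qed
    qed
    also have "\<dots> = e / 2 * (\<integral>s. heat a (s::'a) \<partial>lborel) + C * a\<^sup>2 * (\<integral>s. heat (sqrt 2 * a) (s::'a) \<partial>lborel)"
      by (subst Bochner_Integration.integral_add) (auto intro!: integrable_mult_right integrable_heat a a2)
    also have "\<dots> = e" using a by (simp add: integral_heat)
    finally show ?thesis .
  qed
  then show ?thesis using that[OF a(1)] by blast
qed

text \<open>Gaussian-damped Fourier inversion: \<open>w\<close> is \<open>gauss a\<close> times the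
  forward transform \<open>inv_ft u (- x)\<close>, hence integrable, and by Fubini
  \<open>inv_ft w\<close> is the convolution of \<open>u\<close> with \<open>heat a\<close>.\<close>

lemma inv_ft_uniformly_dense:
  fixes u :: "'a::euclidean_space \<Rightarrow> complex"
  assumes u: "u \<in> Cc" and e: "0 < e"
  obtains w where "integrable lborel w" "\<And>y. cmod (inv_ft w y - u y) \<le> e"
proof -
  obtain a where a: "0 < a" "\<And>y. cmod ((\<integral>t. u t * complex_of_real (heat a (y - t)) \<partial>lborel) - u y) \<le> e"
    using heat_convolution_approx[OF u e] by metis
  define w where "w = (\<lambda>x. complex_of_real (gauss a x) * inv_ft u (- x))"
  note [measurable] = inv_ft_measurable[OF Cc_integrable[OF u]] borel_measurable_continuous_onI[OF continuous_gauss]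
  have "integrable lborel w"
  proof (rule Bochner_Integration.integrable_bound)
    let ?C = "\<integral>x. cmod (u x) \<partial>lborel"
    show "integrable lborel (\<lambda>x::'a. ?C * gauss a x)" by (intro integrable_mult_right integrable_gauss_real a)
    have C0: "0 \<le> ?C" by (rule Bochner_Integration.integral_nonneg) simp
    show "AE x in lborel. norm (w x) \<le> norm (?C * gauss a x)"
      using norm_inv_ft_le[OF Cc_integrable[OF u]]
      by (auto simp: w_def norm_mult abs_mult C0 mult.commute intro!: mult_left_mono)
  qed (simp add: w_def)
  moreover have "inv_ft w y = (\<integral>t. u t * complex_of_real (heat a (y - t)) \<partial>lborel)" for y
  proof -
    have h: "complex_of_real (heat a (y - t)) = (\<integral>x. complex_of_real (gauss a x) * wave x (y - t) \<partial>lborel)" for t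
      unfolding heat_def inv_ft_gauss[OF a(1), symmetric] inv_ft_wave ..
    have inner: "(\<integral>t. u t * wave x (y - t) \<partial>lborel) = inv_ft u (- x) * wave x y" for x
    proof -
      have eq: "u t * wave x (y - t) = (u t * wave t (- x)) * wave x y" for t
      proof -
        have "wave x (y - t) = wave y x * cnj (wave t x)" by (subst wave_commute) (rule wave_diff_left)
        moreover have "wave t (- x) = cnj (wave t x)" by (simp add: wave_def exp_cnj)
        ultimately show ?thesis by (simp add: wave_commute[of y])
      qed
      show ?thesis by (simp only: inv_ft_wave eq integral_mult_left_zero)
    qed
    have "(\<integral>t. u t * complex_of_real (heat a (y - t)) \<partial>lborel) = 
      (\<integral>x. complex_of_real (gauss a x) * (\<integral>t. u t * wave x (y - t) \<partial>lborel) \<partial>lborel)"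
      unfolding h by (rule Fubini_kernel[OF sigma_finite_lborel sigma_finite_lborel Cc_integrable[OF u] integrable_gauss[OF a(1)], where B = 1])
         auto
    then show ?thesis unfolding inner inv_ft_wave[of w] by (simp add: w_def mult.assoc)
  qed
  ultimately show ?thesis using that a(2) by metis
qed

section \<open>Convergence of the transforms\<close>

lemma radon_repD:
  assumes "radon_rep \<nu> M h"
  shows "sets M = sets borel" "sigma_finite_measure M" "h \<in> borel_measurable M" "AE x in M. cmod (h x) = 1"
    "\<And>g. g \<in> Cc \<Longrightarrow> \<nu> g = (\<integral>x. g x * h x \<partial>M)" "\<And>g. g \<in> Cc \<Longrightarrow> integrable M (\<lambda>x. g x * h x)"
  using assms unfolding radon_rep_def by (auto intro: sigma_finite_locally_finite)

lemma integrable_mult_unimodular: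
  fixes F :: "'b \<Rightarrow> complex"
  assumes "integrable M F" "h \<in> borel_measurable M" "AE x in M. cmod (h x) = 1"
  shows "integrable M (\<lambda>x. F x * h x)" "cmod (\<integral>x. F x * h x \<partial>M) \<le> (\<integral>x. cmod (F x) \<partial>M)"
proof -
  show i: "integrable M (\<lambda>x. F x * h x)"
    by (rule Bochner_Integration.integrable_bound[OF assms(1)]) (use assms in \<open>auto simp: norm_mult\<close>)
  have "cmod (\<integral>x. F x * h x \<partial>M) \<le> (\<integral>x. cmod (F x * h x) \<partial>M)" by (rule integral_norm_bound)
  also have "\<dots> = (\<integral>x. cmod (F x) \<partial>M)"
    by (rule integral_cong_AE) (use assms in \<open>auto simp: norm_mult\<close>)
  finally show "cmod (\<integral>x. F x * h x \<partial>M) \<le> (\<integral>x. cmod (F x) \<partial>M)" .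
qed

definition cutoff :: "nat \<Rightarrow> 'a::euclidean_space \<Rightarrow> complex" where
  "cutoff n x = complex_of_real (max 0 (min 1 (real n + 1 - norm x)))"

lemma cutoff_Cc: "cutoff n \<in> Cc"
  unfolding Cc_iff
proof
  show "continuous_on UNIV (cutoff n)" unfolding cutoff_def by (intro continuous_intros)
  show "bounded {x. cutoff n x \<noteq> 0}"
    by (rule boundedI[where B = "real n + 1"]) (auto simp: cutoff_def max_def min_def split: if_splits)
qed

lemma cutoff_eq_1: "norm x \<le> real n \<Longrightarrow> cutoff n x = 1"
  by (simp add: cutoff_def)

lemma norm_cutoff_le: "cmod (cutoff n x) \<le> 1" "cmod (1 - cutoff n x) \<le> 1"
proof -
  let ?r = "max 0 (min 1 (real n + 1 - norm x))"
  have "1 - cutoff n x = complex_of_real (1 - ?r)" by (simp add: cutoff_def)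
  then show "cmod (1 - cutoff n x) \<le> 1" by (simp only: norm_of_real)
  show "cmod (cutoff n x) \<le> 1" unfolding cutoff_def norm_of_real by simp
qed

lemma cutoff_mult_Cc: "continuous_on UNIV F \<Longrightarrow> (\<lambda>x. F x * cutoff n x) \<in> Cc"
  using Cc_mult[OF cutoff_Cc, of F n] by (simp add: mult.commute)

lemma radon_rep_cutoff_limit:
  fixes F :: "'a::euclidean_space \<Rightarrow> complex"
  assumes rep: "radon_rep \<nu> M h" and F: "continuous_on UNIV F" "integrable M F"
  shows "(\<lambda>n. \<nu> (\<lambda>x. F x * cutoff n x)) \<longlonglongrightarrow> (\<integral>x. F x * h x \<partial>M)"
proof -
  note rep' = radon_repD[OF rep]
  have Fh: "integrable M (\<lambda>x. F x * h x)" by (rule integrable_mult_unimodular(1)[OF F(2) rep'(3,4)])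
  have "(\<lambda>n. \<integral>x. (F x * cutoff n x) * h x \<partial>M) \<longlonglongrightarrow> (\<integral>x. F x * h x \<partial>M)"
  proof (rule integral_dominated_convergence[OF _ _ integrable_norm[OF Fh]])
    show "(\<lambda>x. F x * h x) \<in> borel_measurable M" using Fh by simp
    show "(\<lambda>x. (F x * cutoff n x) * h x) \<in> borel_measurable M" for n
      using rep'(6)[OF cutoff_mult_Cc[OF F(1)]] by simp
    show "AE x in M. (\<lambda>n. (F x * cutoff n x) * h x) \<longlonglongrightarrow> F x * h x"
    proof (rule AE_I2)
      fix x :: 'a
      obtain N :: nat where N: "norm x < real N" using reals_Archimedean2 by blast
      have "\<forall>\<^sub>F n in sequentially. (F x * cutoff n x) * h x = F x * h x"
        using eventually_ge_at_top[of N]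
      proof eventually_elim
        case (elim n)
        then have "real N \<le> real n" by simp
        then show ?case using N by (simp add: cutoff_eq_1)
      qed
      then show "(\<lambda>n. (F x * cutoff n x) * h x) \<longlonglongrightarrow> F x * h x" by (rule tendsto_eventually)
    qed
    show "AE x in M. norm ((F x * cutoff n x) * h x) \<le> norm (F x * h x)" for n
    proof (rule AE_I2)
      fix x
      show "norm ((F x * cutoff n x) * h x) \<le> norm (F x * h x)"
        using mult_left_mono[OF norm_cutoff_le(1)[of n x], of "cmod (F x * h x)"] by (simp add: norm_mult mult_ac)
    qed
  qed
  then show ?thesis by (simp add: rep'(5)[OF cutoff_mult_Cc[OF F(1)]])
qed

text \<open>Both integrals are limits of the same values of \<open>\<nu>\<close> on cut-off
  functions. This permits exchanging the unspecified pair of \<open>is_fourier_transform\<close> for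
  one with known mass bounds.\<close>

lemma radon_rep_integral_unique:
  assumes "radon_rep \<nu> M h" "radon_rep \<nu> M' h'" "continuous_on UNIV F" "integrable M F" "integrable M' F"
  shows "(\<integral>x. F x * h x \<partial>M) = (\<integral>x. F x * h' x \<partial>M')"
  using radon_rep_cutoff_limit[OF assms(1,3,4)] radon_rep_cutoff_limit[OF assms(2,3,5)] LIMSEQ_unique by blast

lemma tv_mono: "A \<subseteq> B \<Longrightarrow> tv \<nu> A \<le> tv \<nu> B"
  unfolding tv_def by (rule INF_superset_mono) auto

lemma tv_le_tv_open: "open U \<Longrightarrow> A \<subseteq> U \<Longrightarrow> tv \<nu> A \<le> tv_open \<nu> U"
  unfolding tv_def by (rule INF_lower) auto

lemma tv_open_le_tv: "tv_open \<nu> U \<le> tv \<nu> A" if "U \<subseteq> A"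
  unfolding tv_def
proof (rule INF_greatest)
  fix V assume "V \<in> {V. open V \<and> A \<subseteq> V}"
  then have "U \<subseteq> V" using that by auto
  then show "tv_open \<nu> U \<le> tv_open \<nu> V" unfolding tv_open_def by (intro SUP_subset_mono) auto
qed

definition uniform_rep where
  "uniform_rep \<nu> M h c \<longleftrightarrow> radon_rep \<nu> M h \<and> 0 \<le> c \<and> (\<forall>s. emeasure M (cball s 1) \<le> ennreal c)"

lemma uniform_rep_exists:
  assumes "is_measure \<nu>" "0 \<le> b" "\<And>t. tv \<nu> (cball t 1) \<le> ennreal b"
  obtains M h where "uniform_rep \<nu> M h (6 * b)" "\<And>K. compact K \<Longrightarrow> emeasure M K \<le> 6 * tv \<nu> K"
proof -
  obtain M h where Mh: "radon_rep \<nu> M h" "\<And>K. compact K \<Longrightarrow> emeasure M K \<le> 6 * tv \<nu> K"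
    using complex_riesz_representation[OF assms(1)] by metis
  have "emeasure M (cball s 1) \<le> ennreal (6 * b)" for s
  proof -
    have "emeasure M (cball s 1) \<le> 6 * tv \<nu> (cball s 1)" by (rule Mh(2)) simp
    also have "\<dots> \<le> 6 * ennreal b" by (intro mult_left_mono assms) simp
    also have "\<dots> = ennreal (6 * b)" using assms(2) by (simp add: ennreal_mult)
    finally show ?thesis .
  qed
  then have "uniform_rep \<nu> M h (6 * b)" using Mh(1) assms(2) by (simp add: uniform_rep_def)
  then show ?thesis by (rule that) (rule Mh(2))
qed

abbreviation ft_energy :: "('a::euclidean_space \<Rightarrow> complex) \<Rightarrow> 'a \<Rightarrow> complex" where
  "ft_energy f y \<equiv> complex_of_real ((cmod (inv_ft f y))\<^sup>2)"

lemma continuous_inv_ft_Cc: "f \<in> Cc \<Longrightarrow> continuous_on UNIV (inv_ft f)"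
  by (rule inv_ft_continuous[OF Cc_integrable])

lemma continuous_ft_energy: "f \<in> Cc \<Longrightarrow> continuous_on UNIV (ft_energy f)"
  by (rule continuous_on_of_real[OF continuous_on_power[OF continuous_on_norm[OF continuous_inv_ft_Cc]]])

text \<open>The last claim is the bridge to vague convergence: it replaces an energy by a test
  function at a cost that depends on \<open>c\<close> and \<open>\<tau>\<close> only, not on the
  measure.\<close>

lemma uniform_rep_tails:
  assumes f: "f \<in> Cc" and \<tau>: "energy_tail f \<tau>" and u: "uniform_rep \<nu> M h c"
  shows "integrable M (\<lambda>y. (cmod (inv_ft f y))\<^sup>2)"
    and "(\<integral>y. (cmod (inv_ft f y))\<^sup>2 \<partial>M) \<le> c * \<tau> 0"
    and "cmod ((\<integral>y. ft_energy f y * h y \<partial>M) - \<nu> (\<lambda>y. ft_energy f y * cutoff n y)) \<le> c * \<tau> n"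
proof -
  let ?F = "\<lambda>y. (cmod (inv_ft f y))\<^sup>2"
  have \<tau>0: "0 \<le> \<tau> n" for n using \<tau> by (simp add: energy_tail_def)
  have F0: "continuous_on UNIV ?F" by (rule continuous_on_power[OF continuous_on_norm[OF continuous_inv_ft_Cc[OF f]]])
  have rep: "radon_rep \<nu> M h" and c: "0 \<le> c" "\<forall>s. emeasure M (cball s 1) \<le> ennreal c"
    using u by (auto simp: uniform_rep_def)
  note R = radon_repD[OF rep]
  note [measurable_cong] = R(1)
  have T: "(\<integral>\<^sup>+z. ennreal (?F z) * indicator {z. real n \<le> norm z} z \<partial>M) \<le> ennreal (c * \<tau> n)" for n
    using \<tau> R(1,2) c unfolding energy_tail_def by blast
  \<comment> \<open>For \<open>n = 0\<close> the tail bound \<open>T\<close> covers the whole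
    integral; this gives integrability and the bound \<open>c * \<tau> 0\<close>.\<close>
  have [measurable]: "?F \<in> borel_measurable borel" by (rule borel_measurable_continuous_onI[OF F0])
  have nn: "(\<integral>\<^sup>+y. ennreal (?F y) \<partial>M) \<le> ennreal (c * \<tau> 0)" using T[of 0] by simp
  have i: "integrable M ?F"
    by (rule integrableI_bounded) (use nn in \<open>auto simp: order_le_less_trans\<close>)
  have "ennreal (\<integral>y. ?F y \<partial>M) = (\<integral>\<^sup>+y. ennreal (?F y) \<partial>M)"
    by (rule nn_integral_eq_integral[OF i, symmetric]) simp
  then have le: "(\<integral>y. ?F y \<partial>M) \<le> c * \<tau> 0" using nn by (metis ennreal_le_iff mult_nonneg_nonneg c(1) \<tau>0)
  let ?G = "\<lambda>y. ft_energy f y * (1 - cutoff n y)"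
  have [measurable]: "ft_energy f \<in> borel_measurable borel"
    by (rule borel_measurable_continuous_onI[OF continuous_ft_energy[OF f]])
  have [measurable]: "cutoff n \<in> borel_measurable borel" by (rule Cc_measurable[OF cutoff_Cc])
  have iF: "integrable M (ft_energy f)" by (rule integrable_of_real[OF i])
  have iG: "integrable M ?G"
    by (rule Bochner_Integration.integrable_bound[OF iF])
       (auto simp: norm_mult simp del: of_real_power intro!: mult_left_le norm_cutoff_le)
  have "\<nu> (\<lambda>y. ft_energy f y * cutoff n y) = (\<integral>y. (ft_energy f y * cutoff n y) * h y \<partial>M)"
    by (rule R(5)[OF cutoff_mult_Cc[OF continuous_ft_energy[OF f]]])
  then have "(\<integral>y. ft_energy f y * h y \<partial>M) - \<nu> (\<lambda>y. ft_energy f y * cutoff n y) = 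
    (\<integral>y. ft_energy f y * h y - (ft_energy f y * cutoff n y) * h y \<partial>M)"
    using Bochner_Integration.integral_diff[OF integrable_mult_unimodular(1)[OF iF R(3,4)] 
        R(6)[OF cutoff_mult_Cc[OF continuous_ft_energy[OF f], of n]]] by simp
  also have "\<dots> = (\<integral>y. ?G y * h y \<partial>M)" by (simp add: algebra_simps)
  also have "cmod \<dots> \<le> (\<integral>y. cmod (?G y) \<partial>M)" by (rule integrable_mult_unimodular(2)[OF iG R(3,4)])
  also have "\<dots> \<le> c * \<tau> n"
  proof -
    have "ennreal (\<integral>y. cmod (?G y) \<partial>M) = (\<integral>\<^sup>+y. ennreal (cmod (?G y)) \<partial>M)"
      by (rule nn_integral_eq_integral[symmetric]) (use iG in auto)
    also have "\<dots> \<le> (\<integral>\<^sup>+z. ennreal (?F z) * indicator {z. real n \<le> norm z} z \<partial>M)"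
    proof (rule nn_integral_mono)
      fix y
      show "ennreal (cmod (?G y)) \<le> ennreal (?F y) * indicator {z. real n \<le> norm z} y"
      proof (cases "real n \<le> norm y")
        case True
        then show ?thesis using mult_left_mono[OF norm_cutoff_le(2)[of n y], of "?F y"] 
          by (simp add: norm_mult ennreal_leI del: of_real_power)
      qed (simp add: cutoff_eq_1)
    qed
    also have "\<dots> \<le> ennreal (c * \<tau> n)" by (rule T)
    finally show ?thesis using c(1) \<tau>0[of n] by simp
  qed
  finally show "cmod ((\<integral>y. ft_energy f y * h y \<partial>M) - \<nu> (\<lambda>y. ft_energy f y * cutoff n y)) \<le> c * \<tau> n" .
  show "integrable M ?F" "(\<integral>y. ?F y \<partial>M) \<le> c * \<tau> 0" by (fact i le)+
qed

lemma uniform_rep_energy_integrable: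
  assumes "uniform_rep \<nu> M h c" "f \<in> Cc"
  shows "integrable M (\<lambda>y. (cmod (inv_ft f y))\<^sup>2)"
  using energy_tail_exists[OF assms(2)] uniform_rep_tails(1)[OF assms(2) _ assms(1)] by blast

section \<open>From convergence on energies to convergence on all test functions\<close>

lemma convergent_approx:
  fixes x :: "nat \<Rightarrow> complex"
  assumes "\<And>e. 0 < e \<Longrightarrow> \<exists>y. convergent y \<and> (\<forall>n. cmod (x n - y n) \<le> e)"
  shows "convergent x"
proof (rule Cauchy_convergent, rule metric_CauchyI)
  fix e :: real assume e: "0 < e"
  obtain y where y: "convergent y" "\<And>n. cmod (x n - y n) \<le> e / 4" using assms[of "e/4"] e by auto
  obtain N where N: "\<And>m n. N \<le> m \<Longrightarrow> N \<le> n \<Longrightarrow> dist (y m) (y n) < e / 4"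
    using convergent_Cauchy[OF y(1)] e unfolding Cauchy_def by (metis zero_less_divide_iff zero_less_numeral)
  have "dist (x m) (x n) < e" if "N \<le> m" "N \<le> n" for m n
  proof -
    have "dist (x m) (x n) \<le> dist (x m) (y m) + dist (y m) (y n) + dist (y n) (x n)"
      using dist_triangle[of "x m" "x n" "y m"] dist_triangle[of "y m" "x n" "y n"] by linarith
    then show ?thesis using N[OF that] y(2)[of m] y(2)[of n] e by (simp add: dist_norm norm_minus_commute)
  qed
  then show "\<exists>N. \<forall>m\<ge>N. \<forall>n\<ge>N. dist (x m) (x n) < e" by blast
qed

lemma inv_ft_translate:
  assumes f: "f \<in> Cc" shows "inv_ft (\<lambda>x. f (x - a)) y = inv_ft f y * wave a y"
proof -
  note [measurable] = Cc_measurable[OF f]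
  have "inv_ft (\<lambda>x. f (x - a)) y = (\<integral>x. f (x - a) * wave x y \<partial>lborel)" by (rule inv_ft_wave)
  also have "\<dots> = (\<integral>x. f (a + x - a) * wave (a + x) y \<partial>lborel)"
    by (subst lborel_distr_plus[of a, symmetric], subst integral_distr) auto
  also have "\<dots> = (\<integral>x. f x * wave x y * wave a y \<partial>lborel)"
    by (simp add: wave_add_left mult_ac)
  also have "\<dots> = inv_ft f y * wave a y" by (simp add: inv_ft_wave)
  finally show ?thesis .
qed

lemma Cc_translate:
  fixes f :: "'a::euclidean_space \<Rightarrow> complex"
  assumes f: "f \<in> Cc" shows "(\<lambda>x. f (x - a)) \<in> Cc"
proof -
  have "{x. f (x - a) \<noteq> 0} = (+) a ` {x. f x \<noteq> 0}"
    by (auto simp: image_iff intro!: exI[of _ "_ - a"])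
  then have "bounded {x. f (x - a) \<noteq> 0}" using f by (simp add: Cc_iff bounded_translation)
  then show ?thesis unfolding Cc_iff
    by (auto intro!: continuous_on_compose2[OF Cc_continuous[OF f]] continuous_intros)
qed

lemma inv_ft_add_scale:
  assumes f: "f \<in> Cc" "g \<in> Cc" shows "inv_ft (\<lambda>x. f x + c * g x) y = inv_ft f y + c * inv_ft g y"
proof -
  have i: "integrable lborel (\<lambda>x. f x * wave x y)" if "f \<in> Cc" for f
    by (rule Cc_integrable[OF Cc_mult[OF that]]) (intro continuous_intros)
  show ?thesis unfolding inv_ft_wave using i[OF f(1)] i[OF f(2)] by (simp add: distrib_right mult.assoc)
qed

text \<open>The apparently idle factors \<open>1 *\<close> and \<open>(-1) *\<close> keep all four
  arguments in the shape \<open>p + b * q\<close>, which is that of the transform of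
  \<open>f + b * fa\<close> below.\<close>

lemma polarization_complex:
  fixes p q :: complex
  shows "cnj p * q = (1/4) * complex_of_real ((cmod (p + 1 * q))\<^sup>2) + (- \<i>/4) * complex_of_real ((cmod (p + \<i> * q))\<^sup>2)
    + (-1/4) * complex_of_real ((cmod (p + (-1) * q))\<^sup>2) + (\<i>/4) * complex_of_real ((cmod (p + (-\<i>) * q))\<^sup>2)"
  by (simp only: cmod_power2) (simp add: complex_eq_iff power2_eq_square algebra_simps)

text \<open>The energies of \<open>f\<close> and of translates of \<open>f\<close> generate, by polarization, all products of the
  energy of \<open>f\<close> with a character; integrating over characters gives a uniformly dense set.\<close>

lemma vague_convergence_from_energies:
  fixes \<nu> :: "nat \<Rightarrow> ('a::euclidean_space \<Rightarrow> complex) \<Rightarrow> complex"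
  assumes rep: "\<And>n. uniform_rep (\<nu> n) (M n) (h n) c"
    and conv: "\<And>f. f \<in> Cc \<Longrightarrow> convergent (\<lambda>n. \<integral>y. ft_energy f y * h n y \<partial>M n)"
    and g: "g \<in> Cc"
  shows "convergent (\<lambda>n. \<nu> n g)"
proof (rule convergent_approx)
  fix e :: real assume e: "0 < e"
  let ?S = "closure {x. g x \<noteq> 0}"
  obtain \<phi> where \<phi>: "\<phi> \<in> Ccp" "\<And>y. y \<in> ?S \<Longrightarrow> inv_ft (\<lambda>x. complex_of_real (\<phi> x)) y \<noteq> 0"
    using inv_ft_bump[OF Cc_closure_nonzero[OF g]] by metis
  define f where "f = (\<lambda>x. complex_of_real (\<phi> x))"
  have f: "f \<in> Cc" unfolding f_def by (rule Ccp_of_real[OF \<phi>(1)])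
  obtain \<tau> where \<tau>: "energy_tail f \<tau>" using energy_tail_exists[OF f] by blast
  have R: "radon_rep (\<nu> n) (M n) (h n)" for n using rep[of n] by (simp add: uniform_rep_def)
  have c: "0 \<le> c" using rep[of 0] by (simp add: uniform_rep_def)
  define B where "B = c * \<tau> 0"
  have B: "0 \<le> B" using c \<tau> by (simp add: B_def energy_tail_def)
  have En: "(\<integral>y. cmod (ft_energy f y) \<partial>M n) \<le> B" for n
    using uniform_rep_tails(2)[OF f \<tau> rep[of n]] by (simp add: B_def norm_power)
  have iE: "integrable (M n) (ft_energy f)" for n by (rule integrable_of_real[OF uniform_rep_energy_integrable[OF rep f]])
  have sM: "sets (M n) = sets borel" for n by (rule radon_repD(1)[OF R])
  note [measurable_cong] = sM
  have hm[measurable]: "h n \<in> borel_measurable (M n)" for n by (rule radon_repD(3)[OF R])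
  have h1: "AE x in M n. cmod (h n x) = 1" for n by (rule radon_repD(4)[OF R])
  have iEh: "integrable (M n) (\<lambda>y. ft_energy f y * h n y)" for n
    by (rule integrable_mult_unimodular(1)[OF iE hm h1])
  have [measurable]: "ft_energy f \<in> borel_measurable borel" 
    by (rule borel_measurable_continuous_onI[OF continuous_ft_energy[OF f]])
  have [measurable]: "inv_ft f \<in> borel_measurable borel" by (rule inv_ft_measurable[OF Cc_integrable[OF f]])
  have nE: "ft_energy f y \<noteq> 0" if "y \<in> ?S" for y using \<phi>(2)[OF that] by (simp add: f_def)
  \<comment> \<open>With \<open>g\<close> written as the energy of \<open>f\<close> times
    \<open>u\<close>, a uniform error in \<open>u\<close> costs at most that error times the
    integral of the energy, which is bounded by \<open>B\<close> for all \<open>n\<close>.\<close>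
  define u where "u = (\<lambda>y. g y / ft_energy f y)"
  have u: "u \<in> Cc" unfolding u_def by (rule Cc_divide[OF g continuous_ft_energy[OF f] nE])
  have gu: "g y = ft_energy f y * u y" for y
    using nE[of y] closure_subset[of "{x. g x \<noteq> 0}"] by (auto simp: u_def)

  define D where "D = (\<lambda>n a. \<integral>y. ft_energy f y * h n y * wave a y \<partial>M n)"
  have D_bound: "cmod (D n a) \<le> B" for n a
  proof -
    have "cmod (D n a) \<le> (\<integral>y. cmod (ft_energy f y * h n y * wave a y) \<partial>M n)"
      unfolding D_def by (rule integral_norm_bound)
    also have "\<dots> = (\<integral>y. cmod (ft_energy f y) \<partial>M n)"
      by (rule integral_cong_AE) (use h1[of n] in \<open>auto simp: norm_mult simp del: of_real_power\<close>)
    finally show ?thesis using En[of n] by linarith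
  qed
  have D_cont: "continuous_on UNIV (D n)" for n unfolding D_def
  proof (rule continuous_integral_dominated)
    show "continuous_on UNIV (\<lambda>a. ft_energy f y * h n y * wave a y)" for y by (intro continuous_intros)
    show "(\<lambda>y. ft_energy f y * h n y * wave a y) \<in> borel_measurable (M n)" for a by measurable
    show "cmod (ft_energy f y * h n y * wave a y) \<le> cmod (ft_energy f y * h n y)" for a y
      by (simp add: norm_mult del: of_real_power)
    show "integrable (M n) (\<lambda>y. cmod (ft_energy f y * h n y))" by (rule integrable_norm[OF iEh])
  qed
  have Dm[measurable]: "D n \<in> borel_measurable borel" for n by (rule borel_measurable_continuous_onI[OF D_cont])
  have D_conv: "convergent (\<lambda>n. D n a)" for a
  proof -
    \<comment> \<open>Translation by \<open>a\<close> multiplies the transform by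
      \<open>wave a\<close>, so \<open>cnj (inv_ft f y)\<close> times the transform of
      \<open>fa\<close> is the energy times the character. Polarization expresses it by energies of
      the \<open>k b\<close>.\<close>
    define fa where "fa = (\<lambda>x. f (x - a))"
    have fa: "fa \<in> Cc" unfolding fa_def by (rule Cc_translate[OF f])
    define k where "k = (\<lambda>b::complex. \<lambda>x. f x + b * fa x)"
    have k: "k b \<in> Cc" for b unfolding k_def by (intro Cc_add f Cc_scale fa)
    have kft: "inv_ft (k b) y = inv_ft f y + b * (inv_ft f y * wave a y)" for b y
      unfolding k_def inv_ft_add_scale[OF f fa] unfolding fa_def inv_ft_translate[OF f] ..
    have kint: "integrable (M n) (\<lambda>y. ft_energy (k b) y * h n y)" for b n
      using uniform_rep_energy_integrable[OF rep k] by (intro integrable_mult_unimodular(1)[OF _ hm h1] integrable_of_real)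
    have "ft_energy f y * h n y * wave a y = (1/4) * (ft_energy (k 1) y * h n y) + (-\<i>/4) * (ft_energy (k \<i>) y * h n y)
      + (-1/4) * (ft_energy (k (-1)) y * h n y) + (\<i>/4) * (ft_energy (k (-\<i>)) y * h n y)" for n y
    proof -
      have "ft_energy f y * h n y * wave a y = (cnj (inv_ft f y) * (inv_ft f y * wave a y)) * h n y"
        using complex_norm_square[of "inv_ft f y"] by (simp add: mult_ac)
      then show ?thesis unfolding polarization_complex kft by (simp only: distrib_right mult.assoc)
    qed
    then have "D n a = (1/4) * (\<integral>y. ft_energy (k 1) y * h n y \<partial>M n) + (-\<i>/4) * (\<integral>y. ft_energy (k \<i>) y * h n y \<partial>M n)
      + (-1/4) * (\<integral>y. ft_energy (k (-1)) y * h n y \<partial>M n) + (\<i>/4) * (\<integral>y. ft_energy (k (-\<i>)) y * h n y \<partial>M n)" for n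
      unfolding D_def using kint[where n = n]
      by (simp only: Bochner_Integration.integral_add Bochner_Integration.integrable_add integrable_mult_right integral_mult_right_zero)
    then show ?thesis
      by (simp only:) (intro convergent_add convergent_mult convergent_const conv k)
  qed
  \<comment> \<open>The denominator is \<open>B + 1\<close> because \<open>B\<close> may be
    0.\<close>
  define e' where "e' = e / (B + 1)"
  have e': "0 < e'" using e B by (simp add: e'_def)
  obtain w where w: "integrable lborel w" "\<And>y. cmod (inv_ft w y - u y) \<le> e'"
    using inv_ft_uniformly_dense[OF u e'] by metis
  \<comment> \<open>\<open>Y\<close> has \<open>inv_ft w\<close> in place of \<open>u\<close>.
    Fubini turns it into the integral of \<open>w\<close> against \<open>D n\<close>, where
    pointwise convergence of \<open>D n\<close> and the majorant \<open>B * cmod (w a)\<close>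
    suffice.\<close>
  define Y where "Y = (\<lambda>n. \<integral>y. ft_energy f y * h n y * inv_ft w y \<partial>M n)"
  have Y_eq: "Y n = (\<integral>a. w a * D n a \<partial>lborel)" for n
  proof -
    have [measurable]: "(\<lambda>(y, a). wave a y) \<in> borel_measurable (M n \<Otimes>\<^sub>M lborel)"
      by measurable
    show ?thesis unfolding Y_def D_def inv_ft_wave[of w]
      by (rule Fubini_kernel[OF radon_repD(2)[OF R] sigma_finite_lborel iEh w(1), where B = 1]) auto
  qed
  have "convergent Y"
  proof -
    define L where "L = (\<lambda>a. lim (\<lambda>n. D n a))"
    have L: "(\<lambda>n. D n a) \<longlonglongrightarrow> L a" for a using D_conv[of a] by (simp add: L_def convergent_LIMSEQ_iff)
    have [measurable]: "L \<in> borel_measurable borel" by (rule borel_measurable_LIMSEQ_metric[OF Dm L])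
    have wm[measurable]: "w \<in> borel_measurable borel" using w(1) by auto
    have "Y \<longlonglongrightarrow> (\<integral>a. w a * L a \<partial>lborel)" unfolding Y_eq[abs_def]
    proof (rule integral_dominated_convergence[where w = "\<lambda>a. B * cmod (w a)"])
      show "integrable lborel (\<lambda>a. B * cmod (w a))" using w(1) by simp
      show "AE a in lborel. (\<lambda>n. w a * D n a) \<longlonglongrightarrow> w a * L a" by (intro AE_I2 tendsto_mult tendsto_const L)
      show "AE a in lborel. norm (w a * D n a) \<le> B * cmod (w a)" for n
        using mult_left_mono[OF D_bound norm_ge_zero] by (auto simp: norm_mult mult.commute)
    qed auto
    then show ?thesis by (auto simp: convergent_def)
  qed
  moreover have "cmod (\<nu> n g - Y n) \<le> e" for n
  proof -
    have [measurable]: "inv_ft w \<in> borel_measurable borel" by (rule inv_ft_measurable[OF w(1)])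
    have iw: "integrable (M n) (\<lambda>y. ft_energy f y * h n y * inv_ft w y)"
    proof (rule Bochner_Integration.integrable_bound)
      let ?C = "\<integral>x. cmod (w x) \<partial>lborel"
      show "integrable (M n) (\<lambda>y. complex_of_real ?C * (ft_energy f y * h n y))" by (intro integrable_mult_right iEh)
      have C0: "0 \<le> ?C" by (rule Bochner_Integration.integral_nonneg) simp
      show "AE y in M n. norm (ft_energy f y * h n y * inv_ft w y) \<le> norm (complex_of_real ?C * (ft_energy f y * h n y))"
      proof (rule AE_I2)
        fix y
        show "norm (ft_energy f y * h n y * inv_ft w y) \<le> norm (complex_of_real ?C * (ft_energy f y * h n y))"
          using mult_left_mono[OF norm_inv_ft_le[OF w(1), of y], of "cmod (ft_energy f y * h n y)"] C0
          by (simp add: norm_mult mult_ac del: of_real_power)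
      qed
    qed measurable
    have ig: "integrable (M n) (\<lambda>y. g y * h n y)" by (rule radon_repD(6)[OF R g])
    have "\<nu> n g - Y n = (\<integral>y. g y * h n y - ft_energy f y * h n y * inv_ft w y \<partial>M n)"
      unfolding radon_repD(5)[OF R g] Y_def by (rule Bochner_Integration.integral_diff[OF ig iw, symmetric])
    also have "\<dots> = (\<integral>y. (ft_energy f y * (u y - inv_ft w y)) * h n y \<partial>M n)"
      unfolding gu by (simp only: right_diff_distrib left_diff_distrib mult_ac)
    also have "cmod \<dots> \<le> (\<integral>y. cmod (ft_energy f y * (u y - inv_ft w y) * h n y) \<partial>M n)"
      by (rule integral_norm_bound)
    also have "\<dots> \<le> (\<integral>y. e' * cmod (ft_energy f y) \<partial>M n)"
    proof (rule integral_mono_AE)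
      have "(\<lambda>y. (ft_energy f y * (u y - inv_ft w y)) * h n y) = (\<lambda>y. g y * h n y - ft_energy f y * h n y * inv_ft w y)"
        unfolding gu by (simp only: right_diff_distrib left_diff_distrib mult_ac)
      then show "integrable (M n) (\<lambda>y. cmod (ft_energy f y * (u y - inv_ft w y) * h n y))"
        using Bochner_Integration.integrable_diff[OF ig iw] by (simp add: integrable_norm)
      show "integrable (M n) (\<lambda>y. e' * cmod (ft_energy f y))" by (intro integrable_mult_right integrable_norm iE)
      show "AE y in M n. cmod (ft_energy f y * (u y - inv_ft w y) * h n y) \<le> e' * cmod (ft_energy f y)"
        using h1
      proof eventually_elim
        case (elim y)
        show ?case using mult_left_mono[OF w(2)[of y], of "cmod (ft_energy f y)"] elim
          by (simp add: norm_mult norm_minus_commute mult_ac del: of_real_power)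
      qed
    qed
    also have "\<dots> \<le> e' * B" using En[of n] e' by (simp add: mult_left_mono del: of_real_power)
    also have "\<dots> \<le> e" using e B by (simp add: e'_def field_simps)
    finally show ?thesis .
  qed
  ultimately show "\<exists>Y. convergent Y \<and> (\<forall>n. cmod (\<nu> n g - Y n) \<le> e)" by blast
qed

lemma image_add_cball: "(\<lambda>x. t + x) ` cball 0 r = cball (t::'a::euclidean_space) r"
  using cball_translation[of t 0 r] by simp

theorem theorem4p13:
  fixes \<mu>s \<nu>s :: "nat \<Rightarrow> (('a::euclidean_space \<Rightarrow> complex) \<Rightarrow> complex)"
    and \<mu> :: "('a \<Rightarrow> complex) \<Rightarrow> complex"
  assumes meas: "\<And>n. is_measure (\<mu>s n)"
    and ft: "\<And>n. is_fourier_transform (\<mu>s n) (\<nu>s n)"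
    and mu_meas: "is_measure \<mu>"
    and vague: "vague_conv \<mu>s \<mu>"
    and temp: "tempered \<mu>"
    and etb: "equi_translation_bounded \<nu>s"
  shows "\<exists>\<nu>. is_fourier_transform \<mu> \<nu> \<and> vague_conv \<nu>s \<nu>"
proof -
  have \<nu>s: "is_measure (\<nu>s n)" for n using ft[of n] by (simp add: is_fourier_transform_def)
  have tv_bound: "\<exists>b\<ge>0. \<forall>n t. tv (\<nu>s n) ((\<lambda>x. t + x) ` K) \<le> ennreal b" if K: "compact K" for K
  proof -
    have fin: "(SUP n. SUP t. tv (\<nu>s n) ((\<lambda>x. t + x) ` K)) < \<infinity>"
      using etb K unfolding equi_translation_bounded_def by blast
    then obtain b where b: "(SUP n. SUP t. tv (\<nu>s n) ((\<lambda>x. t + x) ` K)) = ennreal b" "0 \<le> b"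
      by (cases "SUP n. SUP t. tv (\<nu>s n) ((\<lambda>x. t + x) ` K)") auto
    have "tv (\<nu>s n) ((\<lambda>x. t + x) ` K) \<le> ennreal b" for n t
      unfolding b(1)[symmetric] by (rule SUP_upper2[of n], simp, rule SUP_upper) simp
    then show ?thesis using b(2) by blast
  qed
  \<comment> \<open>Radius 2 leaves room for an open ball between \<open>cball t 1\<close> and
    \<open>cball t 2\<close> when the bound is passed to the limit functional.\<close>
  obtain b where b: "0 \<le> b" "\<And>n t. tv (\<nu>s n) (cball t 2) \<le> ennreal b"
    using tv_bound[of "cball 0 2"] unfolding image_add_cball by auto
  have b1: "tv (\<nu>s n) (cball t 1) \<le> ennreal b" for n t
    by (rule order_trans[OF tv_mono b(2)[of n t]]) (rule subset_cball, simp)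
  have "\<exists>M h. uniform_rep (\<nu>s n) M h (6 * b) \<and> (\<forall>K. compact K \<longrightarrow> emeasure M K \<le> 6 * tv (\<nu>s n) K)" for n
    using uniform_rep_exists[OF \<nu>s[of n] b(1) b1[of n]] by metis
  then obtain M h where rep: "\<And>n. uniform_rep (\<nu>s n) (M n) (h n) (6 * b)" 
    and MK: "\<And>n K. compact K \<Longrightarrow> emeasure (M n) K \<le> 6 * tv (\<nu>s n) K" by metis
  have R: "radon_rep (\<nu>s n) (M n) (h n)" for n using rep[of n] by (simp add: uniform_rep_def)

  have energy: "(\<integral>y. ft_energy f y * h n y \<partial>M n) = \<mu>s n (conv f (tilde f))" if f: "f \<in> Cc" for f n
  proof -
    obtain M' h' where M': "radon_rep (\<nu>s n) M' h'" "integrable M' (\<lambda>y. (cmod (inv_ft f y))\<^sup>2)"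
      "\<mu>s n (conv f (tilde f)) = (\<integral>y. ft_energy f y * h' y \<partial>M')"
      using ft[of n] f unfolding is_fourier_transform_def by blast
    show ?thesis unfolding M'(3)
      by (rule radon_rep_integral_unique[OF R M'(1) continuous_ft_energy[OF f] 
            integrable_of_real[OF uniform_rep_energy_integrable[OF rep f]] integrable_of_real[OF M'(2)]])
  qed
  have energy_lim: "(\<lambda>n. \<integral>y. ft_energy f y * h n y \<partial>M n) \<longlonglongrightarrow> \<mu> (conv f (tilde f))" if f: "f \<in> Cc" for f
    unfolding energy[OF f] using vague conv_tilde_Cc[OF f] by (simp add: vague_conv_def)

  \<comment> \<open>\<open>lim\<close> is total; its value is meaningful for \<open>g\<close> in
    \<open>Cc\<close>, where convergence is established next.\<close>
  define \<nu> where "\<nu> = (\<lambda>g. lim (\<lambda>n. \<nu>s n g))"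
  have lim: "(\<lambda>n. \<nu>s n g) \<longlonglongrightarrow> \<nu> g" if g: "g \<in> Cc" for g
    using vague_convergence_from_energies[OF rep convergentI[OF energy_lim] g]
    by (simp add: \<nu>_def convergent_LIMSEQ_iff)
  have \<nu>: "is_measure \<nu>" unfolding is_measure_def
  proof (intro conjI ballI allI impI)
    fix f g :: "'a \<Rightarrow> complex" assume fg: "f \<in> Cc" "g \<in> Cc"
    have "(\<lambda>n. \<nu>s n (\<lambda>x. f x + g x)) \<longlonglongrightarrow> \<nu> f + \<nu> g"
      unfolding meas_add[OF \<nu>s fg] by (intro tendsto_add lim fg)
    then show "\<nu> (\<lambda>x. f x + g x) = \<nu> f + \<nu> g" using lim[OF Cc_add[OF fg]] LIMSEQ_unique by blast
  next
    fix c and g :: "'a \<Rightarrow> complex" assume g: "g \<in> Cc"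
    have "(\<lambda>n. \<nu>s n (\<lambda>x. c * g x)) \<longlonglongrightarrow> c * \<nu> g"
      unfolding meas_scale[OF \<nu>s g] by (intro tendsto_mult tendsto_const lim g)
    then show "\<nu> (\<lambda>x. c * g x) = c * \<nu> g" using lim[OF Cc_scale[OF g]] LIMSEQ_unique by blast
  next
    fix K :: "'a set" assume K: "compact K"
    obtain bK where bK: "0 \<le> bK" "\<And>n. tv (\<nu>s n) K \<le> ennreal bK"
    proof -
      obtain bK where *: "0 \<le> bK" "\<forall>n t. tv (\<nu>s n) ((\<lambda>x. t + x) ` K) \<le> ennreal bK" using tv_bound[OF K] by blast
      have "tv (\<nu>s n) K \<le> ennreal bK" for n using *(2)[rule_format, of n 0] by simp
      then show ?thesis using *(1) that by blast
    qed
    show "\<exists>a. \<forall>g\<in>Cc. supp g \<subseteq> K \<longrightarrow> cmod (\<nu> g) \<le> a * supn g"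
    proof (intro exI ballI impI)
      fix g :: "'a \<Rightarrow> complex" assume g: "g \<in> Cc" "supp g \<subseteq> K"
      have "cmod (\<nu>s n g) \<le> 6 * bK * supn g" for n
      proof -
        have s0: "0 \<le> supn g" using supn_upper[OF g(1), of 0] norm_ge_zero order_trans by blast
        have sM: "sets (M n) = sets borel" by (rule radon_repD(1)[OF R])
        have KM: "K \<in> sets (M n)" using K by (simp add: sM borel_compact)
        have "emeasure (M n) K \<le> 6 * ennreal bK" by (rule order_trans[OF MK[OF K]]) (intro mult_left_mono bK; simp)
        also have "\<dots> = ennreal (6 * bK)" using bK by (simp add: ennreal_mult)
        finally have eK: "emeasure (M n) K \<le> ennreal (6 * bK)" .
        have fin: "emeasure (M n) K < \<infinity>" using eK by (rule le_less_trans) simp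
        have mK: "measure (M n) K \<le> 6 * bK" using eK bK(1) unfolding measure_def
          by (intro enn2real_leI) auto
        have "cmod (\<nu>s n g) \<le> (\<integral>x. cmod (g x * h n x) \<partial>M n)"
          unfolding radon_repD(5)[OF R g(1)] by (rule integral_norm_bound)
        also have "\<dots> \<le> (\<integral>x. supn g * indicator K x \<partial>M n)"
        proof (rule integral_mono_AE)
          show "integrable (M n) (\<lambda>x. cmod (g x * h n x))" by (intro integrable_norm radon_repD(6)[OF R g(1)])
          show "integrable (M n) (\<lambda>x. supn g * indicator K x)"
            by (intro integrable_mult_right integrable_real_indicator KM fin)
          show "AE x in M n. cmod (g x * h n x) \<le> supn g * indicator K x"
            using radon_repD(4)[OF R]
          proof eventually_elim
            case (elim x)
            have "x \<notin> K \<Longrightarrow> g x = 0" using g(2) closure_subset[of "{x. g x \<noteq> 0}"] by (auto simp: supp_def)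
            then show ?case using supn_upper[OF g(1), of x] elim by (auto simp: norm_mult indicator_def)
          qed
        qed
        also have "\<dots> = supn g * measure (M n) K" using KM by (simp add: sets.Int_space_eq2)
        also have "\<dots> \<le> supn g * (6 * bK)" by (rule mult_left_mono[OF mK s0])
        finally show ?thesis by (simp add: mult.commute)
      qed
      then show "cmod (\<nu> g) \<le> 6 * bK * supn g"
        using Lim_bounded[OF tendsto_norm[OF lim[OF g(1)]]] by blast
    qed
  qed
  \<comment> \<open>Lower semicontinuity: on an open set the variation is a supremum over test
    functions, and each single value is bounded along the sequence.\<close>
  have \<nu>_tv: "tv \<nu> (cball t 1) \<le> ennreal b" for t
  proof -
    have "tv \<nu> (cball t 1) \<le> tv_open \<nu> (ball t 2)"
      by (rule tv_le_tv_open) auto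
    also have "\<dots> \<le> ennreal b" unfolding tv_open_def
    proof (rule SUP_least, clarify)
      fix g :: "'a \<Rightarrow> complex" assume g: "g \<in> Cc" "supp g \<subseteq> ball t 2" "supn g \<le> 1"
      have "cmod (\<nu>s n g) \<le> b" for n
      proof -
        have "ennreal (cmod (\<nu>s n g)) \<le> tv_open (\<nu>s n) (ball t 2)"
          unfolding tv_open_def by (rule SUP_upper) (use g in auto)
        also have "\<dots> \<le> tv (\<nu>s n) (cball t 2)" by (rule tv_open_le_tv) auto
        also have "\<dots> \<le> ennreal b" by (rule b(2))
        finally show ?thesis using b(1) by simp
      qed
      then have "cmod (\<nu> g) \<le> b" using Lim_bounded[OF tendsto_norm[OF lim[OF g(1)]]] by blast
      then show "ennreal (cmod (\<nu> g)) \<le> ennreal b" by (rule ennreal_leI)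
    qed
    finally show ?thesis .
  qed
  obtain N k where Nk: "uniform_rep \<nu> N k (6 * b)"
    using uniform_rep_exists[OF \<nu> b(1) \<nu>_tv] by metis
  have "\<mu> (conv f (tilde f)) = (\<integral>y. ft_energy f y * k y \<partial>N)" if f: "f \<in> Cc" for f
  proof -
    obtain \<tau> where \<tau>: "\<tau> \<longlonglongrightarrow> 0" "energy_tail f \<tau>" using energy_tail_exists[OF f] by blast
    define J where "J = (\<lambda>n. \<integral>y. ft_energy f y * h n y \<partial>M n)"
    define J' where "J' = (\<integral>y. ft_energy f y * k y \<partial>N)"
    \<comment> \<open>Two truncation errors of \<open>6 * b * \<tau> m\<close> each, one for
      \<open>M n\<close> and one for \<open>N\<close>. With \<open>m\<close> fixed, vague
      convergence on the truncated energy removes the middle term as \<open>n\<close> grows; only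
      afterwards does \<open>m\<close> tend to infinity.\<close>
    have diff: "cmod (\<mu> (conv f (tilde f)) - J') \<le> 12 * b * \<tau> m" for m
    proof -
      let ?g = "\<lambda>y. ft_energy f y * cutoff m y"
      have g: "?g \<in> Cc" by (rule cutoff_mult_Cc[OF continuous_ft_energy[OF f]])
      have "cmod (J n - J') \<le> 12 * b * \<tau> m + cmod (\<nu>s n ?g - \<nu> ?g)" for n
      proof -
        have "cmod (J n - \<nu>s n ?g) \<le> 6 * b * \<tau> m" unfolding J_def by (rule uniform_rep_tails(3)[OF f \<tau>(2) rep])
        moreover have "cmod (J' - \<nu> ?g) \<le> 6 * b * \<tau> m" unfolding J'_def by (rule uniform_rep_tails(3)[OF f \<tau>(2) Nk])
        moreover have "cmod (z - z') \<le> cmod (z - w) + cmod (w - w') + cmod (z' - w')" for z z' w w' :: complex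
          using norm_triangle_ineq4[of "(z - w) + (w - w')" "z' - w'"] norm_triangle_ineq[of "z - w" "w - w'"] by simp
        then have "cmod (J n - J') \<le> cmod (J n - \<nu>s n ?g) + cmod (\<nu>s n ?g - \<nu> ?g) + cmod (J' - \<nu> ?g)" .
        ultimately show ?thesis by linarith
      qed
      moreover have "(\<lambda>n. cmod (J n - J')) \<longlonglongrightarrow> cmod (\<mu> (conv f (tilde f)) - J')"
        unfolding J_def by (intro tendsto_norm tendsto_diff energy_lim f tendsto_const)
      moreover have "(\<lambda>n. 12 * b * \<tau> m + cmod (\<nu>s n ?g - \<nu> ?g)) \<longlonglongrightarrow> 12 * b * \<tau> m + cmod (\<nu> ?g - \<nu> ?g)"
        by (intro tendsto_intros lim g)
      ultimately have "cmod (\<mu> (conv f (tilde f)) - J') \<le> 12 * b * \<tau> m + cmod (\<nu> ?g - \<nu> ?g)"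
        by (intro LIMSEQ_le) auto
      then show ?thesis by simp
    qed
    have "(\<lambda>m. 12 * b * \<tau> m) \<longlonglongrightarrow> 12 * b * 0" by (intro tendsto_intros \<tau>(1))
    then have "cmod (\<mu> (conv f (tilde f)) - J') \<le> 12 * b * 0"
      by (rule LIMSEQ_le_const) (use diff in blast)
    then show ?thesis by (simp add: J'_def)
  qed
  moreover have "radon_rep \<nu> N k" using Nk by (simp add: uniform_rep_def)
  ultimately have "is_fourier_transform \<mu> \<nu>"
    unfolding is_fourier_transform_def using \<nu> uniform_rep_energy_integrable[OF Nk] by blast
  moreover have "vague_conv \<nu>s \<nu>" unfolding vague_conv_def using lim by blast
  ultimately show ?thesis by blast
qed

end
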